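(* Let $n\ge 1$, $s\ge 1$, and let $F=L_1\cdots L_s\in\Delta_{n,s}$ be a generic point, where $L_1,\dots,L_s\in T_1$. Let $X_F=\bigcup_{i\neq j}\{L_i=0\}\cap\{L_j=0\}\subset\check{\mathbb{P}}^n$. Then the (embedded projective) tangent space to $\Delta_{n,s}\subset \mathbb{P}T_s$ at $F$ is \[T_F(\Delta_{n,s})=|sH-X_F|=\{\text{hypersurfaces of degree } s \text{ in } \check{\mathbb{P}}^n \text{ passing through } X_F\}.\] Moreover, $\deg\Delta_{n,s}$ equals the number of (unordered) $s$-uples of hyperplanes of $\check{\mathbb{P}}^n$ passing through $ns$ generic points of $\check{\mathbb{P}}^n$ (i.e. whose union contains the $ns$ points), and \[\deg\Delta_{n,s}=\binom{ns-1}{n-1}\cdot\binom{n(s-1)-1}{n-1}\cdots 1=\prod_{k=1}^{s}\binom{nk-1}{n-1}.\]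
   Context: Let $S=\mathbb{C}[X_0,\dots,X_n]$ and $T=\mathbb{C}[\partial_0,\dots,\partial_n]$; $S_1$ and $T_1$ are dual to each other via differentiation ($\partial_i$ acts as $\partial/\partial X_i$), and $\check{\mathbb{P}}^n=\mathbb{P}S_1$. Thus $T$ is the homogeneous coordinate ring of $\check{\mathbb{P}}^n$, and points of $\mathbb{P}T_s$ are identified with degree $s$ hypersurfaces of $\check{\mathbb{P}}^n$. $\Delta_{n,s}\subset\mathbb{P}T_s$ is the variety of totally decomposable forms of degree $s$: its points are the classes of forms which can be written as a product of $s$ linear forms in $T_1$. It is the Chow variety of zero-dimensional degree $s$ cycles in $\mathbb{P}^n=\mathbb{P}T_1$. "Generic" means in a suitable nonempty Zariski open subset. $H$ denotes the hyperplane class of $\check{\mathbb{P}}^n$. *)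

theory Defs
  imports
    Complex_Main
    "HOL-Library.Poly_Mapping"
    "HOL-Library.Multiset"
    "HOL-Library.FuncSet"
    "HOL-Computational_Algebra.Polynomial"
begin

section \<open>Coordinate spaces and their projectivizations\<close>

text \<open>
  Vectors are finitely supported functions \<open>'i \<Rightarrow>\<^sub>0 complex\<close>; for a finite index set \<open>I\<close>,
  the space \<open>\<complex>\<^sup>I\<close> is the set of those supported in \<open>I\<close>.
  Polynomials \<open>('i \<Rightarrow>\<^sub>0 nat) \<Rightarrow>\<^sub>0 complex\<close> are vectors indexed by exponent vectors, so spaces of
  forms are again coordinate spaces (with their coefficients as coordinates), and hence have
  projectivizations and polynomial functions of their own.
\<close>

definition scale_pm :: "complex \<Rightarrow> ('i \<Rightarrow>\<^sub>0 complex) \<Rightarrow> ('i \<Rightarrow>\<^sub>0 complex)" where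
  "scale_pm c v = Poly_Mapping.map ((*) c) v"

lemma lookup_scale_pm [simp]:
  "Poly_Mapping.lookup (scale_pm c v) i = c * Poly_Mapping.lookup v i"
  unfolding scale_pm_def by (simp add: Poly_Mapping.map.rep_eq when_def)

global_interpretation pm: vector_space scale_pm
  by standard (auto intro!: poly_mapping_eqI simp: lookup_add algebra_simps)

definition coord_space :: "'i set \<Rightarrow> ('i \<Rightarrow>\<^sub>0 complex) set" where
  "coord_space I = {v. Poly_Mapping.keys v \<subseteq> I}"

text \<open>A point of a projective space is a class of nonzero vectors modulo \<open>\<complex>\<^sup>*\<close>.\<close>

definition proj_pt :: "('i \<Rightarrow>\<^sub>0 complex) \<Rightarrow> ('i \<Rightarrow>\<^sub>0 complex) set" where
  "proj_pt v = {scale_pm c v | c. c \<noteq> 0}"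

definition proj_space :: "'i set \<Rightarrow> ('i \<Rightarrow>\<^sub>0 complex) set set" where
  "proj_space I = {proj_pt v | v. v \<in> coord_space I \<and> v \<noteq> 0}"

section \<open>Polynomials and forms\<close>

type_synonym 'i mpol = "('i \<Rightarrow>\<^sub>0 nat) \<Rightarrow>\<^sub>0 complex"

definition monomials :: "'i set \<Rightarrow> nat \<Rightarrow> ('i \<Rightarrow>\<^sub>0 nat) set" where
  "monomials I d =
     {m. Poly_Mapping.keys m \<subseteq> I \<and> (\<Sum>i\<in>Poly_Mapping.keys m. Poly_Mapping.lookup m i) = d}"

definition forms :: "'i set \<Rightarrow> nat \<Rightarrow> 'i mpol set" where
  "forms I d = coord_space (monomials I d)"

definition mp_eval :: "('i \<Rightarrow> complex) \<Rightarrow> 'i mpol \<Rightarrow> complex" where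
  "mp_eval x p =
     (\<Sum>m\<in>Poly_Mapping.keys p. Poly_Mapping.lookup p m *
        (\<Prod>i\<in>Poly_Mapping.keys m. x i ^ Poly_Mapping.lookup m i))"

definition mp_deriv :: "'i \<Rightarrow> 'i mpol \<Rightarrow> 'i mpol" where
  "mp_deriv i p =
     (\<Sum>m\<in>Poly_Mapping.keys p.
        Poly_Mapping.single (m - Poly_Mapping.single i 1)
          (of_nat (Poly_Mapping.lookup m i) * Poly_Mapping.lookup p m))"

definition vanishes_at :: "'i mpol \<Rightarrow> ('i \<Rightarrow>\<^sub>0 complex) set \<Rightarrow> bool" where
  "vanishes_at p z \<longleftrightarrow> (\<forall>v\<in>z. mp_eval (Poly_Mapping.lookup v) p = 0)"

section \<open>Zariski topology\<close>

definition proj_closed :: "'i set \<Rightarrow> ('i \<Rightarrow>\<^sub>0 complex) set set \<Rightarrow> bool" where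
  "proj_closed I C \<longleftrightarrow>
     (\<exists>A \<subseteq> (\<Union>d. forms I d). C = {z \<in> proj_space I. \<forall>p\<in>A. vanishes_at p z})"

definition proj_open_in ::
  "'i set \<Rightarrow> ('i \<Rightarrow>\<^sub>0 complex) set set \<Rightarrow> ('i \<Rightarrow>\<^sub>0 complex) set set \<Rightarrow> bool" where
  "proj_open_in I Z U \<longleftrightarrow> (\<exists>C. proj_closed I C \<and> U = Z - C)"

text \<open>
  The product \<open>\<P>(\<complex>\<^sup>I)\<^sup>K\<close> carries the Zariski topology whose closed sets are the zero loci of
  multihomogeneous polynomials in the variables \<open>(k, i) \<in> K \<times> I\<close>.
\<close>

definition multiforms :: "'k set \<Rightarrow> 'i set \<Rightarrow> ('k \<Rightarrow> nat) \<Rightarrow> ('k \<times> 'i) mpol set" where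
  "multiforms K I e =
     {p. \<forall>m\<in>Poly_Mapping.keys p. Poly_Mapping.keys m \<subseteq> K \<times> I \<and>
           (\<forall>k\<in>K. (\<Sum>i\<in>I. Poly_Mapping.lookup m (k, i)) = e k)}"

definition multiproj_space :: "'k set \<Rightarrow> 'i set \<Rightarrow> ('k \<Rightarrow> ('i \<Rightarrow>\<^sub>0 complex) set) set" where
  "multiproj_space K I = (\<Pi>\<^sub>E k\<in>K. proj_space I)"

definition multiproj_closed ::
  "'k set \<Rightarrow> 'i set \<Rightarrow> ('k \<Rightarrow> ('i \<Rightarrow>\<^sub>0 complex) set) set \<Rightarrow> bool" where
  "multiproj_closed K I C \<longleftrightarrow>
     (\<exists>A \<subseteq> (\<Union>e. multiforms K I e).
        C = {z \<in> multiproj_space K I.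
               \<forall>p\<in>A. \<forall>v. (\<forall>k\<in>K. v k \<in> z k) \<longrightarrow>
                 mp_eval (\<lambda>(k, i). Poly_Mapping.lookup (v k) i) p = 0})"

definition multiproj_open ::
  "'k set \<Rightarrow> 'i set \<Rightarrow> ('k \<Rightarrow> ('i \<Rightarrow>\<^sub>0 complex) set) set \<Rightarrow> bool" where
  "multiproj_open K I U \<longleftrightarrow> (\<exists>C. multiproj_closed K I C \<and> U = multiproj_space K I - C)"

section \<open>Tangent space and degree of a projective variety\<close>

definition vanishing_forms ::
  "'i set \<Rightarrow> ('i \<Rightarrow>\<^sub>0 complex) set set \<Rightarrow> nat \<Rightarrow> 'i mpol set" where
  "vanishing_forms I Z d = {p \<in> forms I d. \<forall>z\<in>Z. vanishes_at p z}"

text \<open>The embedded projective tangent space: the zero locus of the differentials at \<open>z\<close> of all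
  forms in the homogeneous ideal of \<open>Z\<close>.\<close>

definition embedded_tangent_space ::
  "'i set \<Rightarrow> ('i \<Rightarrow>\<^sub>0 complex) set set \<Rightarrow> ('i \<Rightarrow>\<^sub>0 complex) set \<Rightarrow> ('i \<Rightarrow>\<^sub>0 complex) set set" where
  "embedded_tangent_space I Z z =
     {proj_pt w | w. w \<in> coord_space I \<and> w \<noteq> 0 \<and>
        (\<forall>d. \<forall>p\<in>vanishing_forms I Z d. \<forall>v\<in>z.
           (\<Sum>i\<in>I. Poly_Mapping.lookup w i * mp_eval (Poly_Mapping.lookup v) (mp_deriv i p)) = 0)}"

text \<open>
  The degree of a projective variety is \<open>r!\<close> times the leading coefficient of its Hilbert
  polynomial, where \<open>r\<close> is the degree of that polynomial.  The Hilbert function is the dimension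
  of the degree \<open>d\<close> part of the homogeneous coordinate ring.
\<close>

definition hilbert_function :: "'i set \<Rightarrow> ('i \<Rightarrow>\<^sub>0 complex) set set \<Rightarrow> nat \<Rightarrow> nat" where
  "hilbert_function I Z d = pm.dim (forms I d) - pm.dim (vanishing_forms I Z d)"

definition hilbert_poly :: "'i set \<Rightarrow> ('i \<Rightarrow>\<^sub>0 complex) set set \<Rightarrow> rat poly" where
  "hilbert_poly I Z =
     (THE P. eventually (\<lambda>d. of_nat (hilbert_function I Z d) = poly P (of_nat d)) sequentially)"

definition proj_degree :: "'i set \<Rightarrow> ('i \<Rightarrow>\<^sub>0 complex) set set \<Rightarrow> rat" where
  "proj_degree I Z =
     fact (Polynomial.degree (hilbert_poly I Z)) * lead_coeff (hilbert_poly I Z)"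

section \<open>Totally decomposable forms\<close>

text \<open>
  With respect to the basis \<open>X\<^sub>0, \<dots>, X\<^sub>n\<close> of \<open>S\<^sub>1\<close>, the dual projective space \<open>\<P>S\<^sub>1\<close> is
  \<open>proj_space {..n}\<close>.  Since \<open>\<partial>\<^sub>i X\<^sub>j = \<delta>\<^sub>i\<^sub>j\<close>, the variable \<open>\<partial>\<^sub>i\<close> of \<open>T\<close> is the \<open>i\<close>-th coordinate function
  on \<open>S\<^sub>1\<close>; thus \<open>T\<^sub>s = forms {..n} s\<close>, with elements evaluated on \<open>S\<^sub>1\<close> by \<open>mp_eval\<close>, and
  \<open>\<P>T\<^sub>s = proj_space (monomials {..n} s)\<close>.
\<close>

definition decomposables :: "nat \<Rightarrow> nat \<Rightarrow> nat mpol set set" where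
  "decomposables n s =
     {proj_pt F | F. F \<in> forms {..n} s \<and> F \<noteq> 0 \<and>
        (\<exists>L. (\<forall>i\<in>{1..s}. L i \<in> forms {..n} 1) \<and> F = (\<Prod>i\<in>{1..s}. L i))}"

definition zero_locus :: "nat \<Rightarrow> nat mpol \<Rightarrow> (nat \<Rightarrow>\<^sub>0 complex) set set" where
  "zero_locus n p = {z \<in> proj_space {..n}. vanishes_at p z}"

definition double_locus :: "nat \<Rightarrow> nat \<Rightarrow> (nat \<Rightarrow> nat mpol) \<Rightarrow> (nat \<Rightarrow>\<^sub>0 complex) set set" where
  "double_locus n s L =
     (\<Union>i\<in>{1..s}. \<Union>j\<in>{1..s} - {i}. zero_locus n (L i) \<inter> zero_locus n (L j))"

definition hypersurfaces_through ::
  "nat \<Rightarrow> nat \<Rightarrow> (nat \<Rightarrow>\<^sub>0 complex) set set \<Rightarrow> nat mpol set set" where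
  "hypersurfaces_through n s X =
     {proj_pt G | G. G \<in> forms {..n} s \<and> G \<noteq> 0 \<and> X \<subseteq> zero_locus n G}"

definition hyperplanes :: "nat \<Rightarrow> (nat \<Rightarrow>\<^sub>0 complex) set set set" where
  "hyperplanes n = {zero_locus n L | L. L \<in> forms {..n} 1 \<and> L \<noteq> 0}"

text \<open>Unordered \<open>s\<close>-tuples are multisets, i.e. a hyperplane may be repeated.\<close>

definition hyperplane_tuples_through ::
  "nat \<Rightarrow> nat \<Rightarrow> (nat \<Rightarrow>\<^sub>0 complex) set set \<Rightarrow> (nat \<Rightarrow>\<^sub>0 complex) set set multiset set" where
  "hyperplane_tuples_through n s P =
     {M. size M = s \<and> set_mset M \<subseteq> hyperplanes n \<and> P \<subseteq> \<Union>(set_mset M)}"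

end

theory Submission
  imports Defs "HOL-Library.Disjoint_Sets" "HOL-Combinatorics.Permutations"
    "Jordan_Normal_Form.Determinant"
begin

text \<open>
  Forms on the space of forms of degree \<open>s\<close> pull back along \<open>(L\<^sub>1, \<dots>, L\<^sub>s) \<mapsto> L\<^sub>1 \<cdots> L\<^sub>s\<close> to symmetric
  multihomogeneous functions, so the Hilbert function of the variety at \<open>d\<close> is at most the number of
  multisets of \<open>s\<close> monomials of degree \<open>d\<close>.  For a lower bound, evaluate forms at points
  \<open>p\<^sub>0, \<dots>, p\<^sub>n\<^sub>s\<close> of a rational normal curve, to obtain linear forms \<open>z\<^sub>0, \<dots>, z\<^sub>n\<^sub>s\<close>.  Over
  \<open>z\<^sub>1 = \<dots> = z\<^sub>n\<^sub>s = 0\<close> lie the products of hyperplanes given by the partitions of \<open>p\<^sub>1, \<dots>, p\<^sub>n\<^sub>s\<close> into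
  \<open>s\<close> blocks of size \<open>n\<close>.  At each of them \<open>z\<^sub>1, \<dots>, z\<^sub>n\<^sub>s\<close> are local coordinates, so forms which separate
  the partitions are linearly independent over \<open>\<complex>[z\<^sub>0, \<dots>, z\<^sub>n\<^sub>s]\<close>.  Both bounds have the leading
  coefficient \<open>K / (n s)!\<close>, where \<open>K\<close> is the number of partitions, and \<open>K\<close> also counts the tuples of
  hyperplanes through \<open>n s\<close> points in general position.

  Counting dimensions, every multihomogeneous function is algebraic over \<open>\<complex>[z\<^sub>0, \<dots>, z\<^sub>n\<^sub>s]\<close>.  Where the
  derivatives of minimal relations for the coefficients do not vanish, a tangent vector is determined
  by its \<open>n s + 1\<close> values of the \<open>z\<^sub>k\<close>.  The span of the products in which one factor \<open>L\<^sub>i\<close> is replaced by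
  an arbitrary linear form is tangent and has dimension \<open>n s + 1\<close>, hence is the tangent space; that
  it contains all forms vanishing on the double locus is seen by restriction to lines.
\<close>

text \<open>Only the parametrization of the variety is explicit, not its ideal. Hence the degree is
  found as the limit of the Hilbert function divided by \<open>d ^ (n * s)\<close>, squeezed between
  two explicit bounds. The bounds meet because choosing \<open>s\<close> out of about
  \<open>d ^ n / fact n\<close> monomials gives the coefficient
  \<open>1 / (fact n ^ s * fact s)\<close>, and there are
  \<open>fact (n * s) / (fact n ^ s * fact s)\<close> partitions. As \<open>hilbert_poly\<close> is
  a definite description, the existence of the Hilbert polynomial is proved too, through leading
  monomials and Dickson's lemma. The other obstacle is genericity. The conditions concern the
  factors, but the open set has to be cut out by forms in the coefficients of the product. A
  relation for a function \<open>g\<close> over the polynomials in the coordinate functions, divided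
  by the lowest power of \<open>g\<close> in it, has a constant term that vanishes wherever
  \<open>g\<close> does. Being a polynomial in the coordinates, this term comes from a form on the
  ambient space.\<close>

abbreviation "lookup \<equiv> Poly_Mapping.lookup"
abbreviation "keys \<equiv> Poly_Mapping.keys"
abbreviation "single \<equiv> Poly_Mapping.single"

section \<open>Evaluation of polynomials\<close>

definition mono_eval :: "('i \<Rightarrow> complex) \<Rightarrow> ('i \<Rightarrow>\<^sub>0 nat) \<Rightarrow> complex" where
  "mono_eval x m = (\<Prod>i\<in>keys m. x i ^ lookup m i)"

lemma mono_eval_superset:
  "finite I \<Longrightarrow> keys m \<subseteq> I \<Longrightarrow> mono_eval x m = (\<Prod>i\<in>I. x i ^ lookup m i)"
  unfolding mono_eval_def by (rule prod.mono_neutral_left) (auto simp: in_keys_iff)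

lemma mono_eval_zero [simp]: "mono_eval x 0 = 1"
  by (simp add: mono_eval_def)

lemma mono_eval_add: "mono_eval x (m + m') = mono_eval x m * mono_eval x m'"
proof -
  let ?I = "keys m \<union> keys m'"
  have "keys (m + m') \<subseteq> ?I" by (rule keys_add)
  thus ?thesis
    by (simp add: mono_eval_superset[of ?I] lookup_add power_add prod.distrib)
qed

lemma mono_eval_single [simp]: "mono_eval x (single i k) = x i ^ k"
  by (simp add: mono_eval_superset[of "{i}"])

lemma mono_eval_times: "mono_eval (\<lambda>i. x i * y i) m = mono_eval x m * mono_eval y m"
  by (simp add: mono_eval_def power_mult_distrib prod.distrib)

lemma mono_eval_one [simp]: "mono_eval (\<lambda>i. 1) m = 1"
  by (simp add: mono_eval_def)

lemma mono_eval_cong: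
  "(\<And>i. i \<in> keys m \<Longrightarrow> x i = y i) \<Longrightarrow> mono_eval x m = mono_eval y m"
  by (simp add: mono_eval_def)

text \<open>From here on evaluation is handled one monomial at a time, so that multiplicativity and
  homogeneity reduce to statements about \<open>mono_eval\<close>.\<close>

lemma mp_eval_alt: "mp_eval x p = (\<Sum>m\<in>keys p. lookup p m * mono_eval x m)"
  by (simp add: mp_eval_def mono_eval_def)

lemma mp_eval_superset:
  assumes "finite A" "keys p \<subseteq> A"
  shows "mp_eval x p = (\<Sum>m\<in>A. lookup p m * mono_eval x m)"
  unfolding mp_eval_alt by (rule sum.mono_neutral_left) (use assms in \<open>auto simp: in_keys_iff\<close>)

lemma mp_eval_zero [simp]: "mp_eval x 0 = 0"
  by (simp add: mp_eval_def)

lemma mp_eval_single [simp]: "mp_eval x (single m c) = c * mono_eval x m"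
  by (simp add: mp_eval_superset[of "{m}"])

lemma mp_eval_one [simp]: "mp_eval x 1 = 1"
  by (simp flip: single_one)

lemma mp_eval_add: "mp_eval x (p + q) = mp_eval x p + mp_eval x q"
proof -
  let ?I = "keys p \<union> keys q"
  have "keys (p + q) \<subseteq> ?I" by (rule keys_add)
  thus ?thesis
    by (simp add: mp_eval_superset[of ?I] lookup_add ring_distribs sum.distrib)
qed

lemma mp_eval_sum: "mp_eval x (sum f A) = (\<Sum>a\<in>A. mp_eval x (f a))"
  by (induction A rule: infinite_finite_induct) (auto simp: mp_eval_add)

lemma mp_eval_scale [simp]: "mp_eval x (scale_pm c p) = c * mp_eval x p"
proof -
  have "keys (scale_pm c p) \<subseteq> keys p"
    by (auto simp: in_keys_iff)
  thus ?thesis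
    by (simp add: mp_eval_superset[of "keys p"] sum_distrib_left algebra_simps)
qed

lemma lookup_sum_single:
  assumes "finite A"
  shows "lookup (\<Sum>m\<in>A. single m (f m)) k = (if k \<in> A then f k else 0)"
proof -
  have "lookup (\<Sum>m\<in>A. single m (f m)) k = (\<Sum>m\<in>A. if m = k then f k else 0)"
    unfolding lookup_sum by (intro sum.cong) (auto simp: lookup_single when_def)
  thus ?thesis using assms by simp
qed

lemma poly_mapping_expand:
  fixes p :: "'a \<Rightarrow>\<^sub>0 'b::comm_monoid_add"
  assumes "finite A" "keys p \<subseteq> A"
  shows "p = (\<Sum>m\<in>A. single m (lookup p m))"
  using assms by (intro poly_mapping_eqI) (auto simp: lookup_sum_single in_keys_iff)

lemma mp_eval_mult: "mp_eval x (p * q) = mp_eval x p * mp_eval x q"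
proof -
  have *: "p * q = (\<Sum>m\<in>keys p. \<Sum>m'\<in>keys q.
             single (m + m') (lookup p m * lookup q m'))"
    by (subst (1) poly_mapping_expand[of "keys p" p], simp, simp,
        subst (1) poly_mapping_expand[of "keys q" q], simp, simp)
       (simp add: sum_product mult_single)
  show ?thesis
    unfolding * mp_eval_alt[of x p] mp_eval_alt[of x q] sum_product mp_eval_sum
    by (intro sum.cong) (auto simp: mono_eval_add)
qed

lemma mp_eval_prod: "mp_eval x (prod f A) = (\<Prod>a\<in>A. mp_eval x (f a))"
  by (induction A rule: infinite_finite_induct) (auto simp: mp_eval_mult)

lemma mp_eval_power: "mp_eval x (p ^ k) = mp_eval x p ^ k"
  by (induction k) (auto simp: mp_eval_mult)

lemma mp_eval_cong:
  "(\<And>m i. m \<in> keys p \<Longrightarrow> i \<in> keys m \<Longrightarrow> x i = y i) \<Longrightarrow> mp_eval x p = mp_eval y p"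
  unfolding mp_eval_alt by (intro sum.cong refl arg_cong2[where f="(*)"] mono_eval_cong) auto

text \<open>Monomials are distinct characters of the multiplicative monoid of points, so Dedekind's
  argument applies.\<close>

lemma mono_eval_independent:
  assumes "finite A" "\<And>x. (\<Sum>m\<in>A. c m * mono_eval x m) = 0" "m \<in> A"
  shows "c m = 0"
  using assms
proof (induction A arbitrary: c m rule: finite_induct)
  case empty thus ?case by simp
next
  case (insert m0 A)
  have *: "c m1 = 0" if m1: "m1 \<in> A" for m1
  proof -
    from m1 insert have "m0 \<noteq> m1" by auto
    then obtain i where i: "lookup m0 i \<noteq> lookup m1 i"
      by (metis poly_mapping_eqI)
    define y :: "'a \<Rightarrow> complex" where "y = (\<lambda>j. if j = i then 2 else 1)"
    have y: "mono_eval y m = 2 ^ lookup m i" for m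
    proof -
      have "mono_eval y m = (\<Prod>j\<in>insert i (keys m). y j ^ lookup m j)"
        by (rule mono_eval_superset) auto
      also have "\<dots> = (\<Prod>j\<in>{i}. y j ^ lookup m j)"
        by (rule prod.mono_neutral_right) (auto simp: y_def)
      finally show ?thesis by (simp add: y_def)
    qed
    have "(c m1 * (mono_eval y m1 - mono_eval y m0)) = 0"
    proof (rule insert.IH[OF _ m1])
      fix x
      have "0 = (\<Sum>m\<in>insert m0 A. c m * mono_eval (\<lambda>i. x i * y i) m)
               - mono_eval y m0 * (\<Sum>m\<in>insert m0 A. c m * mono_eval x m)"
        by (simp only: insert.prems(1)) simp
      also have "\<dots> = (\<Sum>m\<in>insert m0 A. c m * (mono_eval y m - mono_eval y m0) * mono_eval x m)"
        by (simp add: sum_distrib_left sum_subtractf[symmetric] mono_eval_times algebra_simps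
                 del: sum.insert)
      also have "\<dots> = (\<Sum>m\<in>A. c m * (mono_eval y m - mono_eval y m0) * mono_eval x m)"
        using insert.hyps by simp
      finally show "(\<Sum>m\<in>A. c m * (mono_eval y m - mono_eval y m0) * mono_eval x m) = 0" by simp
    qed
    moreover have "mono_eval y m1 \<noteq> mono_eval y m0"
    proof
      assume "mono_eval y m1 = mono_eval y m0"
      hence "(of_nat (2 ^ lookup m1 i) :: complex) = of_nat (2 ^ lookup m0 i)"
        by (simp add: y)
      hence "(2::nat) ^ lookup m1 i = 2 ^ lookup m0 i"
        by (simp only: of_nat_eq_iff)
      thus False using i by simp
    qed
    ultimately show ?thesis by simp
  qed
  have "c m0 = 0"
    using insert.prems(1)[of "\<lambda>_. 1"] insert.hyps * by simp
  thus ?case using * insert.prems(2) by auto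
qed

lemma mp_eval_eq_zero_imp:
  assumes "\<And>x. mp_eval x p = 0" shows "p = 0"
proof (rule poly_mapping_eqI)
  fix m
  show "lookup p m = lookup 0 m"
  proof (cases "m \<in> keys p")
    case True
    have "lookup p m = 0"
      by (rule mono_eval_independent[OF _ _ True]) (use assms in \<open>auto simp: mp_eval_alt\<close>)
    thus ?thesis by simp
  qed (simp add: in_keys_iff)
qed

section \<open>Spaces of forms\<close>

lemma coord_space_subspace: "pm.subspace (coord_space I)"
  unfolding pm.subspace_def coord_space_def
  by (auto simp: in_keys_iff lookup_add) (metis add.right_neutral in_keys_iff subsetD)+

lemma coord_space_lookup: "v \<in> coord_space I \<Longrightarrow> i \<notin> I \<Longrightarrow> lookup v i = 0"
  by (auto simp: coord_space_def in_keys_iff)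

lemma coord_spaceI: "(\<And>i. i \<notin> I \<Longrightarrow> lookup v i = 0) \<Longrightarrow> v \<in> coord_space I"
  by (auto simp: coord_space_def in_keys_iff)

lemma monomials_superset:
  assumes "finite I" "keys m \<subseteq> I"
  shows "m \<in> monomials I d \<longleftrightarrow> (\<Sum>i\<in>I. lookup m i) = d"
proof -
  have "(\<Sum>i\<in>keys m. lookup m i) = (\<Sum>i\<in>I. lookup m i)"
    by (rule sum.mono_neutral_left) (use assms in \<open>auto simp: in_keys_iff\<close>)
  thus ?thesis using assms by (simp add: monomials_def)
qed

lemma monomials_keys: "m \<in> monomials I d \<Longrightarrow> keys m \<subseteq> I"
  by (simp add: monomials_def)

lemma monomials_add:
  assumes "m \<in> monomials I d" "m' \<in> monomials I e"
  shows "m + m' \<in> monomials I (d + e)"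
proof -
  let ?J = "keys m \<union> keys m'"
  have 1: "keys (m + m') \<subseteq> ?J" by (rule keys_add)
  have "m \<in> monomials ?J d" "m' \<in> monomials ?J e" using assms by (auto simp: monomials_def)
  hence "m + m' \<in> monomials ?J (d + e)"
    using 1 by (subst (asm) (1 2) monomials_superset)
       (auto simp: monomials_superset lookup_add sum.distrib)
  thus ?thesis using assms by (auto simp: monomials_def)
qed

lemma monomials_single: "i \<in> I \<Longrightarrow> single i k \<in> monomials I k"
  by (cases "k = 0") (auto simp: monomials_def)

lemma monomials_one: "monomials I 1 = (\<lambda>i. single i 1) ` I"
proof (intro equalityI subsetI)
  fix m assume m: "m \<in> monomials I 1"
  hence "(\<Sum>i\<in>keys m. lookup m i) = 1" by (simp add: monomials_def)
  then obtain i where i: "i \<in> keys m" "lookup m i = 1"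
    "\<And>j. j \<in> keys m \<Longrightarrow> j \<noteq> i \<Longrightarrow> lookup m j = 0"
    by (subst (asm) sum_eq_1_iff) (auto)
  have "m = single i 1"
    by (rule poly_mapping_eqI) (use i in \<open>auto simp: lookup_single when_def in_keys_iff\<close>)
  thus "m \<in> (\<lambda>i. single i 1) ` I" using i m by (auto simp: monomials_def)
qed (auto simp: monomials_def)

lemma mono_eval_homog:
  assumes "m \<in> monomials I d"
  shows "mono_eval (\<lambda>i. c * x i) m = c ^ d * mono_eval x m"
proof -
  have "mono_eval (\<lambda>i. c) m = c ^ d"
    using assms by (auto simp: mono_eval_def monomials_def power_sum)
  thus ?thesis by (simp add: mono_eval_times)
qed

lemma forms_keys: "p \<in> forms I d \<Longrightarrow> m \<in> keys p \<Longrightarrow> m \<in> monomials I d"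
  by (auto simp: forms_def coord_space_def)

lemma formsI: "(\<And>m. m \<in> keys p \<Longrightarrow> m \<in> monomials I d) \<Longrightarrow> p \<in> forms I d"
  by (auto simp: forms_def coord_space_def)

lemma mp_eval_homog:
  assumes "p \<in> forms I d"
  shows "mp_eval (\<lambda>i. c * x i) p = c ^ d * mp_eval x p"
  unfolding mp_eval_alt sum_distrib_left
  by (intro sum.cong refl) (simp add: mono_eval_homog[OF forms_keys[OF assms]])

lemma forms_subspace: "pm.subspace (forms I d)"
  unfolding forms_def by (rule coord_space_subspace)

lemmas forms_0 [simp] = pm.subspace_0[OF forms_subspace]
  and forms_add = pm.subspace_add[OF forms_subspace]
  and forms_scale = pm.subspace_scale[OF forms_subspace]
  and forms_diff = pm.subspace_diff[OF forms_subspace]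
  and forms_sum = pm.subspace_sum[OF forms_subspace]

lemma forms_single: "m \<in> monomials I d \<Longrightarrow> single m c \<in> forms I d"
  by (auto simp: forms_def coord_space_def)

lemma forms_1 [simp]: "1 \<in> forms I 0"
  by (auto simp: forms_def coord_space_def monomials_def)

lemma forms_mult: "p \<in> forms I d \<Longrightarrow> q \<in> forms I e \<Longrightarrow> p * q \<in> forms I (d + e)"
  using keys_mult[of p q] by (fastforce intro: formsI monomials_add dest: forms_keys)

lemma forms_prod:
  "(\<And>a. a \<in> A \<Longrightarrow> f a \<in> forms I (e a)) \<Longrightarrow> prod f A \<in> forms I (sum e A)"
  by (induction A rule: infinite_finite_induct) (auto intro: forms_mult)

lemma forms_prod1:
  "(\<And>a. a \<in> A \<Longrightarrow> f a \<in> forms I 1) \<Longrightarrow> prod f A \<in> forms I (card A)"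
  using forms_prod[of A f I "\<lambda>_. 1"] by simp

lemma forms_power: "p \<in> forms I d \<Longrightarrow> p ^ k \<in> forms I (k * d)"
  by (induction k) (auto intro: forms_mult)

lemma finite_monomials:
  assumes "finite I" shows "finite (monomials I d)"
proof (rule finite_imageD)
  show "finite (lookup ` monomials I d)"
  proof (rule finite_subset)
    show "lookup ` monomials I d \<subseteq> {f. \<forall>i. (i \<in> I \<longrightarrow> f i \<in> {..d}) \<and> (i \<notin> I \<longrightarrow> f i = 0)}"
    proof (intro image_subsetI CollectI allI conjI impI)
      fix m i assume m: "m \<in> monomials I d"
      hence s: "(\<Sum>i\<in>I. lookup m i) = d"
        using monomials_superset[OF assms monomials_keys] by blast
      { assume "i \<in> I"
        hence "lookup m i \<le> (\<Sum>i\<in>I. lookup m i)"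
          using assms by (intro member_le_sum) auto
        thus "lookup m i \<in> {..d}" using s by simp }
      { assume "i \<notin> I"
        thus "lookup m i = 0" using m by (auto simp: monomials_def in_keys_iff) }
    qed
    show "finite {f. \<forall>i. (i \<in> I \<longrightarrow> f i \<in> {..d}) \<and> (i \<notin> I \<longrightarrow> f i = 0)}"
      by (rule finite_set_of_finite_funs) (use assms in auto)
  qed
  show "inj_on lookup (monomials I d)"
    by (auto simp: inj_on_def lookup_inject)
qed

text \<open>Monomials of degree \<open>d\<close> are multisets of size \<open>d\<close>, read through their multiplicities.\<close>

lemma card_monomials:
  assumes "finite I"
  shows "card (monomials I d) = (card I + d - 1) choose d"
proof -
  have fin: "finite {i. count M i \<noteq> 0}" for M :: "'a multiset"
    by (metis (mono_tags, lifting) Collect_cong finite_set_mset set_mset_def count_greater_zero_iff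
        neq0_conv)
  have "bij_betw (\<lambda>M. Abs_poly_mapping (count M)) (multisets_of_size I d) (monomials I d)"
  proof (rule bij_betw_byWitness[where f' = "\<lambda>m. Abs_multiset (lookup m)"])
    have look: "lookup (Abs_poly_mapping (count M)) = count M" for M :: "'a multiset"
      using fin by simp
    have cnt: "count (Abs_multiset (lookup m)) = lookup m" for m :: "'a \<Rightarrow>\<^sub>0 nat"
      by (rule count_Abs_multiset) simp
    show "\<forall>M\<in>multisets_of_size I d. Abs_multiset (lookup (Abs_poly_mapping (count M))) = M"
      by (simp only: look count_inverse) simp
    show "\<forall>m\<in>monomials I d. Abs_poly_mapping (count (Abs_multiset (lookup m))) = m"
      by (simp only: cnt lookup_inverse) simp
    have keys: "keys (Abs_poly_mapping (count M)) = set_mset M" for M :: "'a multiset"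
      by (auto simp: in_keys_iff look)
    show "(\<lambda>M. Abs_poly_mapping (count M)) ` multisets_of_size I d \<subseteq> monomials I d"
      by (auto simp: monomials_def multisets_of_size_def keys look size_multiset_overloaded_eq)
    show "(\<lambda>m. Abs_multiset (lookup m)) ` monomials I d \<subseteq> multisets_of_size I d"
    proof (intro image_subsetI)
      fix m assume m: "m \<in> monomials I d"
      have "set_mset (Abs_multiset (lookup m)) = keys m"
        by (metis cnt count_eq_zero_iff in_keys_iff subsetI subset_antisym)
      thus "Abs_multiset (lookup m) \<in> multisets_of_size I d"
        using m by (auto simp: monomials_def multisets_of_size_def cnt size_multiset_overloaded_eq)
    qed
  qed
  hence "card (monomials I d) = card (multisets_of_size I d)"
    by (metis bij_betw_same_card)
  thus ?thesis using card_multisets_of_size[OF assms] by simp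
qed

lemma card_monomials_atMost: "card (monomials {..N} d) = (N + d) choose N"
  using binomial_symmetric[of N "N + d"] by (simp add: card_monomials add.commute)

section \<open>Differentiation\<close>

lemma mp_eval_deriv:
  "mp_eval x (mp_deriv i p) = (\<Sum>m\<in>keys p.
     of_nat (lookup m i) * lookup p m * mono_eval x (m - single i 1))"
  by (simp add: mp_deriv_def mp_eval_sum)

lemma mono_eval_has_field_derivative:
  assumes "finite I" "keys m \<subseteq> I"
    and "\<And>i. i \<in> I \<Longrightarrow> ((\<lambda>t. c t i) has_field_derivative c' i) (at t0)"
  shows "((\<lambda>t. mono_eval (c t) m) has_field_derivative
           (\<Sum>i\<in>I. c' i * (of_nat (lookup m i) * mono_eval (c t0) (m - single i 1)))) (at t0)"
proof -
  have "((\<lambda>t. \<Prod>i\<in>I. c t i ^ lookup m i) has_field_derivative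
     (\<Sum>i\<in>I. (of_nat (lookup m i) * (c' i * c t0 i ^ (lookup m i - Suc 0)))
        * (\<Prod>j\<in>I-{i}. c t0 j ^ lookup m j))) (at t0)"
    by (rule has_field_derivative_prod) (rule DERIV_power, rule assms(3), simp)
  moreover have "(of_nat (lookup m i) * (c' i * c t0 i ^ (lookup m i - Suc 0)))
        * (\<Prod>j\<in>I-{i}. c t0 j ^ lookup m j)
      = c' i * (of_nat (lookup m i) * mono_eval (c t0) (m - single i 1))"
    if "i \<in> I" for i
  proof -
    have "keys (m - single i 1) \<subseteq> I"
      using assms(2) by (auto simp: in_keys_iff lookup_minus)
    hence "mono_eval (c t0) (m - single i 1)
      = (\<Prod>j\<in>I. c t0 j ^ lookup (m - single i 1) j)"
      by (rule mono_eval_superset[OF assms(1)])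
    also have "\<dots> = c t0 i ^ (lookup m i - Suc 0) * (\<Prod>j\<in>I-{i}. c t0 j ^ lookup m j)"
      using assms(1) that
      by (subst prod.remove[of I i]) (auto simp: lookup_minus lookup_single when_def intro!: prod.cong)
    finally show ?thesis by simp
  qed
  ultimately show ?thesis
    by (simp add: mono_eval_superset[OF assms(1,2)])
qed

text \<open>Links the formal \<open>mp_deriv\<close> to analytic derivatives along curves, so that
  tangency can be tested by differentiating functions of one variable.\<close>

lemma mp_eval_has_field_derivative:
  assumes "finite I" "\<And>m. m \<in> keys p \<Longrightarrow> keys m \<subseteq> I"
    and "\<And>i. i \<in> I \<Longrightarrow> ((\<lambda>t. c t i) has_field_derivative c' i) (at t0)"
  shows "((\<lambda>t. mp_eval (c t) p) has_field_derivative
           (\<Sum>i\<in>I. c' i * mp_eval (c t0) (mp_deriv i p))) (at t0)"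
proof -
  have "((\<lambda>t. mp_eval (c t) p) has_field_derivative
     (\<Sum>m\<in>keys p. lookup p m * (\<Sum>i\<in>I. c' i * (of_nat (lookup m i) * mono_eval (c t0) (m - single i 1))))) (at t0)"
    unfolding mp_eval_alt
    by (intro DERIV_sum DERIV_cmult mono_eval_has_field_derivative assms) auto
  also have "(\<Sum>m\<in>keys p. lookup p m * (\<Sum>i\<in>I. c' i * (of_nat (lookup m i) * mono_eval (c t0) (m - single i 1))))
     = (\<Sum>i\<in>I. c' i * mp_eval (c t0) (mp_deriv i p))"
    unfolding mp_eval_deriv sum_distrib_left
    by (subst sum.swap) (intro sum.cong refl, simp add: algebra_simps)
  finally show ?thesis .
qed

text \<open>Makes tangency independent of the representative of a point. The truncated exponent
  \<open>d - 1\<close> is harmless: terms with \<open>lookup m i = 0\<close> have the factor 0, and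
  otherwise \<open>d\<close> is positive.\<close>

lemma mp_deriv_homog:
  assumes "p \<in> forms I d"
  shows "mp_eval (\<lambda>j. c * x j) (mp_deriv i p) = c ^ (d - 1) * mp_eval x (mp_deriv i p)"
proof -
  have "mono_eval (\<lambda>j. c * x j) (m - single i 1) = c ^ (d - 1) * mono_eval x (m - single i 1)"
    if m: "m \<in> keys p" and i: "lookup m i \<noteq> 0" for m
  proof -
    have md: "m \<in> monomials I d" using assms m by (rule forms_keys)
    define m' where "m' = m - single i 1"
    have mm: "m = m' + single i 1"
      by (rule poly_mapping_eqI) (use i in \<open>auto simp: m'_def lookup_add lookup_minus lookup_single when_def\<close>)
    have keys_m': "keys m' \<subseteq> keys m"
      by (auto simp: m'_def in_keys_iff lookup_minus)
    have "(\<Sum>i\<in>keys m. lookup m i) = d"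
      using md by (simp add: monomials_def)
    moreover have "lookup m j = lookup m' j + (if j = i then 1 else 0)" for j
      by (subst mm) (simp add: lookup_add lookup_single when_def eq_commute)
    ultimately have "(\<Sum>j\<in>keys m. lookup m' j + (if j = i then 1 else 0)) = d"
      by simp
    hence "(\<Sum>j\<in>keys m. lookup m' j) = d - 1"
      using i by (simp add: sum.distrib in_keys_iff)
    with keys_m' have "m' \<in> monomials (keys m) (d - 1)"
      by (subst monomials_superset) auto
    thus ?thesis unfolding m'_def[symmetric] by (rule mono_eval_homog)
  qed
  hence "of_nat (lookup m i) * lookup p m * mono_eval (\<lambda>j. c * x j) (m - single i 1)
     = c ^ (d - 1) * (of_nat (lookup m i) * lookup p m * mono_eval x (m - single i 1))"
    if "m \<in> keys p" for m
    using that by (cases "lookup m i = 0") auto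
  thus ?thesis unfolding mp_eval_deriv sum_distrib_left by (intro sum.cong refl)
qed

section \<open>Hilbert functions are eventually polynomial\<close>

text \<open>Initial monomials: a linear order on the index set turns dimensions into cardinalities.\<close>

definition lead :: "('a::linorder \<Rightarrow>\<^sub>0 complex) \<Rightarrow> 'a" where
  "lead v = Max (keys v)"

lemma lead_in_keys: "v \<noteq> 0 \<Longrightarrow> lead v \<in> keys v"
  unfolding lead_def by (rule Max_in) auto

lemma lookup_lead: "v \<noteq> 0 \<Longrightarrow> lookup v (lead v) \<noteq> 0"
  using lead_in_keys by (auto simp: in_keys_iff)

lemma lookup_greater_lead: "lead v < k \<Longrightarrow> lookup v k = 0"
  unfolding lead_def by (metis Max_ge finite_keys in_keys_iff leD)

text \<open>Vectors with distinct leading indices are independent, as the largest index with a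
  nonzero scalar shows. They span, because subtracting a multiple of \<open>b (lead v)\<close>
  lowers the leading index, which lies in the finite set \<open>E\<close>.\<close>

lemma dim_eq_card_lead:
  fixes V :: "('a::linorder \<Rightarrow>\<^sub>0 complex) set"
  assumes "finite M" "V \<subseteq> coord_space M" "pm.subspace V"
  shows "pm.dim V = card (lead ` (V - {0}))"
proof -
  define E where "E = lead ` (V - {0})"
  have "E \<subseteq> M" using assms(2) lead_in_keys by (fastforce simp: E_def coord_space_def)
  hence finE: "finite E" using assms(1) finite_subset by blast
  have "\<forall>e\<in>E. \<exists>v. v \<in> V \<and> v \<noteq> 0 \<and> lead v = e" by (auto simp: E_def)
  then obtain b where b: "\<And>e. e \<in> E \<Longrightarrow> b e \<in> V \<and> b e \<noteq> 0 \<and> lead (b e) = e" by metis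
  have inj: "inj_on b E" by (metis b inj_onI)
  have scal: "c e = 0" if c0: "(\<Sum>e\<in>E. scale_pm (c e) (b e)) = 0" and e: "e \<in> E" for c e
  proof (rule ccontr)
    assume "c e \<noteq> 0"
    define E' where "E' = {e\<in>E. c e \<noteq> 0}"
    have E': "finite E'" "E' \<noteq> {}" using finE e \<open>c e \<noteq> 0\<close> by (auto simp: E'_def)
    define m where "m = Max E'"
    have m: "m \<in> E'" using E' by (simp add: m_def)
    have "0 = lookup (\<Sum>e\<in>E. scale_pm (c e) (b e)) m" using c0 by simp
    also have "\<dots> = (\<Sum>e\<in>E. c e * lookup (b e) m)" by (simp add: lookup_sum)
    also have "\<dots> = (\<Sum>e\<in>{m}. c e * lookup (b e) m)"
    proof (rule sum.mono_neutral_right)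
      show "\<forall>i\<in>E - {m}. c i * lookup (b i) m = 0"
      proof
        fix i assume i: "i \<in> E - {m}"
        show "c i * lookup (b i) m = 0"
        proof (cases "c i = 0")
          case False
          hence "i \<le> m" using i E' by (simp add: m_def E'_def)
          hence "lead (b i) < m" using i b by auto
          thus ?thesis by (simp add: lookup_greater_lead)
        qed simp
      qed
    qed (use finE m in \<open>auto simp: E'_def\<close>)
    also have "\<dots> \<noteq> 0" using m b[of m] lookup_lead[of "b m"] by (auto simp: E'_def)
    finally show False by simp
  qed
  have "pm.independent (b ` E)"
  proof (rule pm.independent_if_scalars_zero)
    show "finite (b ` E)" using finE by simp
    fix f x assume "(\<Sum>x\<in>b ` E. scale_pm (f x) x) = 0" "x \<in> b ` E"
    thus "f x = 0" using scal[of "\<lambda>e. f (b e)"] by (auto simp: sum.reindex[OF inj])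
  qed
  moreover have "V \<subseteq> pm.span (b ` E)"
  proof
    fix v assume "v \<in> V"
    thus "v \<in> pm.span (b ` E)"
    proof (induction "card {e\<in>E. e \<le> lead v}" arbitrary: v rule: less_induct)
      case less
      show ?case
      proof (cases "v = 0")
        case True thus ?thesis by (simp add: pm.span_zero)
      next
        case False
        define e where "e = lead v"
        have e: "e \<in> E" using False less.prems by (auto simp: E_def e_def)
        define c where "c = lookup v e / lookup (b e) e"
        define w where "w = v - scale_pm c (b e)"
        have wV: "w \<in> V" unfolding w_def
          by (intro pm.subspace_diff pm.subspace_scale assms less.prems) (use b e in auto)
        have "w \<in> pm.span (b ` E)"
        proof (cases "w = 0")
          case True thus ?thesis by (simp add: pm.span_zero)
        next
          case wn: False
          have "lead w \<le> e"
          proof (rule ccontr)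
            assume "\<not> lead w \<le> e"
            hence "lookup w (lead w) = 0"
              using b[OF e] by (simp add: w_def lookup_minus lookup_greater_lead e_def)
            thus False using wn lookup_lead by blast
          qed
          moreover have "lookup w e = 0"
            using b[OF e] lookup_lead[of "b e"] by (simp add: w_def lookup_minus c_def)
          hence "lead w \<noteq> e" using wn lookup_lead by metis
          ultimately have lt: "lead w < e" by simp
          have "card {e\<in>E. e \<le> lead w} < card {e\<in>E. e \<le> lead v}"
          proof (rule psubset_card_mono)
            have "e \<in> {e\<in>E. e \<le> lead v}" "e \<notin> {e\<in>E. e \<le> lead w}"
              "{e\<in>E. e \<le> lead w} \<subseteq> {e\<in>E. e \<le> lead v}"
              using lt e by (auto simp: e_def)
            thus "{e\<in>E. e \<le> lead w} \<subset> {e\<in>E. e \<le> lead v}" by blast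
          qed (use finE in simp)
          thus ?thesis by (rule less.hyps) (rule wV)
        qed
        moreover have "scale_pm c (b e) \<in> pm.span (b ` E)"
          using e by (intro pm.span_scale pm.span_base) auto
        ultimately have "w + scale_pm c (b e) \<in> pm.span (b ` E)" by (rule pm.span_add)
        thus ?thesis by (simp add: w_def)
      qed
    qed
  qed
  moreover have "b ` E \<subseteq> V" using b by auto
  ultimately have "pm.dim V = card (b ` E)" by (metis pm.basis_card_eq_dim)
  thus ?thesis using card_image[OF inj] by (simp add: E_def)
qed

lemma dim_coord_space:
  fixes M :: "'a::linorder set"
  assumes "finite M" shows "pm.dim (coord_space M) = card M"
proof -
  have "lead ` (coord_space M - {0}) = M"
  proof (intro equalityI subsetI)
    fix x assume "x \<in> M"
    hence "single x (1::complex) \<in> coord_space M - {0}" "lead (single x (1::complex)) = x"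
      by (auto simp: coord_space_def lead_def) (metis lookup_single_eq lookup_zero zero_neq_one)
    thus "x \<in> lead ` (coord_space M - {0})" by force
  qed (use lead_in_keys in \<open>fastforce simp: coord_space_def\<close>)
  thus ?thesis using dim_eq_card_lead[OF assms order_refl coord_space_subspace] by simp
qed

lemma keys_single_mult:
  fixes p :: "('a::cancel_comm_monoid_add \<Rightarrow>\<^sub>0 complex)"
  shows "keys (single u 1 * p) = (\<lambda>k. u + k) ` keys p"
proof -
  have e: "single u 1 * p = (\<Sum>m\<in>keys p. single (u + m) (lookup p m))"
    by (subst (1) poly_mapping_expand[of "keys p" p], simp, simp)
       (simp add: sum_distrib_left mult_single)
  have l: "lookup (single u 1 * p) (u + k) = lookup p k" for k
  proof -
    have "lookup (single u 1 * p) (u + k)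
        = (\<Sum>m\<in>keys p. if m = k then lookup p k else 0)"
      unfolding e lookup_sum by (intro sum.cong) (auto simp: lookup_single when_def)
    thus ?thesis by (auto simp: in_keys_iff)
  qed
  have "keys (single u 1 * p) \<subseteq> (\<lambda>k. u + k) ` keys p"
    using keys_mult[of "single u 1" p] by auto
  thus ?thesis using l by (auto simp: in_keys_iff)
qed

lemma vanishing_forms_subspace: "pm.subspace (vanishing_forms I Z d)"
  unfolding pm.subspace_def vanishing_forms_def vanishes_at_def
  by (auto simp: mp_eval_add forms_add forms_scale)

text \<open>\<open>E\<close> consists of the leading monomials of the vanishing ideal. The order on
  exponent vectors is compatible with addition, so multiplying a form by a monomial shifts its
  leading monomial.\<close>

lemma hilbert_function_eq_card:
  fixes I :: "'i::linorder set"
  assumes "finite I"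
  obtains E where "\<And>m u. m \<in> E \<Longrightarrow> keys u \<subseteq> I \<Longrightarrow> m + u \<in> E"
    "\<And>d. hilbert_function I Z d = card {m \<in> monomials I d. m \<notin> E}"
proof
  define V where "V = vanishing_forms I Z"
  define E where "E = (\<Union>d. lead ` (V d - {0}))"
  show "m + u \<in> E" if m: "m \<in> E" and u: "keys u \<subseteq> I" for m u
  proof -
    obtain d p where p: "p \<in> V d" "p \<noteq> 0" "lead p = m" using m by (auto simp: E_def)
    define q where "q = single u 1 * p"
    obtain e where "u \<in> monomials I e" using u by (auto simp: monomials_def)
    hence "q \<in> V (e + d)" using p(1)
      by (auto simp: V_def vanishing_forms_def vanishes_at_def q_def mp_eval_mult intro: forms_mult forms_single)
    moreover have k: "keys q = (\<lambda>k. u + k) ` keys p"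
      unfolding q_def by (rule keys_single_mult)
    hence "q \<noteq> 0" using p(2) lead_in_keys by fastforce
    moreover have "lead q = u + m"
      unfolding lead_def k p(3)[symmetric]
      by (rule mono_Max_commute[symmetric]) (use p(2) in \<open>auto intro: monoI add_left_mono\<close>)
    ultimately show ?thesis by (force simp: E_def add.commute)
  qed
  fix d
  have sub: "V d \<subseteq> forms I d" by (auto simp: V_def vanishing_forms_def)
  have fin: "finite (monomials I d)" using assms by (rule finite_monomials)
  \<comment> \<open>A monomial has only one degree, so the union over all degrees in
    \<open>E\<close> adds nothing in degree \<open>d\<close>.\<close>
  have L: "lead ` (V d - {0}) = {m \<in> monomials I d. m \<in> E}"
  proof (intro equalityI subsetI)
    fix m assume "m \<in> lead ` (V d - {0})"
    thus "m \<in> {m \<in> monomials I d. m \<in> E}"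
      using sub lead_in_keys forms_keys by (fastforce simp: E_def)
  next
    fix m assume "m \<in> {m \<in> monomials I d. m \<in> E}"
    then obtain d' where m: "m \<in> monomials I d" "m \<in> lead ` (V d' - {0})" by (auto simp: E_def)
    hence "m \<in> monomials I d'"
      using lead_in_keys forms_keys by (fastforce simp: V_def vanishing_forms_def)
    hence "d' = d" using m(1) by (simp add: monomials_def)
    thus "m \<in> lead ` (V d - {0})" using m by simp
  qed
  have "pm.dim (V d) = card {m \<in> monomials I d. m \<in> E}"
    using dim_eq_card_lead[OF fin sub[unfolded forms_def]] vanishing_forms_subspace[of I Z d] L
    by (simp add: V_def)
  moreover have "pm.dim (forms I d) = card (monomials I d)"
    unfolding forms_def by (rule dim_coord_space[OF fin])
  moreover have "monomials I d - {m \<in> monomials I d. m \<in> E} = {m \<in> monomials I d. m \<notin> E}" by auto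
  moreover have "card (monomials I d - {m \<in> monomials I d. m \<in> E}) = card (monomials I d) - card {m \<in> monomials I d. m \<in> E}"
    by (rule card_Diff_subset) (use fin in auto)
  ultimately show "hilbert_function I Z d = card {m \<in> monomials I d. m \<notin> E}"
    by (simp add: hilbert_function_def V_def)
qed

subsection \<open>Dickson's lemma\<close>

text \<open>There is a monotone subsequence; if it decreases, it is constant from the index of its
  minimum on.\<close>

lemma nat_incseq_subseq:
  fixes f :: "nat \<Rightarrow> nat"
  shows "\<exists>r. strict_mono r \<and> incseq (\<lambda>k. f (r k))"
proof -
  obtain r where r: "strict_mono r" "monoseq (\<lambda>k. f (r k))" using seq_monosub by blast
  show ?thesis
  proof (cases "incseq (\<lambda>k. f (r k))")
    case False
    hence dec: "decseq (\<lambda>k. f (r k))" using r(2) monoseq_iff by blast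
    define N where "N = (ARG_MIN (\<lambda>k. f (r k)) k. True)"
    have N: "f (r N) \<le> f (r k)" for k unfolding N_def by (rule arg_min_nat_le) simp
    have "f (r (N + k)) = f (r N)" for k
      using N[of "N + k"] decseqD[OF dec, of N "N + k"] by simp
    thus ?thesis using r(1) by (intro exI[of _ "\<lambda>k. r (N + k)"]) (auto simp: strict_mono_def)
  qed (use r in blast)
qed

lemma incseq_subseq_finite:
  fixes f :: "nat \<Rightarrow> 'i \<Rightarrow> nat"
  assumes "finite I"
  shows "\<exists>r. strict_mono r \<and> (\<forall>x\<in>I. incseq (\<lambda>k. f (r k) x))"
  using assms
proof (induction I rule: finite_induct)
  case empty
  show ?case by (intro exI[of _ id]) (auto simp: strict_mono_def)
next
  case (insert i I)
  then obtain r where r: "strict_mono r" "\<forall>x\<in>I. incseq (\<lambda>k. f (r k) x)" by blast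
  obtain q where q: "strict_mono q" "incseq (\<lambda>k. f (r (q k)) i)"
    using nat_incseq_subseq[of "\<lambda>k. f (r k) i"] by blast
  have "strict_mono (\<lambda>k. r (q k))" using r(1) q(1) by (simp add: strict_mono_def)
  moreover have "incseq (\<lambda>k. f (r (q k)) x)" if "x \<in> I" for x
  proof (rule monoI)
    fix a b :: nat assume "a \<le> b"
    hence "q a \<le> q b" using q(1) by (simp add: strict_mono_less_eq)
    moreover have "incseq (\<lambda>k. f (r k) x)" using r(2) that by blast
    ultimately show "f (r (q a)) x \<le> f (r (q b)) x" by (meson monoD)
  qed
  ultimately show ?case using q(2) by blast
qed

text \<open>If the chain kept growing, elements that newly enter it would form a sequence with a
  subsequence increasing in every coordinate. A later element \<open>b\<close> then lies above an
  earlier one \<open>a\<close>, so upward closure already puts \<open>b\<close> into the set that it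
  was chosen to avoid.\<close>

lemma upward_closed_chain_stabilizes:
  fixes E :: "nat \<Rightarrow> ('i \<Rightarrow>\<^sub>0 nat) set"
  assumes "finite I" "\<And>k. E k \<subseteq> E (Suc k)"
    and keys: "\<And>k m. m \<in> E k \<Longrightarrow> keys m \<subseteq> I"
    and up: "\<And>k m u. m \<in> E k \<Longrightarrow> keys u \<subseteq> I \<Longrightarrow> m + u \<in> E k"
  shows "\<exists>k0. \<forall>k\<ge>k0. E k = E k0"
proof (rule ccontr)
  assume "\<not> ?thesis"
  hence nst: "\<And>k0. \<exists>k\<ge>k0. E k \<noteq> E k0" by blast
  have mono: "E a \<subseteq> E b" if "a \<le> b" for a b
    using that assms(2) by (rule lift_Suc_mono_le[rotated])
  have "\<exists>m k'. k < k' \<and> m \<in> E k' \<and> m \<notin> E k" for k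
  proof -
    obtain k' where "k' \<ge> k" "E k' \<noteq> E k" using nst by blast
    thus ?thesis using mono[of k k'] by (metis le_neq_implies_less psubsetI psubset_imp_ex_mem Diff_iff)
  qed
  then obtain M K where MK: "\<And>k. k < K k \<and> M k \<in> E (K k) \<and> M k \<notin> E k" by metis
  \<comment> \<open>Iterates the jump \<open>K\<close>, so that \<open>M (c j)\<close> lies in
    \<open>E (c (Suc j))\<close> but not in \<open>E (c j)\<close>.\<close>
  define c where "c j = (K ^^ j) 0" for j
  have c: "c (Suc j) = K (c j)" for j by (simp add: c_def)
  have cm: "c a \<le> c b" if "a \<le> b" for a b
    by (rule lift_Suc_mono_le[OF _ that]) (use MK c less_imp_le in auto)
  obtain r where r: "strict_mono r" "\<forall>x\<in>I. incseq (\<lambda>k. lookup (M (c (r k))) x)"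
    using incseq_subseq_finite[OF assms(1), of "\<lambda>k. lookup (M (c k))"] by blast
  define a b where "a = M (c (r 0))" and "b = M (c (r 1))"
  have r01: "Suc (r 0) \<le> r 1" using r(1) by (simp add: strict_mono_def Suc_leI)
  have aE: "a \<in> E (c (Suc (r 0)))" using MK by (simp add: a_def c)
  hence aE': "a \<in> E (c (r 1))" using mono[OF cm[OF r01]] by auto
  have bk: "keys b \<subseteq> I" using MK keys by (metis b_def)
  have le: "lookup a x \<le> lookup b x" for x
  proof (cases "x \<in> I")
    case True thus ?thesis using r(2) by (auto simp: a_def b_def incseq_def)
  next
    case False
    hence "lookup a x = 0" using keys[OF aE] by (auto simp: in_keys_iff)
    thus ?thesis by simp
  qed
  have "b = a + (b - a)" by (rule poly_mapping_eqI) (simp add: lookup_add lookup_minus le)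
  moreover have "a + (b - a) \<in> E (c (r 1))"
    by (rule up[OF aE']) (use bk in \<open>auto simp: in_keys_iff lookup_minus\<close>)
  ultimately show False using MK b_def by metis
qed

subsection \<open>Eventually polynomial sequences\<close>

definition ev_poly :: "(nat \<Rightarrow> rat) \<Rightarrow> bool" where
  "ev_poly f \<longleftrightarrow> (\<exists>P. eventually (\<lambda>d. f d = poly P (of_nat d)) sequentially)"

lemma ev_poly_add: "ev_poly f \<Longrightarrow> ev_poly g \<Longrightarrow> ev_poly (\<lambda>d. f d + g d)"
proof -
  assume "ev_poly f" "ev_poly g"
  then obtain P Q where "eventually (\<lambda>d. f d = poly P (of_nat d)) sequentially"
    "eventually (\<lambda>d. g d = poly Q (of_nat d)) sequentially" by (auto simp: ev_poly_def)
  hence "eventually (\<lambda>d. f d + g d = poly (P + Q) (of_nat d)) sequentially"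
    by eventually_elim simp
  thus ?thesis unfolding ev_poly_def by blast
qed

lemma ev_poly_const: "ev_poly (\<lambda>d. c)"
  unfolding ev_poly_def by (intro exI[of _ "[:c:]"]) simp

lemma ev_poly_sum: "(\<And>a. a \<in> A \<Longrightarrow> ev_poly (f a)) \<Longrightarrow> ev_poly (\<lambda>d. \<Sum>a\<in>A. f a d)"
  by (induction A rule: infinite_finite_induct) (auto intro: ev_poly_add ev_poly_const)

lemma ev_poly_cong: "eventually (\<lambda>d. f d = g d) sequentially \<Longrightarrow> ev_poly g \<Longrightarrow> ev_poly f"
proof -
  assume 1: "eventually (\<lambda>d. f d = g d) sequentially" and "ev_poly g"
  then obtain P where "eventually (\<lambda>d. g d = poly P (of_nat d)) sequentially" by (auto simp: ev_poly_def)
  with 1 have "eventually (\<lambda>d. f d = poly P (of_nat d)) sequentially" by eventually_elim simp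
  thus ?thesis unfolding ev_poly_def by blast
qed

lemma ev_poly_shift:
  assumes "ev_poly f" shows "ev_poly (\<lambda>d. f (d - k))"
proof -
  obtain P where P: "eventually (\<lambda>d. f d = poly P (of_nat d)) sequentially"
    using assms by (auto simp: ev_poly_def)
  then obtain N where N: "\<And>d. d \<ge> N \<Longrightarrow> f d = poly P (of_nat d)" by (auto simp: eventually_sequentially)
  have "f (d - k) = poly (pcompose P [:- of_nat k, 1:]) (of_nat d)" if "d \<ge> N + k" for d
    using N[of "d - k"] that by (simp add: poly_pcompose of_nat_diff)
  thus ?thesis unfolding ev_poly_def eventually_sequentially by blast
qed

text \<open>Pascal's recursion: telescoping the differences of \<open>of_nat j ^ Suc k\<close>
  expresses this sum through those with smaller exponents.\<close>

lemma power_sum_poly: "\<exists>Q :: rat poly. \<forall>d. (\<Sum>j<d. of_nat j ^ k) = poly Q (of_nat d)"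
proof (induction k rule: less_induct)
  case (less k)
  then obtain Q :: "nat \<Rightarrow> rat poly" where Q: "\<And>i d. i < k \<Longrightarrow> (\<Sum>j<d. of_nat j ^ i) = poly (Q i) (of_nat d)"
    by metis
  define R where "R = Polynomial.smult (1 / of_nat (Suc k)) (Polynomial.monom 1 (Suc k) - (\<Sum>i<k. Polynomial.smult (of_nat (Suc k choose i)) (Q i)))"
  have "(\<Sum>j<d. of_nat j ^ k) = poly R (of_nat d)" for d
  proof -
    have "of_nat d ^ Suc k = (\<Sum>j<d. (of_nat (Suc j) :: rat) ^ Suc k - of_nat j ^ Suc k)"
      by (induction d) auto
    also have "\<dots> = (\<Sum>j<d. \<Sum>i\<le>k. of_nat (Suc k choose i) * of_nat j ^ i)"
    proof (intro sum.cong refl)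
      fix j
      have "(of_nat (Suc j) :: rat) ^ Suc k = (of_nat j + 1) ^ Suc k" by (simp add: add.commute)
      also have "\<dots> = (\<Sum>i\<le>Suc k. of_nat (Suc k choose i) * of_nat j ^ i)"
        by (subst binomial_ring) simp
      also have "\<dots> = (\<Sum>i\<le>k. of_nat (Suc k choose i) * of_nat j ^ i) + of_nat j ^ Suc k" by simp
      finally show "(of_nat (Suc j) :: rat) ^ Suc k - of_nat j ^ Suc k = (\<Sum>i\<le>k. of_nat (Suc k choose i) * of_nat j ^ i)"
        by simp
    qed
    also have "\<dots> = (\<Sum>i\<le>k. of_nat (Suc k choose i) * (\<Sum>j<d. of_nat j ^ i))"
      by (subst sum.swap) (simp add: sum_distrib_left)
    also have "\<dots> = (\<Sum>i<k. of_nat (Suc k choose i) * poly (Q i) (of_nat d)) + of_nat (Suc k) * (\<Sum>j<d. of_nat j ^ k)"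
      using Q by (simp add: lessThan_Suc_atMost[symmetric])
    finally have "(\<Sum>j<d. of_nat j ^ k) = (of_nat d ^ Suc k - (\<Sum>i<k. of_nat (Suc k choose i) * poly (Q i) (of_nat d))) / (of_nat (Suc k) :: rat)"
      by (simp add: field_simps del: of_nat_Suc power_Suc)
    thus ?thesis by (simp add: R_def poly_monom poly_sum del: of_nat_Suc power_Suc)
  qed
  thus ?case by blast
qed

lemma ev_poly_summation:
  assumes "ev_poly f" shows "ev_poly (\<lambda>d. \<Sum>j\<le>d. f j)"
proof -
  obtain P N where N: "\<And>d. d \<ge> N \<Longrightarrow> f d = poly P (of_nat d)"
    using assms by (auto simp: ev_poly_def eventually_sequentially)
  obtain Q :: "nat \<Rightarrow> rat poly" where Q: "\<And>i d. (\<Sum>j<d. of_nat j ^ i) = poly (Q i) (of_nat d)"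
    using power_sum_poly by metis
  define c where "c = (\<Sum>j<N. f j - poly P (of_nat j))"
  define S where "S = (\<Sum>i\<le>Polynomial.degree P. Polynomial.smult (coeff P i) (Q i))"
  \<comment> \<open>\<open>c\<close> corrects the finitely many terms where \<open>f\<close> differs
    from \<open>P\<close>. The substitution \<open>[:1, 1:]\<close> passes from sums over
    \<open>j < d\<close> to sums over \<open>j \<le> d\<close>.\<close>
  have "(\<Sum>j\<le>d. f j) = poly ([:c:] + pcompose S [:1, 1:]) (of_nat d)" if "d \<ge> N" for d
  proof -
    have "(\<Sum>j\<le>d. f j) = (\<Sum>j<Suc d. poly P (of_nat j)) + (\<Sum>j<Suc d. f j - poly P (of_nat j))"
      by (simp add: lessThan_Suc_atMost sum_subtractf)
    also have "(\<Sum>j<Suc d. f j - poly P (of_nat j)) = c"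
      unfolding c_def by (rule sum.mono_neutral_right) (use that N in auto)
    also have "(\<Sum>j<Suc d. poly P (of_nat j)) = poly S (of_nat (Suc d))"
      unfolding poly_altdef[of P] S_def
      by (subst sum.swap) (simp add: poly_sum Q[symmetric] sum_distrib_left del: of_nat_Suc sum.lessThan_Suc)
    finally show ?thesis by (simp add: poly_pcompose add_ac)
  qed
  thus ?thesis unfolding ev_poly_def eventually_sequentially by blast
qed

lemma monomials_insert:
  assumes "finite I" "i \<notin> I"
  shows "monomials (insert i I) d = (\<Union>k\<le>d. (\<lambda>m. m + single i k) ` monomials I (d - k))"
proof (intro equalityI subsetI)
  fix m assume m: "m \<in> monomials (insert i I) d"
  define k where "k = lookup m i"
  define m' where "m' = m - single i k"
  have mm: "m = m' + single i k"
    by (rule poly_mapping_eqI) (auto simp: m'_def k_def lookup_add lookup_minus lookup_single when_def)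
  have "keys m \<subseteq> insert i I" using m by (rule monomials_keys)
  hence k': "keys m' \<subseteq> I"
    by (auto simp: m'_def k_def in_keys_iff lookup_minus lookup_single when_def subset_iff split: if_splits)
  have "(\<Sum>j\<in>insert i I. lookup m j) = d"
    using m assms(1) monomials_superset[of "insert i I" m d] monomials_keys[OF m] by simp
  hence "k + (\<Sum>j\<in>I. lookup m j) = d" using assms by (simp add: k_def)
  moreover have "(\<Sum>j\<in>I. lookup m j) = (\<Sum>j\<in>I. lookup m' j)"
    using assms(2) by (intro sum.cong) (auto simp: m'_def lookup_minus lookup_single when_def)
  ultimately have "k \<le> d" "m' \<in> monomials I (d - k)"
    using assms(1) k' by (auto simp: monomials_superset)
  thus "m \<in> (\<Union>k\<le>d. (\<lambda>m. m + single i k) ` monomials I (d - k))" using mm by blast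
next
  fix m assume "m \<in> (\<Union>k\<le>d. (\<lambda>m. m + single i k) ` monomials I (d - k))"
  then obtain k m' where k: "k \<le> d" "m' \<in> monomials I (d - k)" "m = m' + single i k" by blast
  have "m' \<in> monomials (insert i I) (d - k)" using k by (auto simp: monomials_def)
  hence "m' + single i k \<in> monomials (insert i I) (d - k + k)"
    by (intro monomials_add monomials_single) auto
  thus "m \<in> monomials (insert i I) d" using k by simp
qed

text \<open>Slicing \<open>E\<close> by the exponent \<open>k\<close> of the new variable gives an
  increasing chain \<open>S k\<close> of upward closed sets in fewer variables, which is constant
  from some \<open>k0\<close> on. The slices below \<open>k0\<close> contribute finitely many
  shifted eventually polynomial functions; the others form a partial sum of a single one.\<close>

lemma ev_poly_card_not_in_upward_closed:
  fixes E :: "('i \<Rightarrow>\<^sub>0 nat) set"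
  assumes "finite I" and "\<And>m u. m \<in> E \<Longrightarrow> keys u \<subseteq> I \<Longrightarrow> m + u \<in> E"
  shows "ev_poly (\<lambda>d. of_nat (card {m \<in> monomials I d. m \<notin> E}))"
  using assms
proof (induction I arbitrary: E rule: finite_induct)
  case empty
  have "{m \<in> monomials {} d. m \<notin> E} = {}" if "d \<ge> 1" for d using that by (auto simp: monomials_def)
  hence "eventually (\<lambda>d. (of_nat (card {m \<in> monomials {} d. m \<notin> E}) :: rat) = 0) sequentially"
    unfolding eventually_sequentially by (intro exI[of _ 1] allI impI) (simp only: card.empty of_nat_0)
  thus ?case by (rule ev_poly_cong) (rule ev_poly_const)
next
  case (insert i I)
  define S where "S k = {m. keys m \<subseteq> I \<and> m + single i k \<in> E}" for k
  have Sup: "m + u \<in> S k" if "m \<in> S k" "keys u \<subseteq> I" for m u k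
    using that insert.prems[of "m + single i k" u] keys_add[of m u]
    by (auto simp: S_def add_ac)
  have Smono: "S k \<subseteq> S (Suc k)" for k
  proof
    fix m assume "m \<in> S k"
    thus "m \<in> S (Suc k)"
      using insert.prems[of "m + single i k" "single i 1"]
      by (simp add: S_def add.assoc flip: single_add)
  qed
  have "\<exists>k0. \<forall>k\<ge>k0. S k = S k0"
    by (rule upward_closed_chain_stabilizes[where E = S, OF insert.hyps(1)], rule Smono)
       (simp add: S_def, rule Sup, assumption+)
  then obtain k0 where k0: "\<And>k. k \<ge> k0 \<Longrightarrow> S k = S k0" by blast
  define a where "a k d = card {m \<in> monomials I d. m \<notin> S k}" for k d
  have ev: "ev_poly (\<lambda>d. of_nat (a k d))" for k
    unfolding a_def by (rule insert.IH) (rule Sup)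
  have cnt: "card {m \<in> monomials (insert i I) d. m \<notin> E} = (\<Sum>k\<le>d. a k (d - k))" for d
  proof -
    have "{m \<in> monomials (insert i I) d. m \<notin> E}
        = (\<Union>k\<le>d. (\<lambda>m. m + single i k) ` {m \<in> monomials I (d - k). m \<notin> S k})"
      unfolding monomials_insert[OF insert.hyps] by (auto simp: S_def monomials_def)
    also have "card \<dots> = (\<Sum>k\<le>d. card ((\<lambda>m. m + single i k) ` {m \<in> monomials I (d - k). m \<notin> S k}))"
    proof (rule card_UN_disjoint)
      show "\<forall>k\<in>{..d}. \<forall>k'\<in>{..d}. k \<noteq> k' \<longrightarrow>
         (\<lambda>m. m + single i k) ` {m \<in> monomials I (d - k). m \<notin> S k}
       \<inter> (\<lambda>m. m + single i k') ` {m \<in> monomials I (d - k'). m \<notin> S k'} = {}"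
      proof (intro ballI impI equals0I)
        fix k k' x
        assume "k \<noteq> k'" "x \<in> (\<lambda>m. m + single i k) ` {m \<in> monomials I (d - k). m \<notin> S k}
       \<inter> (\<lambda>m. m + single i k') ` {m \<in> monomials I (d - k'). m \<notin> S k'}"
        then obtain m m' where m: "m \<in> monomials I (d - k)" "m' \<in> monomials I (d - k')"
          "m + single i k = m' + single i k'" by auto
        have "lookup m i = 0" "lookup m' i = 0"
          using m(1,2) insert.hyps(2) by (auto simp: monomials_def in_keys_iff)
        moreover have "lookup (m + single i k) i = lookup (m' + single i k') i"
          using m(3) by simp
        ultimately show False using \<open>k \<noteq> k'\<close> by (simp add: lookup_add)
      qed
    qed (use finite_monomials[OF insert.hyps(1)] in auto)
    also have "\<dots> = (\<Sum>k\<le>d. a k (d - k))"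
      unfolding a_def by (intro sum.cong refl card_image) (auto simp: inj_on_def)
    finally show ?thesis .
  qed
  have "eventually (\<lambda>d. (of_nat (card {m \<in> monomials (insert i I) d. m \<notin> E}) :: rat)
      = (\<Sum>k<k0. of_nat (a k (d - k))) + (\<Sum>j\<le>d - k0. of_nat (a k0 j))) sequentially"
    unfolding eventually_sequentially
  proof (intro exI[of _ k0] allI impI)
    fix d assume d: "d \<ge> k0"
    have "(\<Sum>k\<le>d. a k (d - k)) = (\<Sum>k<k0. a k (d - k)) + (\<Sum>k\<in>{k0..d}. a k (d - k))"
      by (subst sum.union_disjoint[symmetric]) (use d in \<open>auto intro!: sum.cong\<close>)
    also have "(\<Sum>k\<in>{k0..d}. a k (d - k)) = (\<Sum>k\<in>{k0..d}. a k0 (d - k))"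
      by (intro sum.cong refl) (metis a_def atLeastAtMost_iff k0)
    also have "\<dots> = (\<Sum>j\<le>d - k0. a k0 j)"
      by (rule sum.reindex_bij_witness[of _ "\<lambda>j. d - j" "\<lambda>k. d - k"]) (use d in auto)
    finally show "(of_nat (card {m \<in> monomials (insert i I) d. m \<notin> E}) :: rat)
      = (\<Sum>k<k0. of_nat (a k (d - k))) + (\<Sum>j\<le>d - k0. of_nat (a k0 j))"
      unfolding cnt by simp
  qed
  moreover have "ev_poly (\<lambda>d. (\<Sum>k<k0. of_nat (a k (d - k))) + (\<Sum>j\<le>d - k0. of_nat (a k0 j)))"
    by (intro ev_poly_add ev_poly_sum ev_poly_shift[OF ev] ev_poly_shift[OF ev_poly_summation[OF ev]])
  ultimately show ?case by (rule ev_poly_cong)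
qed

lemma ev_poly_hilbert_function:
  fixes I :: "'i::linorder set"
  assumes "finite I" shows "ev_poly (\<lambda>d. of_nat (hilbert_function I Z d))"
proof -
  obtain E where "\<And>m u. m \<in> E \<Longrightarrow> keys u \<subseteq> I \<Longrightarrow> m + u \<in> E"
    "\<And>d. hilbert_function I Z d = card {m \<in> monomials I d. m \<notin> E}"
    using hilbert_function_eq_card[OF assms] by metis
  thus ?thesis using ev_poly_card_not_in_upward_closed[OF assms, of E] by simp
qed

section \<open>The Hilbert polynomial, and the degree as a growth rate\<close>

lemma poly_eq_if_eventually_eq:
  fixes P Q :: "rat poly"
  assumes "eventually (\<lambda>d. poly P (of_nat d) = poly Q (of_nat d)) sequentially"
  shows "P = Q"
proof (rule ccontr)
  assume "P \<noteq> Q"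
  hence "finite {x. poly (P - Q) x = 0}" by (intro poly_roots_finite) auto
  moreover obtain N where N: "\<And>d. d \<ge> N \<Longrightarrow> poly P (of_nat d) = poly Q (of_nat d)"
    using assms by (auto simp: eventually_sequentially)
  have "of_nat ` {N..} \<subseteq> {x. poly (P - Q) x = 0}" using N by auto
  moreover have "infinite ((of_nat :: nat \<Rightarrow> rat) ` {N..})"
    by (subst finite_image_iff) (auto simp: inj_on_def infinite_Ici)
  ultimately show False using finite_subset by blast
qed

text \<open>Existence and uniqueness together give the definite description its meaning.\<close>

lemma hilbert_poly:
  fixes I :: "'i::linorder set"
  assumes "finite I"
  shows "eventually (\<lambda>d. of_nat (hilbert_function I Z d) = poly (hilbert_poly I Z) (of_nat d)) sequentially"
proof -
  obtain P where P: "eventually (\<lambda>d. (of_nat (hilbert_function I Z d) :: rat) = poly P (of_nat d)) sequentially"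
    using ev_poly_hilbert_function[OF assms, of Z] by (auto simp: ev_poly_def)
  show ?thesis unfolding hilbert_poly_def
  proof (rule theI[where P = "\<lambda>P. eventually (\<lambda>d. of_nat (hilbert_function I Z d) = poly P (of_nat d)) sequentially"])
    show "eventually (\<lambda>d. of_nat (hilbert_function I Z d) = poly P (of_nat d)) sequentially" by (rule P)
    fix Q :: "rat poly" assume "eventually (\<lambda>d. of_nat (hilbert_function I Z d) = poly Q (of_nat d)) sequentially"
    with P have "eventually (\<lambda>d. poly Q (of_nat d) = poly P (of_nat d)) sequentially"
      by eventually_elim simp
    thus "Q = P" by (rule poly_eq_if_eventually_eq)
  qed
qed

lemma poly_over_power_tendsto_lead_coeff:
  fixes R :: "real poly"
  shows "(\<lambda>d. poly R (real d) / real d ^ Polynomial.degree R) \<longlonglongrightarrow> lead_coeff R"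
proof -
  let ?D = "Polynomial.degree R"
  have "(\<lambda>d. \<Sum>i\<le>?D. coeff R i * (1 / real d) ^ (?D - i)) \<longlonglongrightarrow> (\<Sum>i\<le>?D. coeff R i * 0 ^ (?D - i))"
    by (intro tendsto_intros lim_1_over_n)
  also have "(\<Sum>i\<le>?D. coeff R i * 0 ^ (?D - i)) = (\<Sum>i\<in>{?D}. coeff R i * 0 ^ (?D - i))"
    by (rule sum.mono_neutral_right) auto
  also have "\<dots> = lead_coeff R" by simp
  finally show ?thesis
  proof (rule Lim_transform_eventually)
    show "eventually (\<lambda>d. (\<Sum>i\<le>?D. coeff R i * (1 / real d) ^ (?D - i)) = poly R (real d) / real d ^ ?D) sequentially"
      using eventually_gt_at_top[of 0]
    proof eventually_elim
      case (elim d)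
      show ?case unfolding poly_altdef sum_divide_distrib
      proof (intro sum.cong refl)
        fix i assume "i \<in> {..?D}"
        hence "real d ^ ?D = real d ^ i * real d ^ (?D - i)" by (simp flip: power_add)
        thus "coeff R i * (1 / real d) ^ (?D - i) = coeff R i * real d ^ i / real d ^ ?D"
          using elim by (simp add: power_divide)
      qed
    qed
  qed
qed

lemma power_ratio_tendsto_0:
  assumes "a < b" shows "(\<lambda>d. real d ^ a / real d ^ b) \<longlonglongrightarrow> 0"
proof -
  have "(\<lambda>d. (1 / real d) ^ (b - a)) \<longlonglongrightarrow> 0 ^ (b - a)" by (intro tendsto_intros lim_1_over_n)
  moreover have "(0::real) ^ (b - a) = 0" using assms by simp
  ultimately have "(\<lambda>d. (1 / real d) ^ (b - a)) \<longlonglongrightarrow> 0" by simp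
  thus ?thesis
  proof (rule Lim_transform_eventually)
    show "eventually (\<lambda>d. (1 / real d) ^ (b - a) = real d ^ a / real d ^ b) sequentially"
      using eventually_gt_at_top[of 0]
    proof eventually_elim
      case (elim d)
      have "real d ^ b = real d ^ a * real d ^ (b - a)" using assms by (simp flip: power_add)
      thus ?case using elim by (simp add: power_divide)
    qed
  qed
qed

text \<open>Computes the degree from asymptotics alone: a nonzero limit forces \<open>r\<close> to
  be the degree of the Hilbert polynomial and \<open>c\<close> to be its leading
  coefficient.\<close>

lemma proj_degree_eqI:
  fixes I :: "'i::linorder set" and c :: rat
  assumes "finite I" "c \<noteq> 0"
    and lim: "(\<lambda>d. real (hilbert_function I Z d) / real d ^ r) \<longlonglongrightarrow> real_of_rat c"
  shows "proj_degree I Z = fact r * c"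
proof -
  define P where "P = hilbert_poly I Z"
  define R where "R = map_poly real_of_rat P"
  have deg: "Polynomial.degree R = Polynomial.degree P" unfolding R_def by (rule degree_map_poly) simp
  have cf: "coeff R i = real_of_rat (coeff P i)" for i by (simp add: R_def coeff_map_poly)
  have ev: "eventually (\<lambda>d. real (hilbert_function I Z d) = poly R (real d)) sequentially"
    using hilbert_poly[OF assms(1), of Z]
  proof eventually_elim
    case (elim d)
    have "poly R (real d) = real_of_rat (poly P (of_nat d))"
      by (simp add: poly_altdef deg cf of_rat_sum of_rat_mult of_rat_power)
    also have "\<dots> = real (hilbert_function I Z d)" using elim by (simp add: P_def flip: elim)
    finally show ?case by simp
  qed
  let ?D = "Polynomial.degree R"
  have D: "?D = Polynomial.degree P" by (rule deg)
  have lc: "lead_coeff R = real_of_rat (lead_coeff P)" by (simp add: deg cf)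
  have lim2: "(\<lambda>d. real (hilbert_function I Z d) / real d ^ ?D) \<longlonglongrightarrow> lead_coeff R"
    by (rule Lim_transform_eventually[OF poly_over_power_tendsto_lead_coeff])
       (use ev in eventually_elim, simp)
  have pos: "eventually (\<lambda>d. d > (0::nat)) sequentially" by (rule eventually_gt_at_top)
  have "?D = r"
  proof (rule ccontr)
    assume "?D \<noteq> r"
    then consider "?D < r" | "r < ?D" by linarith
    thus False
    proof cases
      case 1
      have "(\<lambda>d. real (hilbert_function I Z d) / real d ^ ?D * (real d ^ ?D / real d ^ r)) \<longlonglongrightarrow> lead_coeff R * 0"
        by (intro tendsto_mult lim2 power_ratio_tendsto_0 1)
      hence "(\<lambda>d. real (hilbert_function I Z d) / real d ^ r) \<longlonglongrightarrow> lead_coeff R * 0"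
        by (rule Lim_transform_eventually) (use pos in eventually_elim, simp)
      hence "real_of_rat c = 0" using lim LIMSEQ_unique by fastforce
      thus False using assms(2) by simp
    next
      case 2
      have "(\<lambda>d. real (hilbert_function I Z d) / real d ^ r * (real d ^ r / real d ^ ?D)) \<longlonglongrightarrow> real_of_rat c * 0"
        by (intro tendsto_mult lim power_ratio_tendsto_0 2)
      hence "(\<lambda>d. real (hilbert_function I Z d) / real d ^ ?D) \<longlonglongrightarrow> real_of_rat c * 0"
        by (rule Lim_transform_eventually) (use pos in eventually_elim, simp)
      hence "lead_coeff R = 0" using lim2 LIMSEQ_unique by fastforce
      thus False using 2 by simp
    qed
  qed
  moreover from this have "real_of_rat (lead_coeff P) = real_of_rat c"
    using lim lim2 LIMSEQ_unique lc by metis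
  ultimately show ?thesis using D by (simp add: proj_degree_def P_def)
qed

section \<open>Linear dependence\<close>

lemma homogeneous_system_nontrivial_solution:
  fixes c :: "'x \<Rightarrow> 'b \<Rightarrow> complex"
  assumes "finite X" "finite S" "card S < card X"
  shows "\<exists>l. (\<exists>x\<in>X. l x \<noteq> 0) \<and> (\<forall>b\<in>S. (\<Sum>x\<in>X. l x * c x b) = 0)"
proof -
  define v where "v x = (\<Sum>b\<in>S. single b (c x b))" for x
  have lv: "lookup (v x) b = c x b" if "b \<in> S" for x b
    using that assms by (simp add: v_def lookup_sum_single)
  have span: "v x \<in> pm.span ((\<lambda>b. single b 1) ` S)" for x
  proof -
    have "single b (c x b) = scale_pm (c x b) (single b 1)" for b
      by (rule poly_mapping_eqI) (simp add: lookup_single when_def)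
    hence "v x = (\<Sum>b\<in>S. scale_pm (c x b) (single b 1))" by (simp add: v_def)
    thus ?thesis by (simp only:) (intro pm.span_sum pm.span_scale pm.span_base imageI)
  qed
  have bound: "card A \<le> card S" if "pm.independent A" "A \<subseteq> v ` X" for A
  proof -
    have "card A \<le> card ((\<lambda>b. single b (1::complex)) ` S)"
      using pm.independent_span_bound[of "(\<lambda>b. single b (1::complex)) ` S" A] that assms span by auto
    also have "\<dots> \<le> card S" by (rule card_image_le) (rule assms)
    finally show ?thesis .
  qed
  have "\<exists>l. (\<exists>x\<in>X. l x \<noteq> 0) \<and> (\<Sum>x\<in>X. scale_pm (l x) (v x)) = 0"
  \<comment> \<open>Independence is a property of sets of vectors, so a repeated vector has to
    supply its own relation.\<close>
  proof (cases "inj_on v X")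
    case False
    then obtain x y where xy: "x \<in> X" "y \<in> X" "x \<noteq> y" "v x = v y" by (auto simp: inj_on_def)
    define l where "l = (\<lambda>z. if z = x then 1 else if z = y then -1 else (0::complex))"
    have "(\<Sum>z\<in>X. scale_pm (l z) (v z)) = (\<Sum>z\<in>{x, y}. scale_pm (l z) (v z))"
      by (rule sum.mono_neutral_right) (use xy assms in \<open>auto simp: l_def\<close>)
    also have "\<dots> = 0" using xy by (simp add: l_def)
    finally show ?thesis using xy by (intro exI[of _ l]) (auto simp: l_def)
  next
    case True
    have "\<not> pm.independent (v ` X)" using bound[of "v ` X"] assms card_image[OF True] by auto
    then obtain f w where f: "(\<Sum>w\<in>v ` X. scale_pm (f w) w) = 0" "w \<in> v ` X" "f w \<noteq> 0"
      using pm.independent_if_scalars_zero[of "v ` X"] assms(1) by blast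
    thus ?thesis using True by (intro exI[of _ "\<lambda>x. f (v x)"]) (auto simp: sum.reindex)
  qed
  then obtain l where l: "\<exists>x\<in>X. l x \<noteq> 0" "(\<Sum>x\<in>X. scale_pm (l x) (v x)) = 0" by blast
  have "(\<Sum>x\<in>X. l x * c x b) = 0" if "b \<in> S" for b
  proof -
    have "lookup (\<Sum>x\<in>X. scale_pm (l x) (v x)) b = 0" using l(2) by simp
    thus ?thesis using that by (simp add: lookup_sum lv)
  qed
  thus ?thesis using l(1) by blast
qed

lemma vectors_nontrivial_relation:
  assumes "finite X" "finite M" "card M < card X" "\<And>x. x \<in> X \<Longrightarrow> v x \<in> coord_space M"
  shows "\<exists>l. (\<exists>x\<in>X. l x \<noteq> 0) \<and> (\<Sum>x\<in>X. scale_pm (l x) (v x)) = 0"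
proof -
  obtain l where l: "\<exists>x\<in>X. l x \<noteq> 0" "\<forall>b\<in>M. (\<Sum>x\<in>X. l x * lookup (v x) b) = 0"
    using homogeneous_system_nontrivial_solution[OF assms(1-3), of "\<lambda>x. lookup (v x)"] by blast
  have "(\<Sum>x\<in>X. scale_pm (l x) (v x)) = 0"
  proof (rule poly_mapping_eqI)
    fix b
    show "lookup (\<Sum>x\<in>X. scale_pm (l x) (v x)) b = lookup 0 b"
      using l(2) assms(4) by (cases "b \<in> M") (auto simp: lookup_sum coord_space_lookup[OF assms(4)])
  qed
  thus ?thesis using l(1) by blast
qed

text \<open>A basis of \<open>K\<close> together with a family that is independent modulo
  \<open>K\<close> has at most \<open>card M\<close> members. This yields lower bounds for Hilbert
  functions.\<close>

lemma codim_ge: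
  fixes v :: "'x \<Rightarrow> ('a::linorder \<Rightarrow>\<^sub>0 complex)"
  assumes "finite X" "finite M" "\<And>x. x \<in> X \<Longrightarrow> v x \<in> coord_space M"
    and "pm.subspace K" "K \<subseteq> coord_space M"
    and indep: "\<And>l. (\<Sum>x\<in>X. scale_pm (l x) (v x)) \<in> K \<Longrightarrow> \<forall>x\<in>X. l x = 0"
  shows "card X \<le> pm.dim (coord_space M) - pm.dim K"
proof -
  obtain B where B: "B \<subseteq> K" "pm.independent B" "K \<subseteq> pm.span B" "card B = pm.dim K"
    using pm.basis_exists by blast
  have dimM: "pm.dim (coord_space M) = card M" by (rule dim_coord_space) fact
  have sp: "coord_space M \<subseteq> pm.span ((\<lambda>b. single b 1) ` M)"
  proof
    fix v :: "'a \<Rightarrow>\<^sub>0 complex" assume "v \<in> coord_space M"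
    hence "v = (\<Sum>m\<in>M. single m (lookup v m))"
      by (intro poly_mapping_expand) (auto simp: coord_space_def assms)
    also have "\<dots> = (\<Sum>m\<in>M. scale_pm (lookup v m) (single m 1))"
      by (intro sum.cong refl poly_mapping_eqI) (simp add: lookup_single when_def)
    also have "\<dots> \<in> pm.span ((\<lambda>b. single b 1) ` M)"
      by (intro pm.span_sum pm.span_scale pm.span_base imageI)
    finally show "v \<in> pm.span ((\<lambda>b. single b 1) ` M)" .
  qed
  have finB: "finite B"
    using pm.independent_span_bound[of "(\<lambda>b. single b (1::complex)) ` M" B] B assms sp by auto
  have "card B + card X \<le> card M"
  proof (rule ccontr)
    assume "\<not> ?thesis"
    hence "card M < card (B <+> X)" using finB assms by (simp add: card_Plus)
    moreover have "case_sum id v y \<in> coord_space M" if "y \<in> B <+> X" for y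
      using that B(1) assms(3,5) by auto
    ultimately have "\<exists>l. (\<exists>y\<in>B <+> X. l y \<noteq> 0) \<and> (\<Sum>y\<in>B <+> X. scale_pm (l y) (case_sum id v y)) = 0"
      by (intro vectors_nontrivial_relation[of "B <+> X" M]) (simp_all add: finB assms(1,2))
    then obtain l where l: "\<exists>y\<in>B <+> X. l y \<noteq> 0" "(\<Sum>y\<in>B <+> X. scale_pm (l y) (case_sum id v y)) = 0"
      by (elim exE conjE)
    have 0: "(\<Sum>b\<in>B. scale_pm (l (Inl b)) b) + (\<Sum>x\<in>X. scale_pm (l (Inr x)) (v x)) = 0"
      using l(2) finB assms(1) by (simp add: sum.Plus)
    have bK: "(\<Sum>b\<in>B. scale_pm (l (Inl b)) b) \<in> K"
      using B(1) by (intro pm.subspace_sum pm.subspace_scale assms) auto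
    have "(\<Sum>x\<in>X. scale_pm (l (Inr x)) (v x)) = - (\<Sum>b\<in>B. scale_pm (l (Inl b)) b)"
      using 0 by (simp add: eq_neg_iff_add_eq_0 add.commute)
    also have "\<dots> \<in> K" by (rule pm.subspace_neg) (use bK assms in auto)
    finally have X0: "\<forall>x\<in>X. l (Inr x) = 0" by (rule indep)
    hence "(\<Sum>b\<in>B. scale_pm (l (Inl b)) b) = 0" using 0 by simp
    hence "\<forall>b\<in>B. l (Inl b) = 0"
      using B(2) finB pm.independentD[of B B "\<lambda>b. l (Inl b)"] by auto
    thus False using l(1) X0 by auto
  qed
  thus ?thesis using B(4) dimM by simp
qed

text \<open>The vectors supported outside the leading indices of \<open>K\<close> form a complement
  of \<open>K\<close>. If it had dimension above \<open>card S\<close>, a nonzero vector in it would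
  satisfy all the equations and hence lie in \<open>K\<close>, contradicting its leading index. This
  yields upper bounds for Hilbert functions.\<close>

lemma codim_le:
  fixes K :: "('a::linorder \<Rightarrow>\<^sub>0 complex) set" and c :: "'a \<Rightarrow> 'b \<Rightarrow> complex"
  assumes "finite M" "finite S" "pm.subspace K" "K \<subseteq> coord_space M"
    and ker: "\<And>v. v \<in> coord_space M \<Longrightarrow> (\<And>b. b \<in> S \<Longrightarrow> (\<Sum>m\<in>M. lookup v m * c m b) = 0) \<Longrightarrow> v \<in> K"
  shows "pm.dim (coord_space M) - pm.dim K \<le> card S"
proof (rule ccontr)
  assume neg: "\<not> ?thesis"
  define E where "E = lead ` (K - {0})"
  have EM: "E \<subseteq> M" using assms(4) lead_in_keys by (fastforce simp: E_def coord_space_def)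
  have "pm.dim K = card E" unfolding E_def by (rule dim_eq_card_lead) (use assms in auto)
  moreover have "card (M - E) = card M - card E"
    by (rule card_Diff_subset) (use EM assms finite_subset in auto)
  ultimately have "card S < card (M - E)"
    using neg dim_coord_space[OF assms(1)] by simp
  then obtain l where l: "\<exists>m\<in>M - E. l m \<noteq> 0" "\<forall>b\<in>S. (\<Sum>m\<in>M - E. l m * c m b) = 0"
    using homogeneous_system_nontrivial_solution[of "M - E" S c] assms by auto
  define v where "v = (\<Sum>m\<in>M - E. single m (l m))"
  have lv: "lookup v m = (if m \<in> M - E then l m else 0)" for m
    using assms by (simp add: v_def lookup_sum_single)
  have "v \<in> coord_space M" by (rule coord_spaceI) (simp add: lv)
  moreover have "(\<Sum>m\<in>M. lookup v m * c m b) = 0" if "b \<in> S" for b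
  proof -
    have "(\<Sum>m\<in>M. lookup v m * c m b) = (\<Sum>m\<in>M - E. l m * c m b)"
      by (rule sum.mono_neutral_cong_right) (use assms in \<open>auto simp: lv\<close>)
    thus ?thesis using l(2) that by simp
  qed
  ultimately have "v \<in> K" by (rule ker)
  moreover have vn: "v \<noteq> 0" using l(1) lv by (metis lookup_zero)
  ultimately have "lead v \<in> E" by (auto simp: E_def)
  thus False using lookup_lead[OF vn] lv by auto
qed

lemma single_1_eq_iff: "single i (1::nat) = single j 1 \<longleftrightarrow> i = j"
  by (metis lookup_single_eq lookup_single_not_eq one_neq_zero)

section \<open>The parametrization of totally decomposable forms\<close>

locale split_forms =
  fixes n s :: nat
  assumes n: "n \<ge> 1" and s: "s \<ge> 1"
begin

definition lin :: "(nat \<Rightarrow> complex) \<Rightarrow> nat mpol" where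
  "lin a = (\<Sum>j\<le>n. single (single j 1) (a j))"

definition dot :: "(nat \<Rightarrow> complex) \<Rightarrow> (nat \<Rightarrow> complex) \<Rightarrow> complex" where
  "dot a x = (\<Sum>j\<le>n. a j * x j)"

definition form_of :: "(nat \<Rightarrow> nat \<Rightarrow> complex) \<Rightarrow> nat mpol" where
  "form_of L = (\<Prod>i\<in>{1..s}. lin (L i))"

definition pull :: "(nat \<Rightarrow>\<^sub>0 nat) mpol \<Rightarrow> (nat \<Rightarrow> nat \<Rightarrow> complex) \<Rightarrow> complex" where
  "pull P L = mp_eval (lookup (form_of L)) P"

abbreviation idx :: "(nat \<Rightarrow>\<^sub>0 nat) set" where "idx \<equiv> monomials {..n} s"

lemma finite_idx: "finite idx"
  by (simp add: finite_monomials)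

lemma mp_eval_lin [simp]: "mp_eval x (lin a) = dot a x"
  by (simp add: lin_def dot_def mp_eval_sum)

lemma lin_in_forms: "lin a \<in> forms {..n} 1"
  unfolding lin_def by (intro forms_sum forms_single monomials_single) simp

lemma form_of_in_forms: "form_of L \<in> forms {..n} s"
  using forms_prod1[of "{1..s}" "\<lambda>i. lin (L i)" "{..n}"] lin_in_forms by (simp add: form_of_def)

lemma mp_eval_form_of: "mp_eval x (form_of L) = (\<Prod>i\<in>{1..s}. dot (L i) x)"
  by (simp add: form_of_def mp_eval_prod)

lemma form_eq_lin:
  assumes "l \<in> forms {..n} 1"
  shows "l = lin (\<lambda>j. lookup l (single j 1))"
proof -
  have "keys l \<subseteq> (\<lambda>j. single j 1) ` {..n}"
    using assms unfolding forms_def coord_space_def monomials_one by auto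
  hence "l = (\<Sum>m\<in>(\<lambda>j. single j 1) ` {..n}. single m (lookup l m))"
    by (intro poly_mapping_expand) auto
  also have "\<dots> = (\<Sum>j\<le>n. single (single j 1) (lookup l (single j 1)))"
    by (subst sum.reindex) (auto simp: inj_on_def single_1_eq_iff[simplified])
  finally show ?thesis by (simp add: lin_def)
qed

lemma dot_add: "dot (\<lambda>j. a j + b j) x = dot a x + dot b x"
  by (simp add: dot_def ring_distribs sum.distrib)

lemma dot_scale: "dot (\<lambda>j. c * a j) x = c * dot a x"
  by (simp add: dot_def sum_distrib_left mult.assoc)

lemma dot_add_right: "dot a (\<lambda>j. x j + y j) = dot a x + dot a y"
  by (simp add: dot_def ring_distribs sum.distrib)

lemma dot_scale_right: "dot a (\<lambda>j. c * x j) = c * dot a x"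
  by (simp add: dot_def sum_distrib_left mult_ac)

lemma lin_scale: "lin (\<lambda>j. c * a j) = scale_pm c (lin a)"
  by (rule poly_mapping_eqI)
     (auto simp: lin_def lookup_sum lookup_single when_def sum_distrib_left intro!: sum.cong)

subsection \<open>Multihomogeneous functions of the linear factors\<close>

definition multimono :: "(nat \<Rightarrow> (nat \<Rightarrow>\<^sub>0 nat)) \<Rightarrow> (nat \<Rightarrow> nat \<Rightarrow> complex) \<Rightarrow> complex" where
  "multimono T L = (\<Prod>i\<in>{1..s}. mono_eval (L i) (T i))"

definition multidegs :: "nat \<Rightarrow> (nat \<Rightarrow> (nat \<Rightarrow>\<^sub>0 nat)) set" where
  "multidegs d = ({1..s} \<rightarrow>\<^sub>E monomials {..n} d)"

text \<open>Multihomogeneous polynomials of the same degree \<open>d\<close> in each of the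
  \<open>s\<close> factors, represented by the functions that they define.\<close>

definition multihom :: "nat \<Rightarrow> ((nat \<Rightarrow> nat \<Rightarrow> complex) \<Rightarrow> complex) \<Rightarrow> bool" where
  "multihom d f \<longleftrightarrow> (\<exists>c. \<forall>L. f L = (\<Sum>T\<in>multidegs d. c T * multimono T L))"

lemma finite_multidegs: "finite (multidegs d)"
  unfolding multidegs_def by (intro finite_PiE finite_monomials) auto

lemma multihom_add: "multihom d f \<Longrightarrow> multihom d g \<Longrightarrow> multihom d (\<lambda>L. f L + g L)"
proof -
  assume "multihom d f" "multihom d g"
  then obtain a b where "\<forall>L. f L = (\<Sum>T\<in>multidegs d. a T * multimono T L)"
    "\<forall>L. g L = (\<Sum>T\<in>multidegs d. b T * multimono T L)" by (auto simp: multihom_def)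
  thus ?thesis unfolding multihom_def
    by (intro exI[of _ "\<lambda>T. a T + b T"]) (simp add: ring_distribs sum.distrib)
qed

lemma multihom_cmult: "multihom d f \<Longrightarrow> multihom d (\<lambda>L. c * f L)"
proof -
  assume "multihom d f"
  then obtain a where "\<forall>L. f L = (\<Sum>T\<in>multidegs d. a T * multimono T L)" by (auto simp: multihom_def)
  thus ?thesis unfolding multihom_def
    by (intro exI[of _ "\<lambda>T. c * a T"]) (simp add: sum_distrib_left mult.assoc)
qed

lemma multihom_0: "multihom d (\<lambda>L. 0)"
  unfolding multihom_def by (intro exI[of _ "\<lambda>_. 0"]) simp

lemma multihom_sum: "(\<And>a. a \<in> A \<Longrightarrow> multihom d (f a)) \<Longrightarrow> multihom d (\<lambda>L. \<Sum>a\<in>A. f a L)"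
  by (induction A rule: infinite_finite_induct) (auto intro: multihom_add multihom_0)

lemma multihom_multimono:
  assumes "\<And>i. i \<in> {1..s} \<Longrightarrow> T i \<in> monomials {..n} d"
  shows "multihom d (multimono T)"
proof -
  define T' where "T' = restrict T {1..s}"
  have T': "T' \<in> multidegs d" using assms by (auto simp: T'_def multidegs_def)
  have "multimono T L = (\<Sum>R\<in>multidegs d. (if R = T' then 1 else 0) * multimono R L)" for L
  proof -
    have "multimono T L = multimono T' L" unfolding multimono_def by (intro prod.cong) (auto simp: T'_def)
    also have "\<dots> = (\<Sum>R\<in>multidegs d. if R = T' then multimono T' L else 0)"
      using T' finite_multidegs by simp
    also have "\<dots> = (\<Sum>R\<in>multidegs d. (if R = T' then 1 else 0) * multimono R L)"
      by (intro sum.cong) auto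
    finally show ?thesis .
  qed
  thus ?thesis unfolding multihom_def by (intro exI[of _ "\<lambda>R. if R = T' then 1 else 0"] allI)
qed

lemma multihom_mult:
  assumes "multihom d f" "multihom e g" shows "multihom (d + e) (\<lambda>L. f L * g L)"
proof -
  obtain a b where ab: "\<And>L. f L = (\<Sum>T\<in>multidegs d. a T * multimono T L)"
    "\<And>L. g L = (\<Sum>T\<in>multidegs e. b T * multimono T L)" using assms by (auto simp: multihom_def)
  have "f L * g L = (\<Sum>T\<in>multidegs d. \<Sum>R\<in>multidegs e. (a T * b R) * multimono (\<lambda>i. T i + R i) L)" for L
    unfolding ab sum_product
    by (intro sum.cong refl) (simp add: multimono_def mono_eval_add prod.distrib)
  moreover have "multihom (d + e) (\<lambda>L. \<Sum>T\<in>multidegs d. \<Sum>R\<in>multidegs e. (a T * b R) * multimono (\<lambda>i. T i + R i) L)"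
    by (intro multihom_sum multihom_cmult multihom_multimono monomials_add)
       (auto simp: multidegs_def PiE_def Pi_def)
  ultimately show ?thesis by simp
qed

lemma multihom_1: "multihom 0 (\<lambda>L. 1)"
proof -
  have "multihom 0 (multimono (\<lambda>_. 0))" by (rule multihom_multimono) (simp add: monomials_def)
  moreover have "multimono (\<lambda>_. 0) = (\<lambda>L. 1)" by (simp add: multimono_def fun_eq_iff)
  ultimately show ?thesis by simp
qed

lemma multihom_prod:
  "(\<And>a. a \<in> A \<Longrightarrow> multihom (e a) (f a)) \<Longrightarrow> multihom (sum e A) (\<lambda>L. \<Prod>a\<in>A. f a L)"
  by (induction A rule: infinite_finite_induct) (auto intro: multihom_mult multihom_1)

lemma multihom_power: "multihom d f \<Longrightarrow> multihom (k * d) (\<lambda>L. f L ^ k)"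
  by (induction k) (auto intro: multihom_mult multihom_1)

lemma lookup_form_of:
  "lookup (form_of L) m
     = (\<Sum>f\<in>{1..s} \<rightarrow>\<^sub>E {..n}. (if (\<Sum>i\<in>{1..s}. single (f i) 1) = m then 1 else 0) * (\<Prod>i\<in>{1..s}. L i (f i)))"
proof -
  have prod_single: "(\<Prod>i\<in>A. single (g i) (h i)) = single (\<Sum>i\<in>A. g i) (\<Prod>i\<in>A. h i)"
    for g :: "nat \<Rightarrow> (nat \<Rightarrow>\<^sub>0 nat)" and h :: "nat \<Rightarrow> complex" and A
    by (induction A rule: infinite_finite_induct) (auto simp: mult_single)
  have "form_of L = (\<Sum>f\<in>{1..s} \<rightarrow>\<^sub>E {..n}. \<Prod>i\<in>{1..s}. single (single (f i) 1) (L i (f i)))"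
    unfolding form_of_def lin_def by (rule prod_sum_PiE) auto
  also have "\<dots> = (\<Sum>f\<in>{1..s} \<rightarrow>\<^sub>E {..n}. single (\<Sum>i\<in>{1..s}. single (f i) 1) (\<Prod>i\<in>{1..s}. L i (f i)))"
    by (intro sum.cong refl prod_single)
  finally show ?thesis
    by (simp add: lookup_sum lookup_single when_def) (intro sum.cong refl, auto)
qed

lemma multihom_coefficient: "multihom 1 (\<lambda>L. lookup (form_of L) m)"
proof -
  have "(\<Prod>i\<in>{1..s}. L i (f i)) = multimono (\<lambda>i. single (f i) 1) L" for f and L :: "nat \<Rightarrow> nat \<Rightarrow> complex"
    by (simp add: multimono_def)
  thus ?thesis unfolding lookup_form_of
    by (simp only:) (intro multihom_sum multihom_cmult multihom_multimono monomials_single, auto simp: PiE_def Pi_def)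
qed

lemma multihom_pull:
  assumes "P \<in> forms idx d" shows "multihom d (pull P)"
proof -
  have "multihom d (\<lambda>L. mono_eval (lookup (form_of L)) m)" if "m \<in> monomials idx d" for m
  proof -
    have "multihom (\<Sum>i\<in>keys m. lookup m i * 1) (\<lambda>L. mono_eval (lookup (form_of L)) m)"
      unfolding mono_eval_def by (intro multihom_prod multihom_power multihom_coefficient)
    thus ?thesis using that by (simp add: monomials_def)
  qed
  thus ?thesis unfolding pull_def[abs_def] mp_eval_alt
    by (intro multihom_sum multihom_cmult) (use forms_keys[OF assms] in blast)
qed

lemma multihom_isCont:
  assumes "multihom d f"
  shows "isCont (\<lambda>t. f (\<lambda>i j. L i j + t * M i j)) t0"
proof -
  obtain c where "\<And>L. f L = (\<Sum>T\<in>multidegs d. c T * multimono T L)" using assms by (auto simp: multihom_def)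
  thus ?thesis
    by (simp only: multimono_def mono_eval_def) (intro continuous_intros)
qed

subsection \<open>The vanishing ideal and an upper bound for the Hilbert function\<close>

lemma pull_homog: "P \<in> forms idx d \<Longrightarrow> mp_eval (lookup (scale_pm c (form_of L))) P = c ^ d * pull P L"
  unfolding pull_def using mp_eval_homog[of P idx d c "lookup (form_of L)"]
  by (simp add: lookup_scale_pm[abs_def])

lemma form_of_nonzero_exists: "\<exists>L. form_of L \<noteq> 0"
proof -
  have "mp_eval (\<lambda>j. 1) (form_of (\<lambda>i j. if j = 0 then 1 else 0)) = 1"
    by (simp add: mp_eval_form_of dot_def)
  thus ?thesis by (metis mp_eval_zero zero_neq_one)
qed

lemma decomposables_eq: "decomposables n s = {proj_pt (form_of L) | L. form_of L \<noteq> 0}"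
proof (intro equalityI subsetI)
  fix z assume "z \<in> decomposables n s"
  then obtain l where l: "z = proj_pt (\<Prod>i\<in>{1..s}. l i)" "(\<Prod>i\<in>{1..s}. l i) \<noteq> 0" "\<forall>i\<in>{1..s}. l i \<in> forms {..n} 1"
    by (auto simp: decomposables_def)
  define L where "L i j = lookup (l i) (single j 1)" for i j
  have "(\<Prod>i\<in>{1..s}. l i) = form_of L"
    unfolding form_of_def L_def using l(3) by (intro prod.cong refl form_eq_lin) auto
  thus "z \<in> {proj_pt (form_of L) | L. form_of L \<noteq> 0}" using l by auto
next
  fix z assume "z \<in> {proj_pt (form_of L) | L. form_of L \<noteq> 0}"
  thus "z \<in> decomposables n s"
    unfolding decomposables_def using form_of_in_forms lin_in_forms by (fastforce simp: form_of_def)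
qed

lemma mem_proj_pt: "v \<in> proj_pt v"
  unfolding proj_pt_def by (rule CollectI, rule exI[of _ 1]) simp

text \<open>Turns the homogeneous ideal into the kernel of \<open>pull\<close>. A tuple whose
  product is 0 gives no point of the variety; there the value of \<open>P\<close> is
  \<open>0 ^ d\<close> times its value at a genuine point, which also settles
  \<open>d = 0\<close>.\<close>

lemma vanishing_forms_iff:
  "P \<in> vanishing_forms idx (decomposables n s) d \<longleftrightarrow> P \<in> forms idx d \<and> (\<forall>L. pull P L = 0)"
proof
  assume P: "P \<in> vanishing_forms idx (decomposables n s) d"
  have Pf: "P \<in> forms idx d" using P by (simp add: vanishing_forms_def)
  have nz: "pull P L = 0" if "form_of L \<noteq> 0" for L
  proof -
    have "proj_pt (form_of L) \<in> decomposables n s" using that by (auto simp: decomposables_eq)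
    hence "vanishes_at P (proj_pt (form_of L))" using P by (simp add: vanishing_forms_def)
    thus ?thesis using mem_proj_pt by (auto simp: vanishes_at_def pull_def)
  qed
  have "pull P L = 0" if "form_of L = 0" for L
  proof -
    obtain L' where L': "form_of L' \<noteq> 0" using form_of_nonzero_exists by blast
    have "pull P L = mp_eval (lookup (scale_pm 0 (form_of L'))) P" using that by (simp add: pull_def)
    also have "\<dots> = 0" using pull_homog[OF Pf, of 0 L'] nz[OF L'] by simp
    finally show ?thesis .
  qed
  thus "P \<in> forms idx d \<and> (\<forall>L. pull P L = 0)" using Pf nz by blast
next
  assume P: "P \<in> forms idx d \<and> (\<forall>L. pull P L = 0)"
  show "P \<in> vanishing_forms idx (decomposables n s) d"
    unfolding vanishing_forms_def vanishes_at_def decomposables_eq proj_pt_def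
    using P pull_homog[of P d] by auto
qed

lemma pull_permute:
  assumes "p permutes {1..s}" shows "pull P (\<lambda>i. L (p i)) = pull P L"
proof -
  have "form_of (\<lambda>i. L (p i)) = form_of L"
    unfolding form_of_def using prod.permute[OF assms, of "\<lambda>i. lin (L i)"] by (simp add: o_def)
  thus ?thesis by (simp add: pull_def)
qed

definition symmono :: "(nat \<Rightarrow> (nat \<Rightarrow>\<^sub>0 nat)) \<Rightarrow> (nat \<Rightarrow> nat \<Rightarrow> complex) \<Rightarrow> complex" where
  "symmono T L = (\<Sum>p | p permutes {1..s}. multimono T (\<lambda>i. L (p i)))"

text \<open>Two tuples with the same multiset differ by a permutation \<open>q\<close>, which is
  absorbed by replacing each summation index \<open>p\<close> by \<open>p \<circ> q\<close>.\<close>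

lemma symmono_eq:
  assumes "image_mset T (mset_set {1..s}) = image_mset T' (mset_set {1..s})"
  shows "symmono T L = symmono T' L"
proof -
  obtain q where q: "q permutes {1..s}" "\<forall>i\<in>{1..s}. T i = T' (q i)"
    using image_mset_eq_implies_permutes[OF _ assms] by auto
  have "multimono T (\<lambda>i. L ((p \<circ> q) i)) = multimono T' (\<lambda>i. L (p i))" for p
  proof -
    have "multimono T (\<lambda>i. L ((p \<circ> q) i)) = (\<Prod>i\<in>{1..s}. mono_eval (L (p (q i))) (T' (q i)))"
      unfolding multimono_def using q(2) by (intro prod.cong) auto
    also have "\<dots> = multimono T' (\<lambda>i. L (p i))"
      unfolding multimono_def using prod.permute[OF q(1), of "\<lambda>i. mono_eval (L (p i)) (T' i)"] by (simp add: o_def)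
    finally show ?thesis .
  qed
  moreover have "symmono T L = (\<Sum>p | p permutes {1..s}. multimono T (\<lambda>i. L ((p \<circ> q) i)))"
    unfolding symmono_def by (rule sum_permutations_compose_right[OF q(1)])
  ultimately show ?thesis by (simp add: symmono_def)
qed

lemma hilbert_function_le:
  "hilbert_function idx (decomposables n s) d \<le> (((n + d) choose n) + s - 1) choose s"
proof -
  let ?N = "monomials {..n} d"
  define S where "S = multisets_of_size ?N s"
  define ms where "ms T = image_mset T (mset_set {1..s})" for T :: "nat \<Rightarrow> (nat \<Rightarrow>\<^sub>0 nat)"
  define rep where "rep M = (SOME T. ms T = M)" for M
  have rep: "symmono (rep (ms T)) L = symmono T L" for T L
    by (rule symmono_eq) (use someI[of "\<lambda>T'. ms T' = ms T" T] in \<open>simp add: rep_def ms_def\<close>)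
  have finN: "finite ?N" by (simp add: finite_monomials)
  have msS: "ms T \<in> S" if "T \<in> multidegs d" for T
    using that by (auto simp: multidegs_def ms_def S_def multisets_of_size_def PiE_def Pi_def)
  have finS: "finite S" unfolding S_def by (rule finite_multisets_of_size) (rule finN)
  have "\<forall>m\<in>monomials idx d. \<exists>c. \<forall>L. pull (single m 1) L = (\<Sum>T\<in>multidegs d. c T * multimono T L)"
    using multihom_pull[OF forms_single[of _ idx d 1]] by (auto simp: multihom_def)
  then obtain c where c: "\<And>m L. m \<in> monomials idx d \<Longrightarrow> pull (single m 1) L = (\<Sum>T\<in>multidegs d. c m T * multimono T L)"
    by metis
  define e where "e m M = (\<Sum>T\<in>{T\<in>multidegs d. ms T = M}. c m T)" for m M
  \<comment> \<open>A pullback is invariant under permuting the factors, so \<open>fact s\<close>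
    times it is the sum over all permutations. Its expansion then groups by multisets of
    monomials.\<close>
  have sym: "of_nat (fact s) * pull (single m 1) L = (\<Sum>M\<in>S. e m M * symmono (rep M) L)"
    if m: "m \<in> monomials idx d" for m L
  proof -
    have "of_nat (fact s) * pull (single m 1) L
        = (\<Sum>p | p permutes {1..s}. pull (single m 1) (\<lambda>i. L (p i)))"
      by (simp add: pull_permute card_permutations)
    also have "\<dots> = (\<Sum>T\<in>multidegs d. c m T * symmono T L)"
      unfolding c[OF m] symmono_def by (subst sum.swap) (simp add: sum_distrib_left)
    also have "\<dots> = (\<Sum>M\<in>S. \<Sum>T\<in>{T\<in>multidegs d. ms T = M}. c m T * symmono T L)"
      by (rule sum.group[symmetric]) (use finS finite_multidegs msS in auto)
    also have "\<dots> = (\<Sum>M\<in>S. e m M * symmono (rep M) L)"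
      unfolding e_def sum_distrib_right by (intro sum.cong refl) (use rep in auto)
    finally show ?thesis .
  qed
  have "pm.dim (forms idx d) - pm.dim (vanishing_forms idx (decomposables n s) d) \<le> card S"
    unfolding forms_def
  proof (rule codim_le[where c = e])
    show "finite (monomials idx d)" by (intro finite_monomials finite_idx)
    show "vanishing_forms idx (decomposables n s) d \<subseteq> coord_space (monomials idx d)"
      by (auto simp: vanishing_forms_def forms_def)
    fix v assume v: "v \<in> coord_space (monomials idx d)"
      and v0: "\<And>M. M \<in> S \<Longrightarrow> (\<Sum>m\<in>monomials idx d. lookup v m * e m M) = 0"
    have "pull v L = 0" for L
    proof -
      have "pull v L = (\<Sum>m\<in>monomials idx d. lookup v m * pull (single m 1) L)"
        unfolding pull_def using v
        by (subst mp_eval_superset[OF \<open>finite (monomials idx d)\<close>]) (auto simp: coord_space_def)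
      hence "of_nat (fact s) * pull v L = (\<Sum>m\<in>monomials idx d. lookup v m * (of_nat (fact s) * pull (single m 1) L))"
        by (simp add: sum_distrib_left mult_ac)
      also have "\<dots> = (\<Sum>m\<in>monomials idx d. \<Sum>M\<in>S. lookup v m * e m M * symmono (rep M) L)"
        by (intro sum.cong refl) (simp only: sym sum_distrib_left mult.assoc)
      also have "\<dots> = (\<Sum>M\<in>S. (\<Sum>m\<in>monomials idx d. lookup v m * e m M) * symmono (rep M) L)"
        by (subst sum.swap) (simp add: sum_distrib_right)
      also have "\<dots> = 0" using v0 by simp
      finally show ?thesis by simp
    qed
    thus "v \<in> vanishing_forms idx (decomposables n s) d"
      using v by (simp add: vanishing_forms_iff forms_def)
  qed (use finS vanishing_forms_subspace in auto)
  moreover have "card S = (card ?N + s - 1) choose s"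
    unfolding S_def by (rule card_multisets_of_size) (rule finN)
  moreover have "card ?N = (n + d) choose n" by (rule card_monomials_atMost)
  ultimately show ?thesis by (simp add: hilbert_function_def)
qed

end

section \<open>Partitions into blocks of equal size\<close>

definition block_partitions :: "nat \<Rightarrow> 'a set \<Rightarrow> 'a set set set" where
  "block_partitions n A = {P. partition_on A P \<and> (\<forall>B\<in>P. card B = n)}"

lemma finite_block_partitions: "finite A \<Longrightarrow> finite (block_partitions n A)"
  by (rule finite_subset[of _ "Pow (Pow A)"]) (auto simp: block_partitions_def partition_on_def)

text \<open>The block containing \<open>a\<close> is determined by its \<open>n - 1\<close> other
  elements, and the remaining blocks partition the rest. The condition \<open>finite C\<close>
  excludes infinite sets, whose \<open>card\<close> is 0, in the case \<open>n = 1\<close>.\<close>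

lemma block_partitions_decompose:
  assumes "n \<ge> 1" "a \<in> A"
  shows "block_partitions n A = (\<Union>C\<in>{C. C \<subseteq> A - {a} \<and> card C = n - 1 \<and> finite C}. insert (insert a C) ` block_partitions n (A - insert a C))"
proof (intro equalityI subsetI)
  fix P assume P: "P \<in> block_partitions n A"
  hence part: "partition_on A P" and card: "\<And>B. B \<in> P \<Longrightarrow> card B = n" by (auto simp: block_partitions_def)
  then obtain B where B: "B \<in> P" "a \<in> B" using assms by (auto simp: partition_on_def)
  define C where "C = B - {a}"
  have fB: "finite B" using card[OF B(1)] assms by (metis card.infinite not_one_le_zero)
  have BC: "B = insert a C" using B by (auto simp: C_def)
  have "C \<subseteq> A - {a}" using part B by (auto simp: C_def partition_on_def)
  moreover have "card C = n - 1" using card[OF B(1)] fB B by (simp add: C_def)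
  moreover have "finite C" using fB by (simp add: C_def)
  moreover have "P - {B} \<in> block_partitions n (A - insert a C)"
    unfolding block_partitions_def BC[symmetric]
  proof (intro CollectI conjI ballI)
    show "partition_on (A - B) (P - {B})"
      using part B unfolding partition_on_def disjoint_def by blast
  qed (use card in auto)
  moreover have "P = insert B (P - {B})" using B by auto
  ultimately show "P \<in> (\<Union>C\<in>{C. C \<subseteq> A - {a} \<and> card C = n - 1 \<and> finite C}. insert (insert a C) ` block_partitions n (A - insert a C))"
    using BC by blast
next
  fix P assume "P \<in> (\<Union>C\<in>{C. C \<subseteq> A - {a} \<and> card C = n - 1 \<and> finite C}. insert (insert a C) ` block_partitions n (A - insert a C))"
  then obtain C P' where C: "C \<subseteq> A - {a}" "card C = n - 1" "finite C" "P = insert (insert a C) P'"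
    "P' \<in> block_partitions n (A - insert a C)" by blast
  have p': "partition_on (A - insert a C) P'" using C(5) by (simp add: block_partitions_def)
  have "partition_on A (insert (insert a C) P')"
  proof (rule partition_onI)
    show "\<Union> (insert (insert a C) P') = A" using p' C(1) assms by (auto simp: partition_on_def)
    fix p q assume "p \<in> insert (insert a C) P'" "q \<in> insert (insert a C) P'" "p \<noteq> q"
    thus "disjnt p q" using p' unfolding partition_on_def disjnt_def disjoint_def by blast
  next
    show "{} \<notin> insert (insert a C) P'" using p' by (auto simp: partition_on_def)
  qed
  moreover have "a \<notin> C" using C(1) by auto
  hence "card (insert a C) = n" using C(2,3) assms by simp
  ultimately show "P \<in> block_partitions n A" using C(4,5) by (auto simp: block_partitions_def)
qed

text \<open>The origin of the binomial factors: in a set of \<open>n * k\<close> elements, the block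
  of a fixed element is completed by \<open>n - 1\<close> of the other \<open>n * k - 1\<close>
  elements.\<close>

lemma card_block_partitions:
  assumes "n \<ge> 1" "finite A" "card A = n * s"
  shows "card (block_partitions n A) = (\<Prod>k=1..s. (n * k - 1) choose (n - 1))"
  using assms(2,3)
proof (induction s arbitrary: A)
  case 0
  hence "A = {}" by simp
  hence "block_partitions n A = {{}}" by (auto simp: block_partitions_def partition_on_def)
  thus ?case by simp
next
  case (Suc s)
  have "A \<noteq> {}" using Suc.prems assms(1) by auto
  then obtain a where a: "a \<in> A" by auto
  let ?CC = "{C. C \<subseteq> A - {a} \<and> card C = n - 1 \<and> finite C}"
  have CC: "?CC = {C. C \<subseteq> A - {a} \<and> card C = n - 1}"
    using Suc.prems(1) finite_subset by blast
  have cardCC: "card ?CC = (n * Suc s - 1) choose (n - 1)"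
    unfolding CC using Suc.prems a by (subst n_subsets) auto
  have finCC: "finite ?CC" unfolding CC using Suc.prems(1) by auto
  have rest: "card (A - insert a C) = n * s" if "C \<in> ?CC" for C
  proof -
    have "a \<notin> C" using that by auto
    hence "card (insert a C) = n" using that assms(1) by simp
    moreover have "card (A - insert a C) = card A - card (insert a C)"
      by (rule card_Diff_subset) (use that a in auto)
    ultimately show ?thesis using Suc.prems by simp
  qed
  have notin: "insert a C \<notin> P" if "P \<in> block_partitions n (A - insert a C)" for C P
    using that by (auto simp: block_partitions_def partition_on_def)
  have "card (block_partitions n A) = (\<Sum>C\<in>?CC. card (insert (insert a C) ` block_partitions n (A - insert a C)))"
    unfolding block_partitions_decompose[OF assms(1) a]
  proof (rule card_UN_disjoint)
    show "\<forall>C\<in>?CC. finite (insert (insert a C) ` block_partitions n (A - insert a C))"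
      using Suc.prems(1) by (simp add: finite_block_partitions)
    show "\<forall>C\<in>?CC. \<forall>C'\<in>?CC. C \<noteq> C' \<longrightarrow> insert (insert a C) ` block_partitions n (A - insert a C)
        \<inter> insert (insert a C') ` block_partitions n (A - insert a C') = {}"
    proof (intro ballI impI equals0I)
      fix C C' x assume C: "C \<in> ?CC" "C' \<in> ?CC" "C \<noteq> C'"
        and x: "x \<in> insert (insert a C) ` block_partitions n (A - insert a C)
        \<inter> insert (insert a C') ` block_partitions n (A - insert a C')"
      have ne: "insert a C \<noteq> insert a C'" using C insert_ident[of a C C'] by blast
      have "x \<in> block_partitions n A"
        using x C(1) block_partitions_decompose[OF assms(1) a] by blast
      hence dj: "disjoint x" by (simp add: block_partitions_def partition_on_def)
      obtain P1 P2 where "x = insert (insert a C) P1" "x = insert (insert a C') P2"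
        using x by (elim IntE imageE)
      hence "insert a C \<in> x" "insert a C' \<in> x" by (metis insertI1)+
      from disjointD[OF dj this ne] have "insert a C \<inter> insert a C' = {}" .
      thus False by blast
    qed
  qed (rule finCC)
  also have "\<dots> = (\<Sum>C\<in>?CC. card (block_partitions n (A - insert a C)))"
  proof (intro sum.cong refl card_image inj_onI)
    fix C P P' assume "C \<in> ?CC" "P \<in> block_partitions n (A - insert a C)" "P' \<in> block_partitions n (A - insert a C)"
      "insert (insert a C) P = insert (insert a C) P'"
    thus "P = P'" using notin insert_ident by metis
  qed
  also have "\<dots> = (\<Sum>C\<in>?CC. \<Prod>k=1..s. (n * k - 1) choose (n - 1))"
    using rest Suc.prems(1) by (intro sum.cong refl Suc.IH) auto
  also have "\<dots> = (\<Prod>k=1..Suc s. (n * k - 1) choose (n - 1))"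
    using cardCC by simp
  finally show ?case .
qed

text \<open>Equates the leading coefficients of the upper and the lower bound for the Hilbert
  function. In each induction step the new binomial coefficient cancels against
  \<open>fact (n * s)\<close>.\<close>

lemma prod_choose_eq_multinomial:
  assumes "n \<ge> 1"
  shows "(\<Prod>k=1..s. (n * k - 1) choose (n - 1)) * (fact n ^ s * fact s) = (fact (n * s) :: nat)"
proof (induction s)
  case 0 thus ?case by simp
next
  case (Suc s)
  let ?b = "(n * Suc s - 1) choose (n - 1)"
  have "fact (n - 1) * fact (n * Suc s - 1 - (n - 1)) * ?b = fact (n * Suc s - 1)"
    by (rule binomial_fact_lemma) (use assms in simp)
  moreover have "n * Suc s - 1 - (n - 1) = n * s" using assms by simp
  ultimately have "fact (n - 1) * fact (n * s) * ?b = fact (n * Suc s - 1)" by simp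
  hence "(n * Suc s) * (fact (n - 1) * fact (n * s) * ?b) = (n * Suc s) * fact (n * Suc s - 1)" by simp
  also have "\<dots> = fact (n * Suc s)" using fact_reduce[of "n * Suc s", where 'a = nat] assms by (simp del: mult_Suc_right)
  finally have eq: "(n * Suc s) * (fact (n - 1) * fact (n * s) * ?b) = fact (n * Suc s)" .
  have fn: "(fact n :: nat) = n * fact (n - 1)" using assms fact_reduce[of n, where 'a = nat] by simp
  have "(\<Prod>k=1..Suc s. (n * k - 1) choose (n - 1)) * (fact n ^ Suc s * fact (Suc s))
      = ?b * (fact n * Suc s) * ((\<Prod>k=1..s. (n * k - 1) choose (n - 1)) * (fact n ^ s * fact s))"
    by (simp add: prod.cl_ivl_Suc mult_ac del: mult_Suc_right mult_Suc)
  also have "\<dots> = (n * Suc s) * (fact (n - 1) * fact (n * s) * ?b)"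
    by (subst Suc.IH) (simp only: fn mult_ac)
  also note eq
  finally show ?case .
qed

section \<open>A lower bound for the Hilbert function\<close>

text \<open>Used to cancel powers of \<open>t\<close>: an identity obtained by division for
  \<open>t \<noteq> 0\<close> extends to \<open>t = 0\<close>.\<close>

lemma isCont_zero_off_point:
  fixes f :: "complex \<Rightarrow> complex"
  assumes "isCont f a" "\<And>t. t \<noteq> a \<Longrightarrow> f t = 0" shows "f a = 0"
proof -
  have "f \<midarrow>a\<rightarrow> f a" using assms(1) by (simp add: isCont_def)
  moreover have "f \<midarrow>a\<rightarrow> 0"
    by (rule Lim_transform_eventually[OF tendsto_const]) (auto simp: eventually_at_filter assms(2))
  ultimately show ?thesis using LIM_unique by blast
qed

section \<open>Points of the rational normal curve and hyperplanes spanned by blocks of them\<close>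

context split_forms
begin

text \<open>On these points of the rational normal curve a linear form becomes a polynomial of
  degree at most \<open>n\<close> in the parameter \<open>k\<close>. Since \<open>0 ^ 0 = 1\<close>,
  \<open>mpt 0\<close> is the first unit vector.\<close>

definition mpt :: "nat \<Rightarrow> nat \<Rightarrow> complex" where
  "mpt k j = of_nat k ^ j"

lemma dot_coeff: "Polynomial.degree p \<le> n \<Longrightarrow> dot (coeff p) (mpt k) = poly p (of_nat k)"
  unfolding dot_def mpt_def poly_altdef
  by (rule sum.mono_neutral_right) (auto intro: coeff_eq_0)

definition node_poly :: "nat set \<Rightarrow> complex poly" where
  "node_poly B = (\<Prod>k\<in>B. [:- of_nat k, 1:])"

lemma degree_node_poly: "finite B \<Longrightarrow> Polynomial.degree (node_poly B) = card B"
  unfolding node_poly_def by (subst degree_prod_eq_sum_degree) auto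

lemma poly_node_poly: "poly (node_poly B) x = (\<Prod>k\<in>B. x - of_nat k)"
  unfolding node_poly_def by (simp add: poly_prod)

text \<open>Lagrange interpolation: at most \<open>n\<close> nodes impose independent conditions on
  linear forms.\<close>

lemma interpolation:
  assumes "finite B" "card B \<le> n"
  shows "\<exists>a. \<forall>k\<in>B. dot a (mpt k) = v k"
proof -
  define p where "p = (\<Sum>k\<in>B. Polynomial.smult (v k / (\<Prod>l\<in>B - {k}. of_nat k - of_nat l)) (node_poly (B - {k})))"
  have deg: "Polynomial.degree p \<le> n" unfolding p_def
  proof (rule degree_sum_le)
    fix k assume "k \<in> B"
    show "Polynomial.degree (Polynomial.smult (v k / (\<Prod>l\<in>B - {k}. of_nat k - of_nat l)) (node_poly (B - {k}))) \<le> n"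
      by (rule order_trans[OF degree_smult_le]) (use assms \<open>k \<in> B\<close> in \<open>simp add: degree_node_poly\<close>)
  qed (rule assms)
  have "dot (coeff p) (mpt k) = v k" if k: "k \<in> B" for k
  proof -
    have "dot (coeff p) (mpt k) = (\<Sum>k'\<in>B. v k' / (\<Prod>l\<in>B - {k'}. of_nat k' - of_nat l) * (\<Prod>l\<in>B - {k'}. of_nat k - of_nat l))"
      unfolding dot_coeff[OF deg] by (simp add: p_def poly_sum poly_node_poly)
    also have "\<dots> = (\<Sum>k'\<in>B. if k' = k then v k else 0)"
      using assms(1) k by (intro sum.cong refl) (auto simp: prod_zero_iff)
    finally show ?thesis using assms(1) k by simp
  qed
  thus ?thesis by blast
qed

definition zc :: "nat \<Rightarrow> (nat \<Rightarrow> nat \<Rightarrow> complex) \<Rightarrow> complex" where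
  "zc k L = (\<Prod>i\<in>{1..s}. dot (L i) (mpt k))"

definition is_blocks :: "(nat \<Rightarrow> nat set) \<Rightarrow> bool" where
  "is_blocks b \<longleftrightarrow> (\<forall>i\<in>{1..s}. finite (b i) \<and> card (b i) = n) \<and> disjoint_family_on b {1..s}
     \<and> (\<Union>i\<in>{1..s}. b i) = {1..n * s}"

text \<open>An equation of the hyperplane through the points labelled by the block: along the curve
  it restricts to the polynomial with roots \<open>b i\<close>.\<close>

definition block_lin :: "(nat \<Rightarrow> nat set) \<Rightarrow> nat \<Rightarrow> nat \<Rightarrow> complex" where
  "block_lin b i = coeff (node_poly (b i))"

lemma dot_block_lin:
  assumes "is_blocks b" "i \<in> {1..s}"
  shows "dot (block_lin b i) (mpt k) = (\<Prod>l\<in>b i. of_nat k - of_nat l)"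
proof -
  have "Polynomial.degree (node_poly (b i)) \<le> n" using assms by (simp add: degree_node_poly is_blocks_def)
  thus ?thesis by (simp add: block_lin_def dot_coeff poly_node_poly)
qed

lemma dot_block_lin_eq_0:
  assumes "is_blocks b" "i \<in> {1..s}"
  shows "dot (block_lin b i) (mpt k) = 0 \<longleftrightarrow> k \<in> b i"
  using assms by (auto simp: dot_block_lin is_blocks_def)

text \<open>The functions \<open>zc 1, \<dots>, zc (n s)\<close> are local coordinates at the points \<open>block_lin (b x)\<close>, all of
  which they map to \<open>0\<close>.  Along a line through such a point the lowest order term of the relation
  only involves the coefficient \<open>Q x\<close>, since the other functions \<open>H y\<close> vanish there.\<close>

lemma independent_over_coordinates:
  fixes X :: "'x set"
  assumes X: "finite X" and b: "\<And>x. x \<in> X \<Longrightarrow> is_blocks (b x)"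
    and H: "\<And>x. x \<in> X \<Longrightarrow> multihom c (H x)"
    and H0: "\<And>x y. x \<in> X \<Longrightarrow> y \<in> X \<Longrightarrow> H x (block_lin (b y)) = 0 \<longleftrightarrow> x \<noteq> y"
    and Q: "\<And>x. x \<in> X \<Longrightarrow> Q x \<in> forms {0..n * s} D"
    and rel: "\<And>L. (\<Sum>x\<in>X. mp_eval (\<lambda>k. zc k L) (Q x) * H x L) = 0"
    and x: "x \<in> X"
  shows "Q x = 0"
proof (rule ccontr)
  assume "Q x \<noteq> 0"
  \<comment> \<open>At the chosen points \<open>zc 0\<close> is nonzero while \<open>zc 1\<close>,
    ..., \<open>zc (n * s)\<close> vanish. In a relation of fixed degree \<open>D\<close> the terms
    with the largest exponent \<open>r\<close> of variable 0 therefore have the lowest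
    order.\<close>
  define R where "R = (\<Union>x\<in>X. (\<lambda>m. lookup m 0) ` keys (Q x))"
  have R: "finite R" "R \<noteq> {}" using X x \<open>Q x \<noteq> 0\<close> by (auto simp: R_def)
  define r where "r = Max R"
  have "r \<in> R" using R by (simp add: r_def)
  then obtain y m1 where y: "y \<in> X" "m1 \<in> keys (Q y)" "lookup m1 0 = r"
    by (auto simp: R_def)
  have le_r: "lookup m 0 \<le> r" if "x \<in> X" "m \<in> keys (Q x)" for x m
    unfolding r_def using R(1) that by (intro Max_ge) (auto simp: R_def)
  have mdeg: "m \<in> monomials {0..n * s} D" if "x \<in> X" "m \<in> keys (Q x)" for x m
    using that Q forms_keys by blast
  have sumD: "(\<Sum>k\<in>{0..n * s}. lookup m k) = D" if "m \<in> monomials {0..n * s} D" for m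
    using that monomials_superset[OF _ monomials_keys[OF that]] by simp
  define L where "L = block_lin (b y)"
  define \<zeta> where "\<zeta> = zc 0 L"
  have \<zeta>: "\<zeta> \<noteq> 0"
  proof -
    have "0 \<notin> b y i" if "i \<in> {1..s}" for i
    proof -
      have "b y i \<subseteq> {1..n * s}" using b[OF y(1)] that unfolding is_blocks_def by blast
      thus ?thesis by auto
    qed
    thus ?thesis using dot_block_lin_eq_0[OF b[OF y(1)]] by (auto simp: \<zeta>_def zc_def L_def)
  qed
  define A where "A = {m \<in> keys (Q y). lookup m 0 = r}"
  have main: "(\<Sum>m\<in>A. lookup (Q y) m * mono_eval (\<lambda>k. if k = 0 then \<zeta> else w k) m) = 0" for w
  proof -
    \<comment> \<open>At \<open>mpt k\<close> with \<open>k\<close> in block \<open>i\<close> only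
      the factor \<open>i\<close> of \<open>L\<close> vanishes, so the derivative of
      \<open>zc k\<close> in direction \<open>M\<close> is
      \<open>dot (M i) (mpt k) * cc i k\<close>. Interpolating block by block makes it equal to the
      arbitrary value \<open>w k\<close>.\<close>
    define cc where "cc i k = (\<Prod>i'\<in>{1..s} - {i}. dot (L i') (mpt k))" for i k
    have "\<forall>i\<in>{1..s}. \<exists>a. \<forall>k\<in>b y i. dot a (mpt k) = w k / cc i k"
      using interpolation b[OF y(1)] by (simp add: is_blocks_def)
    then obtain M where M: "\<And>i k. i \<in> {1..s} \<Longrightarrow> k \<in> b y i \<Longrightarrow> dot (M i) (mpt k) = w k / cc i k"
      by metis
    define Lt where "Lt t = (\<lambda>i j. L i j + t * M i j)" for t
    have dLt: "dot (Lt t i) v = dot (L i) v + t * dot (M i) v" for t i v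
      by (simp add: Lt_def dot_add dot_scale)
    have "\<forall>k\<in>{1..n * s}. \<exists>i\<in>{1..s}. k \<in> b y i" using b[OF y(1)] unfolding is_blocks_def by blast
    then obtain I where I: "\<And>k. k \<in> {1..n * s} \<Longrightarrow> I k \<in> {1..s} \<and> k \<in> b y (I k)" by metis
    have cc0: "cc (I k) k \<noteq> 0" if k: "k \<in> {1..n * s}" for k
    proof -
      have "k \<notin> b y i'" if "i' \<in> {1..s} - {I k}" for i'
        using b[OF y(1)] I[OF k] that unfolding is_blocks_def disjoint_family_on_def by blast
      thus ?thesis using dot_block_lin_eq_0[OF b[OF y(1)]] by (auto simp: cc_def L_def)
    qed
    \<comment> \<open>For \<open>k\<close> other than 0 this is \<open>zc k\<close> along the line
      with one factor \<open>t\<close> removed, written without division.\<close>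
    define u where "u t k = (if k = 0 then zc 0 (Lt t)
       else dot (M (I k)) (mpt k) * (\<Prod>i'\<in>{1..s} - {I k}. dot (Lt t i') (mpt k)))" for t k
    have zu: "zc k (Lt t) = (if k = 0 then 1 else t) * u t k" if k: "k \<in> {0..n * s}" for t k
    proof (cases "k = 0")
      case False
      hence k': "k \<in> {1..n * s}" using k by auto
      have "dot (L (I k)) (mpt k) = 0" using I[OF k'] dot_block_lin_eq_0[OF b[OF y(1)]] by (simp add: L_def)
      thus ?thesis using False I[OF k'] unfolding zc_def u_def
        by (subst prod.remove[of "{1..s}" "I k"]) (auto simp: dLt)
    qed (simp add: u_def)
    have u0: "u 0 k = (if k = 0 then \<zeta> else w k)" if k: "k \<in> {0..n * s}" for k
    proof (cases "k = 0")
      case True thus ?thesis by (simp add: u_def \<zeta>_def Lt_def)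
    next
      case False
      hence k': "k \<in> {1..n * s}" using k by auto
      have "u 0 k = w k / cc (I k) k * cc (I k) k"
        using False M I[OF k'] by (simp add: u_def cc_def Lt_def)
      thus ?thesis using cc0[OF k'] False by simp
    qed
    have uc: "isCont (\<lambda>t. u t k) 0" for k
      by (cases "k = 0") (simp_all add: u_def zc_def dLt continuous_intros)
    \<comment> \<open>The relation along the line after removing \<open>t ^ (D - r)\<close>. The
      exponent \<open>r - lookup m 0\<close> is not truncated, because \<open>r\<close> is
      maximal.\<close>
    define E where "E t = (\<Sum>x\<in>X. (\<Sum>m\<in>keys (Q x).
        lookup (Q x) m * t ^ (r - lookup m 0) * mono_eval (u t) m) * H x (Lt t))" for t
    have zE: "mono_eval (\<lambda>k. zc k (Lt t)) m = t ^ (D - lookup m 0) * mono_eval (u t) m"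
      if m: "m \<in> monomials {0..n * s} D" for m t
    proof -
      have keys: "keys m \<subseteq> {0..n * s}" using m by (rule monomials_keys)
      have "mono_eval (\<lambda>k. zc k (Lt t)) m = mono_eval (\<lambda>k. (if k = 0 then 1 else t) * u t k) m"
        by (rule mono_eval_cong) (use keys zu in auto)
      also have "\<dots> = mono_eval (\<lambda>k. if k = 0 then 1 else t) m * mono_eval (u t) m"
        by (rule mono_eval_times)
      also have "mono_eval (\<lambda>k. if k = 0 then 1 else t) m = (\<Prod>k\<in>insert 0 {1..n * s}. (if k = 0 then 1 else t) ^ lookup m k)"
        by (rule mono_eval_superset) (use keys in auto)
      also have "\<dots> = t ^ (\<Sum>k\<in>{1..n * s}. lookup m k)"
        by (simp add: power_sum)
      also have "(\<Sum>k\<in>{1..n * s}. lookup m k) = D - lookup m 0"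
        using sumD[OF m] by (simp add: sum.atLeast_Suc_atMost[of 0])
      finally show ?thesis .
    qed
    have E0: "E t = 0" if t: "t \<noteq> 0" for t
    proof -
      have "0 = (\<Sum>x\<in>X. mp_eval (\<lambda>k. zc k (Lt t)) (Q x) * H x (Lt t))" using rel by simp
      also have "\<dots> = (\<Sum>x\<in>X. t ^ (D - r) * ((\<Sum>m\<in>keys (Q x).
        lookup (Q x) m * t ^ (r - lookup m 0) * mono_eval (u t) m) * H x (Lt t)))"
      proof (intro sum.cong refl)
        fix x assume x: "x \<in> X"
        have "mp_eval (\<lambda>k. zc k (Lt t)) (Q x) = (\<Sum>m\<in>keys (Q x). t ^ (D - r) *
          (lookup (Q x) m * t ^ (r - lookup m 0) * mono_eval (u t) m))"
          unfolding mp_eval_alt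
        proof (intro sum.cong refl)
          fix m assume m: "m \<in> keys (Q x)"
          have "r \<le> D" using sumD[OF mdeg[OF y(1,2)]] y(3)
            by (metis atLeastAtMost_iff finite_atLeastAtMost le0 member_le_sum zero_le)
          hence "D - lookup m 0 = (D - r) + (r - lookup m 0)" using le_r[OF x m] by simp
          thus "lookup (Q x) m * mono_eval (\<lambda>k. zc k (Lt t)) m = t ^ (D - r) *
            (lookup (Q x) m * t ^ (r - lookup m 0) * mono_eval (u t) m)"
            by (simp add: zE[OF mdeg[OF x m]] power_add)
        qed
        thus "mp_eval (\<lambda>k. zc k (Lt t)) (Q x) * H x (Lt t) = t ^ (D - r) * ((\<Sum>m\<in>keys (Q x).
        lookup (Q x) m * t ^ (r - lookup m 0) * mono_eval (u t) m) * H x (Lt t))"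
          by (simp add: sum_distrib_left mult.assoc)
      qed
      also have "\<dots> = t ^ (D - r) * E t" by (simp add: E_def sum_distrib_left)
      finally show ?thesis using t by simp
    qed
    have "isCont E 0" unfolding E_def mono_eval_def Lt_def
      by (intro continuous_intros uc) (use H multihom_isCont in blast)
    hence "E 0 = 0" using E0 by (rule isCont_zero_off_point)
    moreover have "E 0 = (\<Sum>m\<in>keys (Q y).
        lookup (Q y) m * 0 ^ (r - lookup m 0) * mono_eval (u 0) m) * H y L"
    proof -
      have "E 0 = (\<Sum>x\<in>{y}. (\<Sum>m\<in>keys (Q x).
        lookup (Q x) m * 0 ^ (r - lookup m 0) * mono_eval (u 0) m) * H x (Lt 0))"
        unfolding E_def by (rule sum.mono_neutral_right) (use X y H0 in \<open>auto simp: Lt_def L_def\<close>)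
      thus ?thesis by (simp add: Lt_def)
    qed
    ultimately have "0 = (\<Sum>m\<in>keys (Q y).
        lookup (Q y) m * 0 ^ (r - lookup m 0) * mono_eval (u 0) m)"
      using H0[OF y(1) y(1)] by (simp add: L_def)
    also have "\<dots> = (\<Sum>m\<in>A. lookup (Q y) m * 0 ^ (r - lookup m 0) * mono_eval (u 0) m)"
    proof (rule sum.mono_neutral_right)
      show "\<forall>m\<in>keys (Q y) - A. lookup (Q y) m * 0 ^ (r - lookup m 0) * mono_eval (u 0) m = 0"
        using le_r[OF y(1)] by (force simp: A_def)
    qed (auto simp: A_def)
    also have "\<dots> = (\<Sum>m\<in>A. lookup (Q y) m * mono_eval (\<lambda>k. if k = 0 then \<zeta> else w k) m)"
    proof (intro sum.cong refl)
      fix m assume m: "m \<in> A"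
      have "mono_eval (u 0) m = mono_eval (\<lambda>k. if k = 0 then \<zeta> else w k) m"
      proof (rule mono_eval_cong)
        fix k assume "k \<in> keys m"
        hence "k \<in> {0..n * s}" using m mdeg[OF y(1)] monomials_keys by (fastforce simp: A_def)
        thus "u 0 k = (if k = 0 then \<zeta> else w k)" by (rule u0)
      qed
      thus "lookup (Q y) m * 0 ^ (r - lookup m 0) * mono_eval (u 0) m
          = lookup (Q y) m * mono_eval (\<lambda>k. if k = 0 then \<zeta> else w k) m"
        using m by (simp add: A_def)
    qed
    finally show ?thesis by simp
  qed
  \<comment> \<open>All monomials in \<open>A\<close> have exponent \<open>r\<close> at variable 0.
    Removing it leaves a polynomial identity in the free values \<open>w\<close>, to which
    independence of monomials applies.\<close>
  define red where "red m = m - single 0 r" for m :: "nat \<Rightarrow>\<^sub>0 nat"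
  have red: "red m + single 0 r = m" if "m \<in> A" for m
    by (rule poly_mapping_eqI) (use that in \<open>auto simp: A_def red_def lookup_add lookup_minus lookup_single when_def\<close>)
  have injred: "inj_on red A" by (rule inj_onI) (metis red)
  have "(\<Sum>m'\<in>red ` A. lookup (Q y) (m' + single 0 r) * \<zeta> ^ r * mono_eval w m') = 0" for w
  proof -
    have "(\<Sum>m'\<in>red ` A. lookup (Q y) (m' + single 0 r) * \<zeta> ^ r * mono_eval w m')
        = (\<Sum>m\<in>A. lookup (Q y) m * mono_eval (\<lambda>k. if k = 0 then \<zeta> else w k) m)"
      unfolding sum.reindex[OF injred] o_def
    proof (intro sum.cong refl)
      fix m assume m: "m \<in> A"
      have "mono_eval (\<lambda>k. if k = 0 then \<zeta> else w k) m
          = mono_eval (\<lambda>k. if k = 0 then \<zeta> else w k) (red m) * \<zeta> ^ r"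
        by (subst red[OF m, symmetric]) (simp add: mono_eval_add)
      also have "mono_eval (\<lambda>k. if k = 0 then \<zeta> else w k) (red m) = mono_eval w (red m)"
      proof (rule mono_eval_cong)
        fix k assume "k \<in> keys (red m)"
        moreover have "lookup (red m) 0 = 0" using m by (simp add: red_def lookup_minus A_def)
        ultimately have "k \<noteq> 0" by (metis in_keys_iff)
        thus "(if k = 0 then \<zeta> else w k) = w k" by simp
      qed
      finally show "lookup (Q y) (red m + single 0 r) * \<zeta> ^ r * mono_eval w (red m)
          = lookup (Q y) m * mono_eval (\<lambda>k. if k = 0 then \<zeta> else w k) m"
        by (simp add: red[OF m])
    qed
    thus ?thesis using main by simp
  qed
  moreover have m1: "m1 \<in> A" using y by (simp add: A_def)
  ultimately have "lookup (Q y) (red m1 + single 0 r) * \<zeta> ^ r = 0"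
    by (intro mono_eval_independent[of "red ` A" "\<lambda>m'. lookup (Q y) (m' + single 0 r) * \<zeta> ^ r"])
       (auto simp: A_def)
  thus False using \<zeta> y(2) by (simp add: red[OF m1] in_keys_iff)
qed

section \<open>Evaluation as a linear form on the space of forms, and separation of
  partitions\<close>

definition evf :: "(nat \<Rightarrow> complex) \<Rightarrow> (nat \<Rightarrow>\<^sub>0 nat) mpol" where
  "evf x = (\<Sum>a\<in>idx. single (single a 1) (mono_eval x a))"

lemma evf_in_forms: "evf x \<in> forms idx 1"
  unfolding evf_def by (intro forms_sum forms_single monomials_single)

lemma mp_eval_evf:
  assumes "v \<in> forms {..n} s"
  shows "mp_eval (lookup v) (evf x) = mp_eval x v"
proof -
  have "keys v \<subseteq> idx" using assms by (simp add: forms_def coord_space_def)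
  thus ?thesis
    by (simp add: evf_def mp_eval_sum mp_eval_superset[OF finite_idx] mult.commute)
qed

lemma pull_evf: "pull (evf x) L = mp_eval x (form_of L)"
  unfolding pull_def by (rule mp_eval_evf) (rule form_of_in_forms)

lemma pull_evf_mpt: "pull (evf (mpt k)) L = zc k L"
  by (simp add: pull_evf mp_eval_form_of zc_def)

lemma pull_mult: "pull (P * Q) L = pull P L * pull Q L"
  by (simp add: pull_def mp_eval_mult)

lemma pull_prod: "pull (prod f A) L = (\<Prod>a\<in>A. pull (f a) L)"
  by (simp add: pull_def mp_eval_prod)

lemma pull_power: "pull (P ^ k) L = pull P L ^ k"
  by (simp add: pull_def mp_eval_power)

lemma pull_sum: "pull (sum f A) L = (\<Sum>a\<in>A. pull (f a) L)"
  by (simp add: pull_def mp_eval_sum)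

lemma pull_scale: "pull (scale_pm c P) L = c * pull P L"
  by (simp add: pull_def)

text \<open>On the line through a point good for \<open>J\<close> and a point good for
  \<open>a\<close>, each functional vanishes for at most one parameter, so some parameter avoids all
  of them.\<close>

lemma common_nonzero_point:
  assumes "finite J" "V \<noteq> {}"
    and V: "\<And>x y t. x \<in> V \<Longrightarrow> y \<in> V \<Longrightarrow> (\<lambda>j. x j + t * y j) \<in> V"
    and "\<And>a. a \<in> J \<Longrightarrow> \<exists>x\<in>V. dot a x \<noteq> 0"
  shows "\<exists>x\<in>V. \<forall>a\<in>J. dot a x \<noteq> 0"
  using assms(1,4)
proof (induction J rule: finite_induct)
  case empty thus ?case using assms(2) by auto
next
  case (insert a J)
  obtain x where x: "x \<in> V" "\<forall>a\<in>J. dot a x \<noteq> 0" using insert by auto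
  obtain y where y: "y \<in> V" "dot a y \<noteq> 0" using insert.prems by auto
  have fin: "finite {t. dot b x + t * dot b y = 0}" if "dot b x \<noteq> 0 \<or> dot b y \<noteq> 0" for b
  proof (cases "dot b y = 0")
    case False
    hence "{t. dot b x + t * dot b y = 0} \<subseteq> {- dot b x / dot b y}"
      by (auto simp: field_simps add_eq_0_iff)
    thus ?thesis using finite_subset by blast
  qed (use that in auto)
  have "finite (\<Union>b\<in>insert a J. {t. dot b x + t * dot b y = 0})"
    using insert.hyps(1) x y fin by blast
  then obtain t where t: "t \<notin> (\<Union>b\<in>insert a J. {t. dot b x + t * dot b y = 0})"
    using ex_new_if_finite[OF infinite_UNIV_char_0] by blast
  have "dot b (\<lambda>j. x j + t * y j) \<noteq> 0" if "b \<in> insert a J" for b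
    using t that by (auto simp: dot_add_right dot_scale_right)
  thus ?case using V[OF x(1) y(1), of t] by blast
qed

lemma card_block_partition:
  assumes "P \<in> block_partitions n {1..n * s}" shows "finite P" "card P = s"
proof -
  have part: "partition_on {1..n * s} P" and c: "\<And>B. B \<in> P \<Longrightarrow> card B = n"
    using assms by (auto simp: block_partitions_def)
  show fin: "finite P" using part by (rule finite_elements[rotated]) simp
  have "card (\<Union>P) = (\<Sum>B\<in>P. card B)"
    by (rule card_Union_disjoint)
       (use part in \<open>auto simp: partition_on_def disjnt_def disjoint_def pairwise_def intro: finite_subset\<close>)
  moreover have "\<Union>P = {1..n * s}" using part by (simp add: partition_on_def)
  ultimately have "n * s = card P * n" using c by simp
  thus "card P = s" using n by simp
qed

lemma blocks_of_partition:
  assumes "P \<in> block_partitions n {1..n * s}"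
  shows "\<exists>b. is_blocks b \<and> b ` {1..s} = P"
proof -
  have part: "partition_on {1..n * s} P" and c: "\<And>B. B \<in> P \<Longrightarrow> card B = n"
    using assms by (auto simp: block_partitions_def)
  obtain b where b: "bij_betw b {1..s} P"
    using ex_bij_betw_nat_finite_1[OF card_block_partition(1)[OF assms]] card_block_partition(2)[OF assms] by auto
  have bP: "b ` {1..s} = P" using b by (simp add: bij_betw_def)
  have mem: "b i \<in> P" if "i \<in> {1..s}" for i using bP that by auto
  have "disjoint_family_on b {1..s}"
    unfolding disjoint_family_on_def
  proof (intro ballI impI)
    fix i j assume ij: "i \<in> {1..s}" "j \<in> {1..s}" "i \<noteq> j"
    hence "b i \<noteq> b j" using inj_onD[OF bij_betw_imp_inj_on[OF b]] by metis
    moreover have "disjoint P" using part by (simp add: partition_on_def)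
    ultimately show "b i \<inter> b j = {}" using disjointD mem[OF ij(1)] mem[OF ij(2)] by metis
  qed
  moreover have "(\<Union>i\<in>{1..s}. b i) = {1..n * s}" using bP part by (simp add: partition_on_def)
  moreover have "finite (b i) \<and> card (b i) = n" if "i \<in> {1..s}" for i
    using c[OF mem[OF that]] n by (metis card.infinite not_one_le_zero)
  ultimately have "is_blocks b" unfolding is_blocks_def by blast
  thus ?thesis using bP by blast
qed

text \<open>Some block of \<open>b'\<close> is not a block of \<open>b\<close>. Its hyperplane lies
  in none of the hyperplanes of \<open>b\<close>, since for each of them it contains a node outside
  the corresponding block. A general point of this hyperplane therefore separates the two
  products.\<close>

lemma separating_point:
  assumes b: "is_blocks b" "is_blocks b'" and ne: "b ` {1..s} \<noteq> b' ` {1..s}"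
  shows "\<exists>x. mp_eval x (form_of (block_lin b)) \<noteq> 0 \<and> mp_eval x (form_of (block_lin b')) = 0"
proof -
  have cardim: "card (c ` {1..s}) = s" if "is_blocks c" for c
  proof -
    have "inj_on c {1..s}"
    proof (rule inj_onI)
      fix i j assume ij: "i \<in> {1..s}" "j \<in> {1..s}" "c i = c j"
      have "card (c i) = n" using that ij(1) unfolding is_blocks_def by blast
      hence "c i \<noteq> {}" using n by auto
      thus "i = j" using that ij unfolding is_blocks_def disjoint_family_on_def by (metis Int_absorb)
    qed
    thus ?thesis by (simp add: card_image)
  qed
  have "\<not> b' ` {1..s} \<subseteq> b ` {1..s}"
    using card_subset_eq[of "b ` {1..s}" "b' ` {1..s}"] ne cardim b by auto
  then obtain i0 where i0: "i0 \<in> {1..s}" "b' i0 \<notin> b ` {1..s}" by blast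
  define V where "V = {x. dot (block_lin b' i0) x = 0}"
  have "\<exists>x\<in>V. \<forall>a\<in>(\<lambda>i. block_lin b i) ` {1..s}. dot a x \<noteq> 0"
  proof (rule common_nonzero_point)
    have "(\<lambda>j. 0) \<in> V" by (simp add: V_def dot_def)
    thus "V \<noteq> {}" by blast
    show "(\<lambda>j. x j + t * y j) \<in> V" if "x \<in> V" "y \<in> V" for x y t
      using that by (simp add: V_def dot_add_right dot_scale_right)
    fix a assume "a \<in> (\<lambda>i. block_lin b i) ` {1..s}"
    then obtain i where i: "i \<in> {1..s}" "a = block_lin b i" by auto
    have "\<not> b' i0 \<subseteq> b i"
      using card_subset_eq[of "b i" "b' i0"] i i0 b by (auto simp: is_blocks_def)
    then obtain k where k: "k \<in> b' i0" "k \<notin> b i" by auto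
    have "mpt k \<in> V" using dot_block_lin_eq_0[OF b(2) i0(1)] k by (simp add: V_def)
    moreover have "dot a (mpt k) \<noteq> 0" using dot_block_lin_eq_0[OF b(1) i(1)] k i by simp
    ultimately show "\<exists>x\<in>V. dot a x \<noteq> 0" by blast
  qed simp
  then obtain x where x: "x \<in> V" "\<forall>i\<in>{1..s}. dot (block_lin b i) x \<noteq> 0" by auto
  have "mp_eval x (form_of (block_lin b)) \<noteq> 0" using x by (simp add: mp_eval_form_of)
  moreover have "mp_eval x (form_of (block_lin b')) = 0"
    using x(1) i0(1) by (auto simp: mp_eval_form_of V_def intro!: prod_zero)
  ultimately show ?thesis by blast
qed

definition num_blocks :: nat where
  "num_blocks = (\<Prod>k=1..s. (n * k - 1) choose (n - 1))"

lemma card_block_partitions_num: "card (block_partitions n {1..n * s}) = num_blocks"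
  unfolding num_blocks_def by (rule card_block_partitions) (use n in auto)

definition zmono :: "(nat \<Rightarrow>\<^sub>0 nat) \<Rightarrow> (nat \<Rightarrow>\<^sub>0 nat) mpol" where
  "zmono m = (\<Prod>k\<in>keys m. evf (mpt k) ^ lookup m k)"

lemma pull_zmono: "pull (zmono m) L = mono_eval (\<lambda>k. zc k L) m"
  by (simp add: zmono_def pull_prod pull_power pull_evf_mpt mono_eval_def)

lemma zmono_in_forms: "m \<in> monomials J d \<Longrightarrow> zmono m \<in> forms idx d"
  using forms_prod[of "keys m" "\<lambda>k. evf (mpt k) ^ lookup m k" idx "lookup m"]
    forms_power[OF evf_in_forms]
  by (simp add: zmono_def monomials_def)

text \<open>\<open>h P\<close> is the product, over all other partitions, of the evaluations at
  points that separate \<open>P\<close> from them. All these products have the same degree, as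
  \<open>independent_over_coordinates\<close> requires.\<close>

lemma separating_forms:
  obtains b and h :: "nat set set \<Rightarrow> (nat \<Rightarrow>\<^sub>0 nat) mpol" and c
  where "\<And>P. P \<in> block_partitions n {1..n * s} \<Longrightarrow> is_blocks (b P)"
    and "\<And>P. P \<in> block_partitions n {1..n * s} \<Longrightarrow> h P \<in> forms idx c"
    and "\<And>P P'. P \<in> block_partitions n {1..n * s} \<Longrightarrow> P' \<in> block_partitions n {1..n * s} \<Longrightarrow>
           pull (h P) (block_lin (b P')) = 0 \<longleftrightarrow> P \<noteq> P'"
proof -
  define X where "X = block_partitions n {1..n * s}"
  have finX: "finite X" by (simp add: X_def finite_block_partitions)
  have "\<forall>P\<in>X. \<exists>b. is_blocks b \<and> b ` {1..s} = P" using blocks_of_partition by (simp add: X_def)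
  then obtain b where b: "\<And>P. P \<in> X \<Longrightarrow> is_blocks (b P)" "\<And>P. P \<in> X \<Longrightarrow> b P ` {1..s} = P" by metis
  have "\<forall>P\<in>X. \<forall>P'\<in>X. P \<noteq> P' \<longrightarrow> (\<exists>x. mp_eval x (form_of (block_lin (b P))) \<noteq> 0 \<and> mp_eval x (form_of (block_lin (b P'))) = 0)"
    using separating_point b by metis
  then obtain x where x: "\<And>P P'. P \<in> X \<Longrightarrow> P' \<in> X \<Longrightarrow> P \<noteq> P' \<Longrightarrow>
      mp_eval (x P P') (form_of (block_lin (b P))) \<noteq> 0 \<and> mp_eval (x P P') (form_of (block_lin (b P'))) = 0"
    by metis
  define h where "h P = (\<Prod>P'\<in>X - {P}. evf (x P P'))" for P
  have "h P \<in> forms idx (card X - 1)" if "P \<in> X" for P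
    using forms_prod1[of "X - {P}" "\<lambda>P'. evf (x P P')" idx] evf_in_forms that finX by (simp add: h_def)
  moreover have "pull (h P) (block_lin (b P')) = 0 \<longleftrightarrow> P \<noteq> P'" if "P \<in> X" "P' \<in> X" for P P'
    using x that finX by (auto simp: h_def pull_prod pull_evf)
  ultimately show ?thesis using that[of b h "card X - 1"] b by (simp add: X_def)
qed

text \<open>The shift \<open>c\<close> is the degree of the separating forms; it disappears in the
  leading coefficient.\<close>

lemma hilbert_function_ge:
  "\<exists>c. \<forall>d. num_blocks * ((n * s + d) choose (n * s)) \<le> hilbert_function idx (decomposables n s) (d + c)"
proof -
  obtain b and h :: "nat set set \<Rightarrow> (nat \<Rightarrow>\<^sub>0 nat) mpol" and c
  where b: "\<And>P. P \<in> block_partitions n {1..n * s} \<Longrightarrow> is_blocks (b P)"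
    and h: "\<And>P. P \<in> block_partitions n {1..n * s} \<Longrightarrow> h P \<in> forms idx c"
    and h0: "\<And>P P'. P \<in> block_partitions n {1..n * s} \<Longrightarrow> P' \<in> block_partitions n {1..n * s} \<Longrightarrow>
           pull (h P) (block_lin (b P')) = 0 \<longleftrightarrow> P \<noteq> P'"
    using separating_forms by blast
  define X where "X = block_partitions n {1..n * s}"
  have finX: "finite X" by (simp add: X_def finite_block_partitions)
  have "num_blocks * ((n * s + d) choose (n * s)) \<le> hilbert_function idx (decomposables n s) (d + c)" for d
  proof -
    let ?M = "monomials {0..n * s} d"
    have finM: "finite ?M" by (simp add: finite_monomials)
    define v where "v = (\<lambda>(P, m). zmono m * h P)"
    have vf: "v Pm \<in> forms idx (d + c)" if "Pm \<in> X \<times> ?M" for Pm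
      using that h unfolding v_def X_def by (auto intro!: forms_mult zmono_in_forms)
    have "card (X \<times> ?M) \<le> pm.dim (coord_space (monomials idx (d + c)))
        - pm.dim (vanishing_forms idx (decomposables n s) (d + c))"
    proof (rule codim_ge[where v = v])
      fix l assume l: "(\<Sum>x\<in>X \<times> ?M. scale_pm (l x) (v x)) \<in> vanishing_forms idx (decomposables n s) (d + c)"
      define Q where "Q P = (\<Sum>m\<in>?M. single m (l (P, m)))" for P
      have lQ: "lookup (Q P) m = l (P, m)" if "m \<in> ?M" for P m
        using that finM by (simp add: Q_def lookup_sum_single)
      have Q0: "Q P = 0" if "P \<in> X" for P
      proof (rule independent_over_coordinates[where b = b and H = "\<lambda>P. pull (h P)" and Q = Q and X = X and c = c])
        show "Q P \<in> forms {0..n * s} d" for P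
          unfolding Q_def by (intro forms_sum forms_single)
        fix L
        have "0 = pull (\<Sum>x\<in>X \<times> ?M. scale_pm (l x) (v x)) L" using l by (simp add: vanishing_forms_iff)
        also have "\<dots> = (\<Sum>P\<in>X. \<Sum>m\<in>?M. l (P, m) * (mono_eval (\<lambda>k. zc k L) m * pull (h P) L))"
          by (simp add: pull_sum pull_scale sum.cartesian_product v_def split_def pull_mult pull_zmono)
        also have "\<dots> = (\<Sum>P\<in>X. mp_eval (\<lambda>k. zc k L) (Q P) * pull (h P) L)"
          by (simp add: Q_def mp_eval_sum sum_distrib_right mult.assoc)
        finally show "(\<Sum>P\<in>X. mp_eval (\<lambda>k. zc k L) (Q P) * pull (h P) L) = 0" by simp
      qed (use finX b h h0 that multihom_pull in \<open>auto simp: X_def\<close>)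
      show "\<forall>x\<in>X \<times> ?M. l x = 0" using Q0 lQ by (metis SigmaE lookup_zero)
    qed (use finX finM vf vanishing_forms_subspace finite_monomials[OF finite_idx] in
         \<open>auto simp: forms_def vanishing_forms_def\<close>)
    moreover have "card ?M = (n * s + d) choose (n * s)"
      by (simp only: atLeast0AtMost card_monomials_atMost)
    moreover have "card X = num_blocks" unfolding X_def by (rule card_block_partitions_num)
    ultimately show ?thesis by (simp add: hilbert_function_def forms_def card_cartesian_product)
  qed
  thus ?thesis by blast
qed

end

section \<open>Growth of binomial coefficients and the value of the degree\<close>

lemma linear_ratio_tendsto: "(\<lambda>d. real (a + d - e) / real d) \<longlonglongrightarrow> 1"
proof -
  have "(\<lambda>d. 1 + (real a - real e) / real d) \<longlonglongrightarrow> 1 + 0"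
    by (intro tendsto_intros real_tendsto_divide_at_top[OF tendsto_const filterlim_real_sequentially])
  hence "(\<lambda>d. 1 + (real a - real e) / real d) \<longlonglongrightarrow> 1" by simp
  thus ?thesis
  proof (rule Lim_transform_eventually)
    show "eventually (\<lambda>d. 1 + (real a - real e) / real d = real (a + d - e) / real d) sequentially"
      using eventually_ge_at_top[of "e + 1"]
      by eventually_elim (simp add: of_nat_diff field_simps)
  qed
qed

text \<open>Each of the \<open>r\<close> factors \<open>u d - i\<close>, divided by
  \<open>g d\<close>, tends to \<open>l\<close>. The scale \<open>g\<close> is general because the
  nested binomial of the upper bound needs both \<open>d\<close> and \<open>d ^ n\<close>.\<close>

lemma binomial_asymptotic:
  fixes u :: "nat \<Rightarrow> nat" and g :: "nat \<Rightarrow> real"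
  assumes "filterlim g at_top sequentially" "(\<lambda>d. real (u d) / g d) \<longlonglongrightarrow> l"
  shows "(\<lambda>d. real (u d choose r) / g d ^ r) \<longlonglongrightarrow> l ^ r / fact r"
proof -
  have inv: "(\<lambda>d. c / g d) \<longlonglongrightarrow> 0" for c :: real
    by (rule real_tendsto_divide_at_top[OF tendsto_const assms(1)])
  have "(\<lambda>d. (\<Prod>i<r. real (u d) / g d - real i / g d) / fact r) \<longlonglongrightarrow> (\<Prod>i<r. l - 0) / fact r"
    by (intro tendsto_intros assms(2) inv) simp
  moreover have "(\<Prod>i<r. real (u d) / g d - real i / g d) / fact r = real (u d choose r) / g d ^ r" for d
  proof -
    have "real (u d choose r) = (\<Prod>i<r. real (u d) - real i) / fact r"
      by (simp add: binomial_gbinomial gbinomial_prod_rev atLeast0LessThan)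
    thus ?thesis by (simp add: diff_divide_distrib[symmetric] prod_dividef)
  qed
  ultimately show ?thesis by simp
qed

context split_forms
begin

lemma hilbert_function_asymptotic:
  "(\<lambda>d. real (hilbert_function idx (decomposables n s) d) / real d ^ (n * s)) \<longlonglongrightarrow> real num_blocks / fact (n * s)"
proof -
  obtain c where c: "\<And>d. num_blocks * ((n * s + d) choose (n * s)) \<le> hilbert_function idx (decomposables n s) (d + c)"
    using hilbert_function_ge by blast
  have inf: "filterlim (\<lambda>d::nat. real d) at_top sequentially" by (rule filterlim_real_sequentially)
  note lin1 = linear_ratio_tendsto
  have low: "(\<lambda>d. real num_blocks * (real ((n * s + d - c) choose (n * s)) / real d ^ (n * s))) \<longlonglongrightarrow> real num_blocks * (1 ^ (n * s) / fact (n * s))"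
    by (intro tendsto_mult tendsto_const binomial_asymptotic inf lin1)
  have N1: "(\<lambda>d. real ((n + d) choose n) / real d ^ n) \<longlonglongrightarrow> 1 ^ n / fact n"
    by (intro binomial_asymptotic inf) (use lin1[of n 0] in simp)
  have infn: "filterlim (\<lambda>d. real d ^ n) at_top sequentially"
    by (rule filterlim_pow_at_top[OF _ inf]) (use n in simp)
  have "(\<lambda>d. real ((n + d) choose n) / real d ^ n + real (s - 1) / real d ^ n) \<longlonglongrightarrow> 1 / fact n + 0"
    by (rule tendsto_add[OF N1[simplified] real_tendsto_divide_at_top[OF tendsto_const infn]])
  moreover have "real ((n + d) choose n) / real d ^ n + real (s - 1) / real d ^ n = real (((n + d) choose n) + s - 1) / real d ^ n" for d
    using s by (simp add: add_divide_distrib[symmetric] of_nat_diff)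
  ultimately have "(\<lambda>d. real (((n + d) choose n) + s - 1) / real d ^ n) \<longlonglongrightarrow> 1 / fact n" by simp
  hence "(\<lambda>d. real ((((n + d) choose n) + s - 1) choose s) / (real d ^ n) ^ s) \<longlonglongrightarrow> (1 / fact n) ^ s / fact s"
    by (rule binomial_asymptotic[OF infn])
  hence up: "(\<lambda>d. real ((((n + d) choose n) + s - 1) choose s) / real d ^ (n * s)) \<longlonglongrightarrow> (1 / fact n) ^ s / fact s"
    by (simp add: power_mult)
  have "num_blocks * (fact n ^ s * fact s) = fact (n * s)"
    unfolding num_blocks_def by (rule prod_choose_eq_multinomial) (rule n)
  hence "real num_blocks * (fact n ^ s * fact s) = fact (n * s)"
    by (metis of_nat_fact of_nat_mult of_nat_power)
  hence eq: "(1 / fact n) ^ s / fact s = real num_blocks / fact (n * s)"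
    by (simp add: field_simps power_one_over)
  show ?thesis
  proof (rule tendsto_sandwich)
    show "eventually (\<lambda>d. real num_blocks * (real ((n * s + d - c) choose (n * s)) / real d ^ (n * s))
        \<le> real (hilbert_function idx (decomposables n s) d) / real d ^ (n * s)) sequentially"
      using eventually_ge_at_top[of c]
    proof eventually_elim
      case (elim d)
      have "num_blocks * ((n * s + d - c) choose (n * s)) \<le> hilbert_function idx (decomposables n s) d"
        using c[of "d - c"] elim by simp
      hence "real num_blocks * real ((n * s + d - c) choose (n * s)) \<le> real (hilbert_function idx (decomposables n s) d)"
        by (metis of_nat_le_iff of_nat_mult)
      thus ?case by (simp add: divide_right_mono)
    qed
    show "eventually (\<lambda>d. real (hilbert_function idx (decomposables n s) d) / real d ^ (n * s)
        \<le> real ((((n + d) choose n) + s - 1) choose s) / real d ^ (n * s)) sequentially"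
      by (intro always_eventually allI divide_right_mono) (use hilbert_function_le in auto)
    show "(\<lambda>d. real num_blocks * (real ((n * s + d - c) choose (n * s)) / real d ^ (n * s))) \<longlonglongrightarrow> real num_blocks / fact (n * s)"
      using low by simp
    show "(\<lambda>d. real ((((n + d) choose n) + s - 1) choose s) / real d ^ (n * s)) \<longlonglongrightarrow> real num_blocks / fact (n * s)"
      using up unfolding eq .
  qed
qed

lemma num_blocks_pos: "num_blocks > 0"
proof -
  have "num_blocks * (fact n ^ s * fact s) = fact (n * s)"
    unfolding num_blocks_def by (rule prod_choose_eq_multinomial) (rule n)
  thus ?thesis by (metis fact_nonzero gr0I mult_zero_left)
qed

lemma proj_degree_decomposables: "proj_degree idx (decomposables n s) = of_nat num_blocks"
proof -
  have "proj_degree idx (decomposables n s) = fact (n * s) * (of_nat num_blocks / fact (n * s))"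
  proof (rule proj_degree_eqI[OF finite_idx])
    show "(of_nat num_blocks / fact (n * s) :: rat) \<noteq> 0" using num_blocks_pos by simp
    have "real_of_rat (of_nat num_blocks / fact (n * s)) = real num_blocks / fact (n * s)"
      by (simp add: of_rat_divide) (metis of_nat_fact of_rat_of_nat_eq)
    thus "(\<lambda>d. real (hilbert_function idx (decomposables n s) d) / real d ^ (n * s)) \<longlonglongrightarrow> real_of_rat (of_nat num_blocks / fact (n * s))"
      using hilbert_function_asymptotic by simp
  qed
  thus ?thesis by simp
qed

end

section \<open>Hyperplanes through points in general position\<close>

lemma multiforms_mult:
  assumes "finite I" "p \<in> multiforms K I e" "q \<in> multiforms K I e'"
  shows "p * q \<in> multiforms K I (\<lambda>k. e k + e' k)"
  unfolding multiforms_def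
proof (intro CollectI ballI)
  fix m assume "m \<in> keys (p * q)"
  then obtain a b where ab: "a \<in> keys p" "b \<in> keys q" "m = a + b"
    using keys_mult[of p q] by auto
  have "keys a \<subseteq> K \<times> I" "keys b \<subseteq> K \<times> I"
    "\<forall>k\<in>K. (\<Sum>i\<in>I. lookup a (k, i)) = e k" "\<forall>k\<in>K. (\<Sum>i\<in>I. lookup b (k, i)) = e' k"
    using assms(2,3) ab(1,2) unfolding multiforms_def by blast+
  moreover from this have "keys m \<subseteq> K \<times> I" using keys_add[of a b] ab(3) by blast
  ultimately show "keys m \<subseteq> K \<times> I \<and> (\<forall>k\<in>K. (\<Sum>i\<in>I. lookup m (k, i)) = e k + e' k)"
    by (simp add: ab(3) lookup_add sum.distrib)
qed

lemma multiforms_prod: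
  assumes "finite I" "\<And>a. a \<in> A \<Longrightarrow> f a \<in> multiforms K I (e a)"
  shows "prod f A \<in> multiforms K I (\<lambda>k. \<Sum>a\<in>A. e a k)"
  using assms(2)
proof (induction A rule: infinite_finite_induct)
  case (insert a A)
  thus ?case using multiforms_mult[OF assms(1), of "f a" K "e a" "prod f A" "\<lambda>k. \<Sum>a\<in>A. e a k"] by simp
qed (auto simp: multiforms_def)

lemma multiforms_uminus: "p \<in> multiforms K I e \<Longrightarrow> - p \<in> multiforms K I e"
  by (simp add: multiforms_def)

lemma multiforms_sum:
  assumes "\<And>a. a \<in> A \<Longrightarrow> f a \<in> multiforms K I e" shows "sum f A \<in> multiforms K I e"
  using assms
proof (induction A rule: infinite_finite_induct)
  case (insert a A)
  hence "f a \<in> multiforms K I e" "sum f A \<in> multiforms K I e" by auto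
  thus ?case using keys_add[of "f a" "sum f A"] insert.hyps unfolding multiforms_def by (simp, blast)
qed (auto simp: multiforms_def)

lemma comm_ring_hom_mp_eval: "comm_ring_hom (mp_eval x)"
  by unfold_locales (auto simp: mp_eval_add mp_eval_mult)

text \<open>Here \<open>inc H\<close> is the set of labels of the points on the hyperplane \<open>H\<close>.\<close>

lemma covering_tuples_bij:
  fixes inc :: "'h \<Rightarrow> 'k set"
  assumes n: "n \<ge> 1" and K: "finite K" "card K = n * s"
    and inc: "\<And>H. H \<in> HH \<Longrightarrow> inc H \<subseteq> K \<and> card (inc H) \<le> n"
    and ex: "\<And>B. B \<subseteq> K \<Longrightarrow> card B = n \<Longrightarrow> \<exists>H\<in>HH. inc H = B"
    and un: "\<And>H H'. H \<in> HH \<Longrightarrow> H' \<in> HH \<Longrightarrow> inc H = inc H' \<Longrightarrow> card (inc H) = n \<Longrightarrow> H = H'"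
  shows "bij_betw (\<lambda>M. inc ` set_mset M)
    {M. size M = s \<and> set_mset M \<subseteq> HH \<and> K \<subseteq> \<Union>(inc ` set_mset M)} (block_partitions n K)"
proof -
  define T where "T = {M. size M = s \<and> set_mset M \<subseteq> HH \<and> K \<subseteq> \<Union>(inc ` set_mset M)}"
  have main: "M = mset_set (set_mset M) \<and> (\<forall>H\<in>set_mset M. card (inc H) = n) \<and> inc ` set_mset M \<in> block_partitions n K"
    if M: "M \<in> T" for M
  proof -
    define D where "D = set_mset M"
    have D: "finite D" "D \<subseteq> HH" "K \<subseteq> \<Union>(inc ` D)" "size M = s" using M by (auto simp: T_def D_def)
    have fin: "finite (inc H)" if "H \<in> D" for H using inc D K(1) that finite_subset by blast
    have cD: "card D \<le> s"
      unfolding D_def D(4)[symmetric] by (metis mset_set_set_mset_msubset size_mset_mono size_mset_set)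
    \<comment> \<open>The count is tight: at most \<open>s\<close> sets with at most
      \<open>n\<close> elements each cover \<open>n * s\<close> labels. So the hyperplanes are
      pairwise distinct and each contains exactly \<open>n\<close> of the points.\<close>
    have le: "n * s \<le> (\<Sum>H\<in>D. card (inc H))"
      using card_mono[OF _ D(3)] fin D(1) card_UN_le[OF D(1), of inc] K(2) by (metis finite_UN le_trans)
    also have "\<dots> \<le> (\<Sum>H\<in>D. n)" by (rule sum_mono) (use inc D in auto)
    finally have "n * s \<le> card D * n" by simp
    hence cs: "card D = s" using cD n by simp
    have c_n: "card (inc H) = n" if H: "H \<in> D" for H
    proof (rule ccontr)
      assume "card (inc H) \<noteq> n"
      hence "card (inc H) < n" using inc H D by (meson le_neq_implies_less subsetD)
      hence "(\<Sum>H\<in>D. card (inc H)) < (\<Sum>H\<in>D. n)"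
        using H D by (intro sum_strict_mono_ex1) (auto dest: inc)
      thus False using le cs by (simp add: mult.commute)
    qed
    have dis: "inc H \<inter> inc H' = {}" if H: "H \<in> D" "H' \<in> D" "H \<noteq> H'" for H H'
    proof (rule ccontr)
      assume "inc H \<inter> inc H' \<noteq> {}"
      then obtain k where k: "k \<in> inc H" "k \<in> inc H'" by auto
      \<comment> \<open>A shared label could be dropped from one of the two sets, leaving too few
        elements to cover \<open>K\<close>.\<close>
      have "K \<subseteq> (inc H' - {k}) \<union> (\<Union>H\<in>D - {H'}. inc H)" using D(3) H k by auto
      hence "n * s \<le> card ((inc H' - {k}) \<union> (\<Union>H\<in>D - {H'}. inc H))"
        using fin H D(1) by (subst K(2)[symmetric], intro card_mono) auto
      also have "\<dots> \<le> card (inc H' - {k}) + card (\<Union>H\<in>D - {H'}. inc H)" by (rule card_Un_le)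
      also have "card (\<Union>H\<in>D - {H'}. inc H) \<le> (\<Sum>H\<in>D - {H'}. card (inc H))"
        using D(1) by (intro card_UN_le) auto
      also have "\<dots> = (s - 1) * n" using c_n cs H D(1) by simp
      also have "card (inc H' - {k}) = n - 1" using c_n[OF H(2)] k fin[OF H(2)] by simp
      finally have "n * s \<le> (n - 1) + (s - 1) * n" by simp
      moreover have "s \<ge> 1" using cs H(1) D(1) by (metis One_nat_def Suc_leI card_gt_0_iff empty_iff)
      hence "(s - 1) * n + n = n * s" by (metis add.commute le_add_diff_inverse mult.commute mult_Suc plus_1_eq_Suc)
      ultimately show False using n by linarith
    qed
    have "M = mset_set D"
    proof -
      have "mset_set D \<subseteq># M" unfolding D_def by (rule mset_set_set_mset_msubset)
      moreover have "size (mset_set D) = size M" using cs D(4) by simp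
      ultimately show ?thesis by (metis mset_subset_size nat_less_le subset_mset.nless_le)
    qed
    moreover have "inc ` D \<in> block_partitions n K"
      unfolding block_partitions_def
    proof (intro CollectI conjI ballI partition_onI)
      show "\<Union> (inc ` D) = K" using D(2,3) inc by blast
      show "disjnt p q" if "p \<in> inc ` D" "q \<in> inc ` D" "p \<noteq> q" for p q
        using that dis unfolding disjnt_def by blast
      show "{} \<notin> inc ` D" using c_n n by fastforce
      show "card B = n" if "B \<in> inc ` D" for B using that c_n by blast
    qed
    ultimately show ?thesis using c_n unfolding D_def by blast
  qed
  have "inj_on (\<lambda>M. inc ` set_mset M) T"
  proof (rule inj_onI)
    have sub: "set_mset M \<subseteq> set_mset M'" if MM: "M \<in> T" "M' \<in> T" "inc ` set_mset M = inc ` set_mset M'" for M M'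
    proof
      fix H assume H: "H \<in># M"
      then obtain H' where H': "H' \<in># M'" "inc H = inc H'" using MM(3) by (metis imageE imageI)
      have "card (inc H) = n" using main[OF MM(1)] H by blast
      hence "H = H'" using un[of H H'] H H' MM(1,2) by (auto simp: T_def)
      thus "H \<in># M'" using H' by simp
    qed
    fix M M' assume a: "M \<in> T" "M' \<in> T" "inc ` set_mset M = inc ` set_mset M'"
    hence "set_mset M = set_mset M'" using sub[OF a] sub[OF a(2,1)] by auto
    thus "M = M'" using main[OF a(1)] main[OF a(2)] by metis
  qed
  moreover have "P \<in> (\<lambda>M. inc ` set_mset M) ` T" if P: "P \<in> block_partitions n K" for P
  proof -
    have part: "partition_on K P" and c: "\<And>B. B \<in> P \<Longrightarrow> card B = n" using P by (auto simp: block_partitions_def)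
    have finP: "finite P" using part K(1) by (metis finite_elements)
    have "\<forall>B\<in>P. \<exists>H\<in>HH. inc H = B" using ex c part by (auto simp: partition_on_def)
    then obtain h where h: "\<And>B. B \<in> P \<Longrightarrow> h B \<in> HH \<and> inc (h B) = B" by metis
    have inj: "inj_on h P" by (metis h inj_onI)
    have im: "inc ` h ` P = P" using h by force
    have "card (\<Union>P) = (\<Sum>B\<in>P. card B)"
    proof (rule card_Union_disjoint)
      show "pairwise disjnt P" using part unfolding partition_on_def pairwise_def disjnt_def disjoint_def by blast
      show "finite B" if "B \<in> P" for B using c[OF that] n by (metis card.infinite not_one_le_zero)
    qed
    hence "card K = card P * n" using c part by (simp add: partition_on_def)
    hence "card P = s" using K n by simp
    hence "mset_set (h ` P) \<in> T"
      using h finP im part card_image[OF inj] by (auto simp: T_def partition_on_def)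
    moreover have "inc ` set_mset (mset_set (h ` P)) = P" using finP im by simp
    ultimately show ?thesis by (metis (no_types, lifting) image_eqI)
  qed
  ultimately show ?thesis using main unfolding bij_betw_def T_def[symmetric] by blast
qed

context split_forms
begin

text \<open>The label \<open>0\<close> stands for the constant auxiliary point \<open>(1, 0, \<dots>, 0)\<close>: with it, the
  nonvanishing of all \<open>(n + 1)\<close>-minors also makes every \<open>n\<close> of the points independent.\<close>

definition coord_row :: "nat \<Rightarrow> nat \<Rightarrow> (nat \<times> nat) mpol" where
  "coord_row k j = (if k = 0 then (if j = 0 then 1 else 0) else single (single (k, j) 1) 1)"

definition minor :: "nat set \<Rightarrow> (nat \<times> nat) mpol" where
  "minor S = det (mat (Suc n) (Suc n) (\<lambda>(r, j). coord_row (sorted_list_of_set S ! r) j))"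

definition label_sets :: "nat set set" where
  "label_sets = {S. S \<subseteq> {0..n * s} \<and> card S = Suc n}"

lemma label_set_finite: "S \<in> label_sets \<Longrightarrow> finite S"
  by (auto simp: label_sets_def intro: finite_subset)

lemma label_set_nth:
  assumes "S \<in> label_sets"
  shows "(\<lambda>r. sorted_list_of_set S ! r) ` {..<Suc n} = S"
proof -
  have "length (sorted_list_of_set S) = Suc n" using assms by (simp add: label_sets_def)
  moreover have "set (sorted_list_of_set S) = S" using label_set_finite[OF assms] by simp
  ultimately show ?thesis by (metis set_conv_nth image_Collect lessThan_def setcompr_eq_image)
qed

lemma coord_row_multiforms:
  assumes "j \<le> n" "k \<le> n * s"
  shows "coord_row k j \<in> multiforms {1..n * s} {..n} (\<lambda>k'. if k' = k then 1 else 0)"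
proof (cases "k = 0")
  case True
  thus ?thesis by (auto simp: coord_row_def multiforms_def)
next
  case False
  have "(\<Sum>i\<le>n. lookup (single (k, j) (1::nat)) (k', i)) = (if k' = k then 1 else 0)" for k'
  proof -
    have "(\<Sum>i\<le>n. lookup (single (k, j) (1::nat)) (k', i))
      = (\<Sum>i\<le>n. if i = j then (if k' = k then 1 else 0) else 0)"
      by (intro sum.cong) (auto simp: lookup_single when_def)
    thus ?thesis using assms by simp
  qed
  thus ?thesis using False assms by (auto simp: coord_row_def multiforms_def)
qed

text \<open>Each term of the Leibniz expansion takes one entry from every row, so all terms have the
  same multidegree; the row of label 0 is constant and contributes nothing.\<close>

lemma minor_multiforms:
  assumes "S \<in> label_sets"
  shows "\<exists>e. minor S \<in> multiforms {1..n * s} {..n} e"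
proof -
  let ?l = "\<lambda>r. sorted_list_of_set S ! r"
  have l: "?l r \<le> n * s" if "r < Suc n" for r
  proof -
    have "?l r \<in> S" using label_set_nth[OF assms] that by blast
    thus ?thesis using assms by (auto simp: label_sets_def)
  qed
  define e where "e = (\<lambda>k. \<Sum>r\<in>{0..<Suc n}. if k = ?l r then 1 else (0::nat))"
  have prod: "(\<Prod>r\<in>{0..<Suc n}. coord_row (?l r) (p r)) \<in> multiforms {1..n * s} {..n} e"
    if "p permutes {0..<Suc n}" for p
    unfolding e_def
  proof (rule multiforms_prod)
    fix r assume r: "r \<in> {0..<Suc n}"
    hence "p r \<in> {0..<Suc n}" using permutes_in_image[OF that] by simp
    thus "coord_row (?l r) (p r) \<in> multiforms {1..n * s} {..n} (\<lambda>k. if k = ?l r then 1 else 0)"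
      using r l by (intro coord_row_multiforms) auto
  qed simp
  have "minor S = (\<Sum>p\<in>{p. p permutes {0..<Suc n}}. signof p * (\<Prod>r\<in>{0..<Suc n}. coord_row (?l r) (p r)))"
    unfolding minor_def
    by (subst det_def') (auto intro!: sum.cong prod.cong dest: permutes_in_image)
  also have "\<dots> \<in> multiforms {1..n * s} {..n} e"
  proof (rule multiforms_sum)
    fix p assume "p \<in> {p. p permutes {0..<Suc n}}"
    thus "signof p * (\<Prod>r\<in>{0..<Suc n}. coord_row (?l r) (p r)) \<in> multiforms {1..n * s} {..n} e"
      using prod[of p] multiforms_uminus[OF prod[of p]] by (auto simp: sign_def)
  qed
  finally show ?thesis by blast
qed

definition rows :: "(nat \<Rightarrow> nat \<Rightarrow> complex) \<Rightarrow> nat \<Rightarrow> nat \<Rightarrow> complex" where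
  "rows v k j = (if k = 0 then (if j = 0 then 1 else 0) else v k j)"

lemma mp_eval_minor_eq_0_iff:
  assumes "S \<in> label_sets"
  shows "mp_eval (\<lambda>(k, i). v k i) (minor S) = 0 \<longleftrightarrow> (\<exists>a. (\<exists>j\<le>n. a j \<noteq> 0) \<and> (\<forall>k\<in>S. dot a (rows v k) = 0))"
proof -
  interpret h: comm_ring_hom "mp_eval (\<lambda>(k, i). v k i)" by (rule comm_ring_hom_mp_eval)
  let ?l = "\<lambda>r. sorted_list_of_set S ! r"
  define A where "A = mat (Suc n) (Suc n) (\<lambda>(r, j). rows v (?l r) j)"
  have A: "A \<in> carrier_mat (Suc n) (Suc n)" by (simp add: A_def)
  have ev: "mp_eval (\<lambda>(k, i). v k i) (minor S) = det A"
    unfolding minor_def h.hom_det[symmetric] A_def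
    by (intro arg_cong[where f = det] eq_matI) (auto simp: coord_row_def rows_def)
  have mv: "A *\<^sub>v w = 0\<^sub>v (Suc n) \<longleftrightarrow> (\<forall>k\<in>S. dot (\<lambda>j. w $ j) (rows v k) = 0)" if "w \<in> carrier_vec (Suc n)" for w
  proof -
    have "(A *\<^sub>v w) $ r = dot (\<lambda>j. w $ j) (rows v (?l r))" if "r < Suc n" for r
      using that \<open>w \<in> carrier_vec (Suc n)\<close>
      by (auto simp: A_def scalar_prod_def dot_def atLeast0LessThan lessThan_Suc_atMost mult.commute intro!: sum.cong)
    hence "A *\<^sub>v w = 0\<^sub>v (Suc n) \<longleftrightarrow> (\<forall>r<Suc n. dot (\<lambda>j. w $ j) (rows v (?l r)) = 0)"
      using A by (auto simp: vec_eq_iff)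
    also have "\<dots> \<longleftrightarrow> (\<forall>k\<in>(\<lambda>r. ?l r) ` {..<Suc n}. dot (\<lambda>j. w $ j) (rows v k) = 0)" by auto
    finally show ?thesis unfolding label_set_nth[OF assms] .
  qed
  have "(\<exists>w\<in>carrier_vec (Suc n). w \<noteq> 0\<^sub>v (Suc n) \<and> A *\<^sub>v w = 0\<^sub>v (Suc n))
      \<longleftrightarrow> (\<exists>a. (\<exists>j\<le>n. a j \<noteq> 0) \<and> (\<forall>k\<in>S. dot a (rows v k) = 0))"
  proof
    assume "\<exists>w\<in>carrier_vec (Suc n). w \<noteq> 0\<^sub>v (Suc n) \<and> A *\<^sub>v w = 0\<^sub>v (Suc n)"
    then obtain w where w: "w \<in> carrier_vec (Suc n)" "w \<noteq> 0\<^sub>v (Suc n)" "A *\<^sub>v w = 0\<^sub>v (Suc n)" by blast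
    have "\<exists>j\<le>n. w $ j \<noteq> 0"
    proof (rule ccontr)
      assume "\<not> ?thesis"
      hence "w = 0\<^sub>v (Suc n)" using w(1) by (intro eq_vecI) auto
      thus False using w by simp
    qed
    thus "\<exists>a. (\<exists>j\<le>n. a j \<noteq> 0) \<and> (\<forall>k\<in>S. dot a (rows v k) = 0)" using mv[OF w(1)] w(3) by blast
  next
    assume "\<exists>a. (\<exists>j\<le>n. a j \<noteq> 0) \<and> (\<forall>k\<in>S. dot a (rows v k) = 0)"
    then obtain a j where a: "j \<le> n" "a j \<noteq> 0" "\<forall>k\<in>S. dot a (rows v k) = 0" by blast
    define w where "w = vec (Suc n) a"
    have w: "w \<in> carrier_vec (Suc n)" by (simp add: w_def)
    have "dot (\<lambda>j. w $ j) x = dot a x" for x by (simp add: dot_def w_def)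
    hence "A *\<^sub>v w = 0\<^sub>v (Suc n)" using mv[OF w] a by simp
    moreover have "w \<noteq> 0\<^sub>v (Suc n)"
    proof
      assume "w = 0\<^sub>v (Suc n)"
      hence "w $ j = 0" using a by simp
      thus False using a by (simp add: w_def)
    qed
    ultimately show "\<exists>w\<in>carrier_vec (Suc n). w \<noteq> 0\<^sub>v (Suc n) \<and> A *\<^sub>v w = 0\<^sub>v (Suc n)" using w by blast
  qed
  thus ?thesis unfolding ev det_0_iff_vec_prod_zero[OF A] by blast
qed

text \<open>A nonzero polynomial of degree at most \<open>n\<close> has at most \<open>n\<close>
  roots. Thus points of the curve are in general position, and the open set of point tuples is
  nonempty.\<close>

lemma mpt_vanish:
  assumes "finite S" "card S = Suc n" "\<And>k. k \<in> S \<Longrightarrow> dot a (mpt k) = 0" "j \<le> n"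
  shows "a j = 0"
proof -
  define p where "p = (\<Sum>j\<le>n. Polynomial.monom (a j) j)"
  have cf: "coeff p i = (if i \<le> n then a i else 0)" for i by (simp add: p_def coeff_sum)
  have deg: "Polynomial.degree p \<le> n" by (rule degree_le) (simp add: cf)
  have "dot a x = dot (coeff p) x" for x by (simp add: dot_def cf)
  hence roots: "of_nat ` S \<subseteq> {x. poly p x = 0}" using assms(3) dot_coeff[OF deg] by auto
  have "p = 0"
  proof (rule ccontr)
    assume "p \<noteq> 0"
    have "Suc n = card ((of_nat :: nat \<Rightarrow> complex) ` S)" using assms by (simp add: card_image inj_on_def)
    also have "\<dots> \<le> card {x. poly p x = 0}" by (rule card_mono[OF poly_roots_finite[OF \<open>p \<noteq> 0\<close>] roots])
    also have "\<dots> \<le> Polynomial.degree p" by (rule card_poly_roots_bound) fact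
    finally show False using deg by simp
  qed
  thus ?thesis using cf[of j] assms(4) by simp
qed

definition gen_pos :: "(nat \<times> nat) mpol" where
  "gen_pos = (\<Prod>S\<in>label_sets. minor S)"

lemma gen_pos_nonzero_iff:
  "mp_eval (\<lambda>(k, i). v k i) gen_pos \<noteq> 0 \<longleftrightarrow>
    (\<forall>S\<in>label_sets. \<forall>a. (\<forall>k\<in>S. dot a (rows v k) = 0) \<longrightarrow> (\<forall>j\<le>n. a j = 0))"
proof -
  have "finite label_sets" unfolding label_sets_def by (rule finite_subset[of _ "Pow {0..n * s}"]) auto
  hence "mp_eval (\<lambda>(k, i). v k i) gen_pos \<noteq> 0 \<longleftrightarrow> (\<forall>S\<in>label_sets. mp_eval (\<lambda>(k, i). v k i) (minor S) \<noteq> 0)"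
    by (simp add: gen_pos_def mp_eval_prod)
  also have "\<dots> \<longleftrightarrow> (\<forall>S\<in>label_sets. \<not> (\<exists>a. (\<exists>j\<le>n. a j \<noteq> 0) \<and> (\<forall>k\<in>S. dot a (rows v k) = 0)))"
    by (intro ball_cong refl) (simp only: mp_eval_minor_eq_0_iff)
  also have "\<dots> \<longleftrightarrow> (\<forall>S\<in>label_sets. \<forall>a. (\<forall>k\<in>S. dot a (rows v k) = 0) \<longrightarrow> (\<forall>j\<le>n. a j = 0))"
    by blast
  finally show ?thesis .
qed

lemma zero_locus_lin: "z \<in> zero_locus n (lin a) \<longleftrightarrow> z \<in> proj_space {..n} \<and> (\<forall>v\<in>z. dot a (lookup v) = 0)"
  by (simp add: zero_locus_def vanishes_at_def)

lemma lin_eq_0_iff: "lin a = 0 \<longleftrightarrow> (\<forall>j\<le>n. a j = 0)"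
proof
  assume 0: "lin a = 0"
  show "\<forall>j\<le>n. a j = 0"
  proof (intro allI impI)
    fix j assume "j \<le> n"
    have "dot a (\<lambda>i. if i = j then 1 else 0) = 0" using mp_eval_lin[of "\<lambda>i. if i = j then 1 else 0" a] 0 by simp
    thus "a j = 0" using \<open>j \<le> n\<close> by (simp add: dot_def if_distrib[of "\<lambda>x. _ * x"] cong: if_cong)
  qed
qed (simp add: lin_def)

lemma hyperplanes_eq: "hyperplanes n = {zero_locus n (lin a) | a. \<exists>j\<le>n. a j \<noteq> 0}"
proof (intro equalityI subsetI)
  fix H assume "H \<in> hyperplanes n"
  then obtain l where l: "H = zero_locus n l" "l \<in> forms {..n} 1" "l \<noteq> 0" by (auto simp: hyperplanes_def)
  thus "H \<in> {zero_locus n (lin a) | a. \<exists>j\<le>n. a j \<noteq> 0}"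
    using form_eq_lin[OF l(2)] lin_eq_0_iff by (metis (mono_tags, lifting) mem_Collect_eq)
qed (use lin_in_forms lin_eq_0_iff in \<open>auto simp: hyperplanes_def\<close>)

lemma mem_proj_space_zero_locus:
  assumes "z \<in> proj_space {..n}" "v \<in> z"
  shows "z \<in> zero_locus n (lin a) \<longleftrightarrow> dot a (lookup v) = 0"
proof -
  obtain w where w: "z = proj_pt w" using assms(1) by (auto simp: proj_space_def)
  obtain c where c: "c \<noteq> 0" "v = scale_pm c w" using assms(2) w by (auto simp: proj_pt_def)
  have sc: "dot a (lookup (scale_pm c' w)) = c' * dot a (lookup w)" for c'
    by (simp add: lookup_scale_pm[abs_def] dot_scale_right)
  show ?thesis
    unfolding zero_locus_lin using assms(1) c by (auto simp: w proj_pt_def sc)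
qed

lemma card_hyperplane_tuples:
  assumes p: "p \<in> multiproj_space {1..n * s} {..n}" and v: "\<And>k. k \<in> {1..n * s} \<Longrightarrow> v k \<in> p k"
    and gp: "mp_eval (\<lambda>(k, i). lookup (v k) i) gen_pos \<noteq> 0"
  shows "finite (hyperplane_tuples_through n s (p ` {1..n * s}))
    \<and> card (hyperplane_tuples_through n s (p ` {1..n * s})) = num_blocks"
proof -
  define K where "K = {1..n * s}"
  define y where "y = rows (\<lambda>k. lookup (v k))"
  have GP: "a j = 0" if "S \<subseteq> {0..n * s}" "card S = Suc n" "\<And>k. k \<in> S \<Longrightarrow> dot a (y k) = 0" "j \<le> n" for S a j
    using gp that unfolding gen_pos_nonzero_iff y_def by (auto simp: label_sets_def)
  have GP': "card B \<le> n" if "B \<subseteq> {0..n * s}" "\<And>k. k \<in> B \<Longrightarrow> dot a (y k) = 0" "\<exists>j\<le>n. a j \<noteq> 0" for B a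
  proof (rule ccontr)
    assume "\<not> card B \<le> n"
    then obtain S where "S \<subseteq> B" "card S = Suc n" by (metis not_less_eq_eq obtain_subset_with_card_n)
    thus False using GP[of S a] that by blast
  qed
  have cards: "card {k \<in> K. dot a (y k) = 0} \<le> n" if "\<exists>j\<le>n. a j \<noteq> 0" for a
  proof (rule GP'[OF _ _ that])
    show "{k \<in> K. dot a (y k) = 0} \<subseteq> {0..n * s}" by (auto simp: K_def)
  qed simp
  define inc where "inc H = {k \<in> K. p k \<in> H}" for H
  have mem: "p k \<in> zero_locus n (lin a) \<longleftrightarrow> dot a (y k) = 0" if "k \<in> K" for k a
  proof -
    have "p k \<in> proj_space {..n}" using p that by (auto simp: multiproj_space_def K_def)
    thus ?thesis using mem_proj_space_zero_locus[OF _ v] that by (simp add: K_def y_def rows_def[abs_def])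
  qed
  have inc: "inc (zero_locus n (lin a)) = {k \<in> K. dot a (y k) = 0}" for a
    by (auto simp: inc_def mem)
  have "bij_betw (\<lambda>M. inc ` set_mset M)
    {M. size M = s \<and> set_mset M \<subseteq> hyperplanes n \<and> K \<subseteq> \<Union>(inc ` set_mset M)} (block_partitions n K)"
  proof (rule covering_tuples_bij[OF n])
    fix H assume "H \<in> hyperplanes n"
    then obtain a where a: "H = zero_locus n (lin a)" "\<exists>j\<le>n. a j \<noteq> 0" by (auto simp: hyperplanes_eq)
    show "inc H \<subseteq> K \<and> card (inc H) \<le> n"
      unfolding a(1) inc using cards[OF a(2)] by blast
  next
    fix B assume B: "B \<subseteq> K" "card B = n"
    have finB: "finite B" using B(1) by (rule finite_subset) (simp add: K_def)
    obtain a where a: "\<exists>j\<in>{..n}. a j \<noteq> 0" "\<forall>k\<in>B. (\<Sum>j\<le>n. a j * y k j) = 0"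
      using homogeneous_system_nontrivial_solution[of "{..n}" B "\<lambda>j k. y k j"] finB B by auto
    have "card {k \<in> K. dot a (y k) = 0} \<le> n"
      by (rule cards) (use a(1) in blast)
    moreover have "B \<subseteq> {k \<in> K. dot a (y k) = 0}" using B a(2) by (auto simp: dot_def)
    ultimately have "inc (zero_locus n (lin a)) = B"
      unfolding inc using B card_seteq[of "{k \<in> K. dot a (y k) = 0}" B] by (simp add: K_def)
    thus "\<exists>H\<in>hyperplanes n. inc H = B" using a(1) by (auto simp: hyperplanes_eq)
  next
    fix H H' assume H: "H \<in> hyperplanes n" "H' \<in> hyperplanes n" "inc H = inc H'" "card (inc H) = n"
    obtain a where a: "H = zero_locus n (lin a)" "\<exists>j\<le>n. a j \<noteq> 0" using H(1) by (auto simp: hyperplanes_eq)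
    obtain b where b: "H' = zero_locus n (lin b)" "\<exists>j\<le>n. b j \<noteq> 0" using H(2) by (auto simp: hyperplanes_eq)
    define B where "B = inc H"
    have B: "B \<subseteq> K" "finite B" "card B = n" "\<And>k. k \<in> B \<Longrightarrow> dot a (y k) = 0 \<and> dot b (y k) = 0"
      using H inc[of a] inc[of b] by (auto simp: B_def a(1) b(1) K_def)
    have "0 \<notin> B" using B(1) by (auto simp: K_def)
    hence B0: "insert 0 B \<subseteq> {0..n * s}" "card (insert 0 B) = Suc n"
      using B(1-3) by (auto simp: K_def subset_iff)
    \<comment> \<open>A linear form has the value \<open>c 0\<close> at label 0, so if
      \<open>c 0\<close> were 0 it would vanish at \<open>n + 1\<close> labels and hence be
      zero.\<close>
    have nz: "c 0 \<noteq> 0" if "\<And>k. k \<in> B \<Longrightarrow> dot c (y k) = 0" "\<exists>j\<le>n. c j \<noteq> 0" for c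
    proof
      assume "c 0 = 0"
      hence "dot c (y 0) = 0" by (auto simp: dot_def y_def rows_def intro!: sum.neutral)
      thus False using GP[OF B0, of c] that by blast
    qed
    \<comment> \<open>This combination vanishes at the \<open>n\<close> common points and also at
      label 0, hence identically, so \<open>a\<close> and \<open>b\<close> are proportional.\<close>
    have "b 0 * a j + (- a 0) * b j = 0" if "j \<le> n" for j
    proof (rule GP[OF B0 _ that, of "\<lambda>j. b 0 * a j + (- a 0) * b j"])
      fix k assume "k \<in> insert 0 B"
      moreover have "dot c (y 0) = c 0" for c
        by (simp add: dot_def y_def rows_def if_distrib[of "\<lambda>x. _ * x"] cong: if_cong)
      ultimately show "dot (\<lambda>j. b 0 * a j + (- a 0) * b j) (y k) = 0"
        using B(4) unfolding dot_add dot_scale by auto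
    qed
    hence ab: "b j = (b 0 / a 0) * a j" if "j \<le> n" for j
      using that nz[of a] B(4) a(2) by (auto simp: field_simps)
    have "lin b = scale_pm (b 0 / a 0) (lin a)"
      unfolding lin_scale[symmetric] unfolding lin_def by (intro sum.cong refl) (metis ab atMost_iff)
    moreover have "b 0 / a 0 \<noteq> 0" using nz[of a] nz[of b] B(4) a(2) b(2) by auto
    ultimately show "H = H'" by (auto simp: a(1) b(1) zero_locus_def vanishes_at_def simp del: mp_eval_lin)
  qed (auto simp: K_def)
  moreover have "{M. size M = s \<and> set_mset M \<subseteq> hyperplanes n \<and> K \<subseteq> \<Union>(inc ` set_mset M)}
      = hyperplane_tuples_through n s (p ` {1..n * s})"
    by (fastforce simp: hyperplane_tuples_through_def inc_def K_def)
  ultimately have bij: "bij_betw (\<lambda>M. inc ` set_mset M) (hyperplane_tuples_through n s (p ` {1..n * s})) (block_partitions n K)"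
    by simp
  have "finite (block_partitions n K)" by (simp add: finite_block_partitions K_def)
  thus ?thesis
    using bij_betw_finite[OF bij] bij_betw_same_card[OF bij] card_block_partitions_num by (simp add: K_def)
qed

lemma generic_points:
  "\<exists>W. multiproj_open {1..n * s} {..n} W \<and> W \<noteq> {} \<and>
     (\<forall>p\<in>W. finite (hyperplane_tuples_through n s (p ` {1..n * s}))
       \<and> card (hyperplane_tuples_through n s (p ` {1..n * s})) = num_blocks)"
proof -
  let ?K = "{1..n * s}"
  define ev where "ev v = mp_eval (\<lambda>(k, i). lookup (v k) i) gen_pos" for v :: "nat \<Rightarrow> nat \<Rightarrow>\<^sub>0 complex"
  define C where "C = {z \<in> multiproj_space ?K {..n}. \<forall>q\<in>{gen_pos}. \<forall>v. (\<forall>k\<in>?K. v k \<in> z k) \<longrightarrow>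
                 mp_eval (\<lambda>(k, i). lookup (v k) i) q = 0}"
  define W where "W = multiproj_space ?K {..n} - C"
  have "\<forall>S\<in>label_sets. \<exists>e. minor S \<in> multiforms ?K {..n} e" using minor_multiforms by blast
  then obtain e where "\<And>S. S \<in> label_sets \<Longrightarrow> minor S \<in> multiforms ?K {..n} (e S)" by metis
  hence "gen_pos \<in> multiforms ?K {..n} (\<lambda>k. \<Sum>S\<in>label_sets. e S k)"
    unfolding gen_pos_def by (intro multiforms_prod) auto
  hence "multiproj_closed ?K {..n} C"
    unfolding multiproj_closed_def C_def by (intro exI[of _ "{gen_pos}"]) auto
  hence "multiproj_open ?K {..n} W" unfolding multiproj_open_def W_def by blast
  moreover have "W \<noteq> {}"
  proof -
    define v where "v k = (\<Sum>j\<le>n. single j (mpt k j))" for k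
    have lv: "lookup (v k) j = (if j \<le> n then mpt k j else 0)" for k j
      by (simp add: v_def lookup_sum_single)
    define z where "z = (\<lambda>k\<in>?K. proj_pt (v k))"
    have "v k \<noteq> 0" for k
    proof
      assume "v k = 0"
      hence "lookup (v k) 0 = 0" by simp
      thus False unfolding lv by (simp add: mpt_def)
    qed
    moreover have "v k \<in> coord_space {..n}" for k by (rule coord_spaceI) (simp add: lv)
    ultimately have "z \<in> multiproj_space ?K {..n}"
      by (auto simp: z_def multiproj_space_def proj_space_def)
    moreover have "mp_eval (\<lambda>(k, i). lookup (v k) i) gen_pos \<noteq> 0"
      unfolding gen_pos_nonzero_iff
    proof (intro ballI allI impI)
      fix S a j assume S: "S \<in> label_sets" and 0: "\<forall>k\<in>S. dot a (rows (\<lambda>k. lookup (v k)) k) = 0" and "j \<le> n"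
      \<comment> \<open>The auxiliary point of label 0 is \<open>mpt 0\<close>, so all labels lie on
        the curve.\<close>
      have eq: "dot a (rows (\<lambda>k. lookup (v k)) k) = dot a (mpt k)" for k
        by (auto simp: dot_def rows_def lv mpt_def intro!: sum.cong)
      show "a j = 0"
      proof (rule mpt_vanish[OF label_set_finite[OF S] _ _ \<open>j \<le> n\<close>])
        show "card S = Suc n" using S by (simp add: label_sets_def)
        fix k assume "k \<in> S"
        with 0 have "dot a (rows (\<lambda>k. lookup (v k)) k) = 0" by (rule bspec)
        thus "dot a (mpt k) = 0" unfolding eq .
      qed
    qed
    moreover have "v k \<in> z k" if "k \<in> ?K" for k using that mem_proj_pt by (simp add: z_def)
    ultimately have "z \<in> W" unfolding W_def C_def by blast
    thus ?thesis by blast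
  qed
  moreover have "finite (hyperplane_tuples_through n s (p ` ?K)) \<and> card (hyperplane_tuples_through n s (p ` ?K)) = num_blocks"
    if "p \<in> W" for p
  proof -
    obtain v where "\<forall>k\<in>?K. v k \<in> p k" "mp_eval (\<lambda>(k, i). lookup (v k) i) gen_pos \<noteq> 0"
      using \<open>p \<in> W\<close> unfolding W_def C_def by blast
    thus ?thesis using \<open>p \<in> W\<close> by (intro card_hyperplane_tuples[of p v]) (auto simp: W_def)
  qed
  ultimately show ?thesis by blast
qed

section \<open>Algebraic dependence on the coordinate functions\<close>

lemma mp_eval_on_line:
  assumes "\<And>m. m \<in> keys p \<Longrightarrow> m \<in> monomials I d"
  shows "\<exists>q. Polynomial.degree q \<le> d \<and> (\<forall>t. mp_eval (\<lambda>i. x i + t * y i) p = poly q t)"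
proof -
  define mq where "mq m = (\<Prod>i\<in>keys m. [:x i, y i:] ^ lookup m i)" for m
  have mq: "poly (mq m) t = mono_eval (\<lambda>i. x i + t * y i) m" for m t
    by (simp add: mq_def mono_eval_def poly_prod)
  have deg: "Polynomial.degree (mq m) \<le> d" if "m \<in> monomials I d" for m
  proof -
    have "Polynomial.degree (mq m) \<le> (\<Sum>i\<in>keys m. Polynomial.degree ([:x i, y i:] ^ lookup m i))"
      unfolding mq_def by (rule order_trans[OF degree_prod_sum_le]) (simp_all add: o_def)
    also have "\<dots> \<le> (\<Sum>i\<in>keys m. lookup m i)"
      by (intro sum_mono order_trans[OF degree_power_le]) simp
    also have "\<dots> = d" using that by (simp add: monomials_def)
    finally show ?thesis .
  qed
  define q where "q = (\<Sum>m\<in>keys p. Polynomial.smult (lookup p m) (mq m))"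
  have "Polynomial.degree q \<le> d" unfolding q_def
    by (intro degree_sum_le order_trans[OF degree_smult_le]) (use deg assms in auto)
  moreover have "mp_eval (\<lambda>i. x i + t * y i) p = poly q t" for t
    by (simp add: q_def mp_eval_alt poly_sum mq)
  ultimately show ?thesis by blast
qed

lemma multihom_on_line:
  assumes "multihom d f"
  shows "\<exists>q. \<forall>t. f (\<lambda>i j. L i j + t * M i j) = poly q t"
proof -
  obtain c where c: "\<And>L. f L = (\<Sum>T\<in>multidegs d. c T * multimono T L)" using assms by (auto simp: multihom_def)
  define q where "q = (\<Sum>T\<in>multidegs d. Polynomial.smult (c T) (\<Prod>i\<in>{1..s}. \<Prod>j\<in>keys (T i). [:L i j, M i j:] ^ lookup (T i) j))"
  have "f (\<lambda>i j. L i j + t * M i j) = poly q t" for t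
    by (simp add: c q_def poly_sum poly_prod multimono_def mono_eval_def)
  thus ?thesis by blast
qed

text \<open>There are no zero divisors: on the line joining a point where \<open>f\<close> is
  nonzero to one where \<open>g\<close> is nonzero, both restrict to nonzero polynomials in one
  variable.\<close>

lemma multihom_mult_eq_0:
  assumes "multihom d f" "multihom e g" "\<And>L. f L * g L = 0" "g L0 \<noteq> 0"
  shows "f L = 0"
proof (rule ccontr)
  assume f: "f L \<noteq> 0"
  define M where "M i j = L0 i j - L i j" for i j
  obtain p q where p: "\<And>t. f (\<lambda>i j. L i j + t * M i j) = poly p t"
    and q: "\<And>t. g (\<lambda>i j. L i j + t * M i j) = poly q t"
    using multihom_on_line[OF assms(1)] multihom_on_line[OF assms(2)] by metis
  have "\<forall>t. poly (p * q) t = 0" using assms(3) by (simp flip: p q)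
  hence "p * q = 0" by (simp only: poly_all_0_iff_0)
  moreover have "poly p 0 \<noteq> 0" using f by (simp flip: p)
  moreover have "poly q 1 \<noteq> 0" using assms(4) by (simp add: M_def flip: q)
  ultimately show False by auto
qed

lemma common_nonzero_multihom:
  assumes "finite A" "\<And>a. a \<in> A \<Longrightarrow> multihom (e a) (f a)" "\<And>a. a \<in> A \<Longrightarrow> \<exists>L. f a L \<noteq> 0"
  shows "\<exists>L. \<forall>a\<in>A. f a L \<noteq> 0"
proof (rule ccontr)
  assume neg: "\<not> ?thesis"
  have "\<exists>L. (\<Prod>a\<in>A. f a L) \<noteq> 0"
    using assms
  proof (induction A rule: finite_induct)
    case (insert a A)
    then obtain L where L: "(\<Prod>a\<in>A. f a L) \<noteq> 0" by auto
    show ?case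
    proof (rule ccontr)
      assume "\<not> ?thesis"
      hence "f a L * (\<Prod>a\<in>A. f a L) = 0" for L using insert.hyps by simp
      hence "f a L = 0" for L
        using multihom_mult_eq_0[of "e a" "f a" "sum e A" "\<lambda>L. \<Prod>a\<in>A. f a L"] multihom_prod[of A e f] insert.prems L
        by blast
      thus False using insert.prems by blast
    qed
  qed simp
  thus False using neg assms(1) by (auto simp: prod_zero_iff)
qed

text \<open>The case of a single partition in \<open>independent_over_coordinates\<close>; a
  partition exists because \<open>num_blocks\<close> is positive.\<close>

lemma coordinates_independent:
  assumes "Q \<in> forms {0..n * s} D" "\<And>L. mp_eval (\<lambda>k. zc k L) Q = 0"
  shows "Q = 0"
proof -
  have "block_partitions n {1..n * s} \<noteq> {}"
    using card_block_partitions_num num_blocks_pos by (metis card.empty less_numeral_extra(3))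
  then obtain P where P: "P \<in> block_partitions n {1..n * s}" by blast
  obtain b and h :: "nat set set \<Rightarrow> (nat \<Rightarrow>\<^sub>0 nat) mpol" and c
  where b: "\<And>P. P \<in> block_partitions n {1..n * s} \<Longrightarrow> is_blocks (b P)"
    and h: "\<And>P. P \<in> block_partitions n {1..n * s} \<Longrightarrow> h P \<in> forms idx c"
    and h0: "\<And>P P'. P \<in> block_partitions n {1..n * s} \<Longrightarrow> P' \<in> block_partitions n {1..n * s} \<Longrightarrow>
           pull (h P) (block_lin (b P')) = 0 \<longleftrightarrow> P \<noteq> P'"
    using separating_forms by blast
  show ?thesis
    by (rule independent_over_coordinates[where X = "{P}" and b = b and H = "\<lambda>P. pull (h P)" and Q = "\<lambda>_. Q" and c = c and x = P])
       (use P b h0 multihom_pull[OF h] assms in auto)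
qed

text \<open>Substitutes the evaluations at the points \<open>mpt k\<close> for the variables of
  \<open>Q\<close>. This is how polynomials in the coordinates become forms on the ambient
  space.\<close>

definition zform :: "nat mpol \<Rightarrow> (nat \<Rightarrow>\<^sub>0 nat) mpol" where
  "zform Q = (\<Sum>m\<in>keys Q. scale_pm (lookup Q m) (zmono m))"

lemma zform_in_forms: "Q \<in> forms J d \<Longrightarrow> zform Q \<in> forms idx d"
  unfolding zform_def by (intro forms_sum forms_scale zmono_in_forms) (rule forms_keys)

lemma mp_eval_zform:
  assumes "v \<in> forms {..n} s"
  shows "mp_eval (lookup v) (zform Q) = mp_eval (\<lambda>k. mp_eval (mpt k) v) Q"
  by (simp add: zform_def mp_eval_sum mp_eval_alt[of _ Q] zmono_def mp_eval_prod mp_eval_power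
      mp_eval_evf[OF assms] mono_eval_def)

lemma pull_zform: "pull (zform Q) L = mp_eval (\<lambda>k. zc k L) Q"
  using mp_eval_zform[OF form_of_in_forms, of L Q] by (simp add: pull_def mp_eval_form_of zc_def)

lemma card_multidegs: "card (multidegs d) = ((n + d) choose n) ^ s"
  unfolding multidegs_def by (simp add: card_PiE card_monomials_atMost)

text \<open>Divided by \<open>D ^ (n * s)\<close>, the left side tends to
  \<open>(1 / fact n) ^ s\<close>, which is at most 1, and the right side to
  \<open>(fact (n * s) + 1) / fact (n * s)\<close>, which exceeds 1. This dictates the
  constant.\<close>

lemma card_multidegs_less:
  "\<exists>D. card (multidegs (D + e)) < (fact (n * s) + 1) * card (monomials {0..n * s} D)"
proof -
  have inf: "filterlim (\<lambda>d::nat. real d) at_top sequentially" by (rule filterlim_real_sequentially)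
  have "(\<lambda>D. (real ((n + e + D - 0) choose n) / real D ^ n) ^ s) \<longlonglongrightarrow> (1 ^ n / fact n) ^ s"
    by (intro tendsto_power binomial_asymptotic inf linear_ratio_tendsto)
  hence l1: "(\<lambda>D. real (card (multidegs (D + e))) / real D ^ (n * s)) \<longlonglongrightarrow> (1 / fact n) ^ s"
    by (simp add: card_multidegs power_divide power_mult add_ac)
  have l2: "(\<lambda>D. real (fact (n * s) + 1) * (real ((n * s + D - 0) choose (n * s)) / real D ^ (n * s)))
     \<longlonglongrightarrow> real (fact (n * s) + 1) * (1 ^ (n * s) / fact (n * s))"
    by (intro tendsto_mult tendsto_const binomial_asymptotic inf linear_ratio_tendsto)
  have cm: "card (monomials {0..n * s} D) = (n * s + D) choose (n * s)" for D
    by (simp only: atLeast0AtMost card_monomials_atMost)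
  have "(1 / fact n :: real) ^ s \<le> 1" by (intro power_le_one) auto
  also have "1 < real (fact (n * s) + 1) * (1 ^ (n * s) / fact (n * s))" by (simp add: field_simps)
  finally have "eventually (\<lambda>D. 0 < real (fact (n * s) + 1) * (real ((n * s + D - 0) choose (n * s)) / real D ^ (n * s))
     - real (card (multidegs (D + e))) / real D ^ (n * s)) sequentially"
    by (intro order_tendstoD(1)[OF tendsto_diff[OF l2 l1]]) simp
  hence "eventually (\<lambda>D. card (multidegs (D + e)) < (fact (n * s) + 1) * card (monomials {0..n * s} D)) sequentially"
    using eventually_gt_at_top[of 0]
  proof eventually_elim
    case (elim D)
    hence "real (card (multidegs (D + e))) < real (fact (n * s) + 1) * real ((n * s + D) choose (n * s))"
      by (simp add: divide_less_cancel del: of_nat_add)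
    thus ?case unfolding cm by (metis of_nat_less_iff of_nat_mult)
  qed
  thus ?thesis by (meson eventually_sequentially order_refl)
qed

text \<open>The degree of \<open>Q b\<close> compensates the power of \<open>g\<close>, so that all
  products of a coordinate monomial with \<open>g L ^ b\<close> have degree
  \<open>D + c * B\<close>. For large \<open>D\<close> they outnumber the multihomogeneous monomials
  of that degree, which forces a linear relation.\<close>

lemma algebraic_over_coordinates:
  assumes g: "multihom c g"
  shows "\<exists>D B Q. (\<forall>b\<le>B. Q b \<in> forms {0..n * s} (D + c * (B - b))) \<and> (\<exists>b\<le>B. Q b \<noteq> 0)
    \<and> (\<forall>L. (\<Sum>b\<le>B. mp_eval (\<lambda>k. zc k L) (Q b) * g L ^ b) = 0)"
proof -
  define B :: nat where "B = fact (n * s)"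
  obtain D where D: "card (multidegs (D + c * B)) < (B + 1) * card (monomials {0..n * s} D)"
    using card_multidegs_less[of "c * B"] by (auto simp: B_def)
  define X where "X = (SIGMA b:{..B}. monomials {0..n * s} (D + c * (B - b)))"
  have finX: "finite X" by (simp add: X_def finite_monomials)
  \<comment> \<open>Multiplying by a power of variable 0 embeds the monomials of degree
    \<open>D\<close> into those of any larger degree, so each exponent \<open>b\<close> contributes
    at least this many products.\<close>
  have "card (monomials {0..n * s} D) \<le> card (monomials {0..n * s} (D + e))" for e
  proof (rule card_inj_on_le)
    show "(\<lambda>m. m + single 0 e) ` monomials {0..n * s} D \<subseteq> monomials {0..n * s} (D + e)"
      by (auto intro!: monomials_add monomials_single)
    show "inj_on (\<lambda>m. m + single 0 e) (monomials {0..n * s} D)" by (auto simp: inj_on_def)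
  qed (simp add: finite_monomials)
  hence "(\<Sum>b\<le>B. card (monomials {0..n * s} D)) \<le> (\<Sum>b\<le>B. card (monomials {0..n * s} (D + c * (B - b))))"
    by (intro sum_mono)
  hence "(B + 1) * card (monomials {0..n * s} D) \<le> card X"
    unfolding X_def by (subst card_SigmaI) (auto simp: finite_monomials)
  hence less: "card (multidegs (D + c * B)) < card X" using D by simp
  have "\<forall>x\<in>X. \<exists>C. \<forall>L. mono_eval (\<lambda>k. zc k L) (snd x) * g L ^ fst x = (\<Sum>T\<in>multidegs (D + c * B). C T * multimono T L)"
  proof
    fix x assume "x \<in> X"
    then obtain b m where x: "x = (b, m)" "b \<le> B" "m \<in> monomials {0..n * s} (D + c * (B - b))" by (auto simp: X_def)
    have "multihom (D + c * (B - b)) (\<lambda>L. mono_eval (\<lambda>k. zc k L) m)"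
      using multihom_pull[OF zmono_in_forms[OF x(3)]] by (simp add: pull_zmono[abs_def])
    hence "multihom (D + c * (B - b) + b * c) (\<lambda>L. mono_eval (\<lambda>k. zc k L) m * g L ^ b)"
      by (intro multihom_mult multihom_power g)
    moreover have "D + c * (B - b) + b * c = D + c * B"
    proof -
      have "B = (B - b) + b" using x(2) by simp
      thus ?thesis by (metis add.assoc distrib_left mult.commute)
    qed
    ultimately show "\<exists>C. \<forall>L. mono_eval (\<lambda>k. zc k L) (snd x) * g L ^ fst x = (\<Sum>T\<in>multidegs (D + c * B). C T * multimono T L)"
      by (simp add: multihom_def x(1))
  qed
  then obtain C where C: "\<And>x L. x \<in> X \<Longrightarrow> mono_eval (\<lambda>k. zc k L) (snd x) * g L ^ fst x = (\<Sum>T\<in>multidegs (D + c * B). C x T * multimono T L)"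
    by metis
  obtain l where l: "\<exists>x\<in>X. l x \<noteq> 0" "\<forall>T\<in>multidegs (D + c * B). (\<Sum>x\<in>X. l x * C x T) = 0"
    using homogeneous_system_nontrivial_solution[OF finX finite_multidegs less, of C] by blast
  define Q where "Q b = (\<Sum>m\<in>monomials {0..n * s} (D + c * (B - b)). single m (l (b, m)))" for b
  have "Q b \<in> forms {0..n * s} (D + c * (B - b))" for b
    unfolding Q_def by (intro forms_sum forms_single)
  moreover have "\<exists>b\<le>B. Q b \<noteq> 0"
  proof -
    obtain b m where bm: "b \<le> B" "m \<in> monomials {0..n * s} (D + c * (B - b))" "l (b, m) \<noteq> 0"
      using l(1) by (auto simp: X_def)
    have "lookup (Q b) m \<noteq> 0"
      using bm by (simp add: Q_def lookup_sum_single finite_monomials)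
    thus ?thesis using bm(1) by (metis lookup_zero)
  qed
  moreover have "(\<Sum>b\<le>B. mp_eval (\<lambda>k. zc k L) (Q b) * g L ^ b) = 0" for L
  proof -
    have "(\<Sum>b\<le>B. mp_eval (\<lambda>k. zc k L) (Q b) * g L ^ b)
        = (\<Sum>b\<le>B. \<Sum>m\<in>monomials {0..n * s} (D + c * (B - b)). l (b, m) * (mono_eval (\<lambda>k. zc k L) m * g L ^ b))"
      by (simp add: Q_def mp_eval_sum sum_distrib_right mult.assoc)
    also have "\<dots> = (\<Sum>x\<in>X. l x * (mono_eval (\<lambda>k. zc k L) (snd x) * g L ^ fst x))"
      unfolding X_def by (subst sum.Sigma) (auto simp: finite_monomials split_def)
    also have "\<dots> = (\<Sum>x\<in>X. \<Sum>T\<in>multidegs (D + c * B). l x * C x T * multimono T L)"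
      by (intro sum.cong refl) (simp add: C sum_distrib_left mult.assoc)
    also have "\<dots> = (\<Sum>T\<in>multidegs (D + c * B). (\<Sum>x\<in>X. l x * C x T) * multimono T L)"
      by (subst sum.swap) (simp add: sum_distrib_right)
    also have "\<dots> = 0" using l(2) by simp
    finally show ?thesis .
  qed
  ultimately show ?thesis by blast
qed

text \<open>The constant term of a primitive relation for \<open>g\<close> is a form on the ambient space which
  detects the zeros of \<open>g\<close>.\<close>

lemma detecting_form:
  assumes g: "multihom c g" and g0: "g L0 \<noteq> 0"
  shows "\<exists>d. \<exists>P\<in>forms idx d. (\<exists>L. pull P L \<noteq> 0) \<and> (\<forall>L. pull P L \<noteq> 0 \<longrightarrow> g L \<noteq> 0)"
proof -
  obtain D B Q where Q: "\<And>b. b \<le> B \<Longrightarrow> Q b \<in> forms {0..n * s} (D + c * (B - b))" "\<exists>b\<le>B. Q b \<noteq> 0"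
    "\<And>L. (\<Sum>b\<le>B. mp_eval (\<lambda>k. zc k L) (Q b) * g L ^ b) = 0"
    using algebraic_over_coordinates[OF g] by blast
  define b0 where "b0 = (LEAST b. b \<le> B \<and> Q b \<noteq> 0)"
  have b0: "b0 \<le> B" "Q b0 \<noteq> 0" using LeastI_ex[of "\<lambda>b. b \<le> B \<and> Q b \<noteq> 0"] Q(2) by (auto simp: b0_def)
  have below: "Q b = 0" if "b < b0" for b
    using not_less_Least[of b "\<lambda>b. b \<le> B \<and> Q b \<noteq> 0"] that b0(1) by (auto simp: b0_def)
  \<comment> \<open>The relation divided by \<open>g ^ b0\<close>. It still holds everywhere, since
    \<open>g\<close> is not identically zero and there are no zero divisors.\<close>
  define R where "R L = (\<Sum>b\<in>{b0..B}. mp_eval (\<lambda>k. zc k L) (Q b) * g L ^ (b - b0))" for L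
  have "multihom (D + c * (B - b0)) (\<lambda>L. mp_eval (\<lambda>k. zc k L) (Q b) * g L ^ (b - b0))" if "b \<in> {b0..B}" for b
  proof -
    have "multihom (D + c * (B - b)) (\<lambda>L. mp_eval (\<lambda>k. zc k L) (Q b))"
      using multihom_pull[OF zform_in_forms[OF Q(1)], of b] that by (simp add: pull_zform[abs_def])
    hence "multihom (D + c * (B - b) + (b - b0) * c) (\<lambda>L. mp_eval (\<lambda>k. zc k L) (Q b) * g L ^ (b - b0))"
      by (intro multihom_mult multihom_power g)
    moreover have "D + c * (B - b) + (b - b0) * c = D + c * (B - b0)"
    proof -
      have "B - b0 = (B - b) + (b - b0)" using that by auto
      thus ?thesis by (simp add: distrib_left mult.commute)
    qed
    ultimately show ?thesis by simp
  qed
  hence R: "multihom (D + c * (B - b0)) R" unfolding R_def[abs_def] by (intro multihom_sum)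
  have "R L * g L ^ b0 = 0" for L
  proof -
    have "R L * g L ^ b0 = (\<Sum>b\<in>{b0..B}. mp_eval (\<lambda>k. zc k L) (Q b) * g L ^ b)"
      unfolding R_def sum_distrib_right by (intro sum.cong refl) (simp add: mult.assoc power_add[symmetric])
    also have "\<dots> = (\<Sum>b\<le>B. mp_eval (\<lambda>k. zc k L) (Q b) * g L ^ b)"
      by (rule sum.mono_neutral_left) (auto simp: below)
    finally show ?thesis using Q(3) by simp
  qed
  hence R0: "R L = 0" for L
    by (rule multihom_mult_eq_0[OF R multihom_power[OF g, of b0], of L0]) (use g0 in simp)
  \<comment> \<open>Where \<open>g\<close> vanishes, only the constant term of the divided relation
    is left.\<close>
  have "mp_eval (\<lambda>k. zc k L) (Q b0) = 0" if "g L = 0" for L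
  proof -
    have "R L = (\<Sum>b\<in>{b0}. mp_eval (\<lambda>k. zc k L) (Q b) * g L ^ (b - b0))"
      unfolding R_def by (rule sum.mono_neutral_right) (use b0 that in auto)
    thus ?thesis using R0 by simp
  qed
  moreover have "\<exists>L. mp_eval (\<lambda>k. zc k L) (Q b0) \<noteq> 0"
    using coordinates_independent[OF Q(1)[OF b0(1)]] b0(2) by blast
  ultimately show ?thesis
    using zform_in_forms[OF Q(1)[OF b0(1)]] by (metis pull_zform)
qed

text \<open>In a relation of least degree in the coefficient, the derivative with respect to that
  coefficient cannot vanish identically, since it would be a shorter relation.\<close>

lemma coefficient_relation:
  defines "e \<equiv> \<lambda>a L. lookup (form_of L) a"
  shows "\<exists>D B Q. (\<forall>b\<le>B. Q b \<in> forms {0..n * s} (D + (B - b)))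
    \<and> (\<forall>L. (\<Sum>b\<le>B. mp_eval (\<lambda>k. zc k L) (Q b) * e a L ^ b) = 0)
    \<and> (\<exists>L. (\<Sum>b\<le>B. of_nat b * (mp_eval (\<lambda>k. zc k L) (Q b) * e a L ^ (b - 1))) \<noteq> 0)"
proof -
  define rel where "rel B \<longleftrightarrow> (\<exists>D Q. (\<forall>b\<le>B. Q b \<in> forms {0..n * s} (D + (B - b))) \<and> (\<exists>b\<le>B. Q b \<noteq> 0)
    \<and> (\<forall>L. (\<Sum>b\<le>B. mp_eval (\<lambda>k. zc k L) (Q b) * e a L ^ b) = 0))" for B
  have "multihom 1 (e a)" unfolding e_def by (rule multihom_coefficient)
  then obtain D B Q where "\<forall>b\<le>B. Q b \<in> forms {0..n * s} (D + 1 * (B - b))" "\<exists>b\<le>B. Q b \<noteq> 0"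
    "\<forall>L. (\<Sum>b\<le>B. mp_eval (\<lambda>k. zc k L) (Q b) * e a L ^ b) = 0"
    using algebraic_over_coordinates by blast
  hence "rel B" unfolding rel_def by (intro exI[of _ D] exI[of _ Q]) simp
  hence ex: "\<exists>B. rel B" by (rule exI)
  define B where "B = (LEAST B. rel B)"
  have B: "rel B" unfolding B_def by (rule LeastI_ex) (rule ex)
  have min: "\<not> rel B'" if "B' < B" for B' using that not_less_Least unfolding B_def by blast
  obtain D Q where Q: "\<And>b. b \<le> B \<Longrightarrow> Q b \<in> forms {0..n * s} (D + (B - b))" "\<exists>b\<le>B. Q b \<noteq> 0"
    "\<And>L. (\<Sum>b\<le>B. mp_eval (\<lambda>k. zc k L) (Q b) * e a L ^ b) = 0"
    using B unfolding rel_def by blast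
  have "B \<noteq> 0"
  proof
    assume "B = 0"
    hence "Q 0 = 0" using Q(3) by (intro coordinates_independent[OF Q(1)[of 0]]) auto
    thus False using Q(2) \<open>B = 0\<close> by simp
  qed
  then obtain B' where B': "B = Suc B'" by (cases B) auto
  have QB: "Q B \<noteq> 0"
  proof
    assume QB: "Q B = 0"
    \<comment> \<open>Dropping the top term leaves a shorter relation. As degrees are measured from
      the top exponent, \<open>D\<close> increases by one.\<close>
    have "rel B'" unfolding rel_def
    proof (rule exI[of _ "Suc D"], rule exI[of _ Q], intro conjI allI impI)
      fix b assume "b \<le> B'"
      thus "Q b \<in> forms {0..n * s} (Suc D + (B' - b))" using Q(1)[of b] by (simp add: B' Suc_diff_le)
    next
      show "\<exists>b\<le>B'. Q b \<noteq> 0" using Q(2) QB unfolding B' by (metis le_Suc_eq)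
      show "(\<Sum>b\<le>B'. mp_eval (\<lambda>k. zc k L) (Q b) * e a L ^ b) = 0" for L
        using Q(3)[of L] QB by (simp add: B')
    qed
    thus False using min[of B'] by (simp add: B')
  qed
  have "\<exists>L. (\<Sum>b\<le>B. of_nat b * (mp_eval (\<lambda>k. zc k L) (Q b) * e a L ^ (b - 1))) \<noteq> 0"
  proof (rule ccontr)
    assume neg: "\<not> ?thesis"
    \<comment> \<open>The shorter relation is the derivative; its top coefficient is
      \<open>B\<close> times \<open>Q B\<close>, which is nonzero in characteristic 0.\<close>
    have "rel B'" unfolding rel_def
    proof (rule exI[of _ D], rule exI[of _ "\<lambda>b. scale_pm (of_nat (Suc b)) (Q (Suc b))"], intro conjI allI impI)
      fix b assume "b \<le> B'"
      thus "scale_pm (of_nat (Suc b)) (Q (Suc b)) \<in> forms {0..n * s} (D + (B' - b))"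
        using Q(1)[of "Suc b"] by (intro forms_scale) (simp add: B')
    next
      show "\<exists>b\<le>B'. scale_pm (of_nat (Suc b)) (Q (Suc b)) \<noteq> 0"
        using QB by (intro exI[of _ B']) (simp add: B' del: of_nat_Suc)
      fix L
      have "(\<Sum>b\<le>B'. mp_eval (\<lambda>k. zc k L) (scale_pm (of_nat (Suc b)) (Q (Suc b))) * e a L ^ b)
         = (\<Sum>b\<le>B. of_nat b * (mp_eval (\<lambda>k. zc k L) (Q b) * e a L ^ (b - 1)))"
        unfolding B' by (subst sum.atMost_Suc_shift) (simp add: mult.assoc)
      thus "(\<Sum>b\<le>B'. mp_eval (\<lambda>k. zc k L) (scale_pm (of_nat (Suc b)) (Q (Suc b))) * e a L ^ b) = 0"
        using neg by simp
    qed
    thus False using min[of B'] by (simp add: B')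
  qed
  thus ?thesis using Q(1,3) by blast
qed

section \<open>The tangent space\<close>

text \<open>The linear space underlying the embedded tangent space, tested at the one representative
  \<open>F\<close>; it includes the vector 0.\<close>

definition tangent :: "nat mpol \<Rightarrow> nat mpol \<Rightarrow> bool" where
  "tangent F w \<longleftrightarrow> w \<in> forms {..n} s \<and> (\<forall>d. \<forall>P\<in>vanishing_forms idx (decomposables n s) d.
     (\<Sum>a\<in>idx. lookup w a * mp_eval (lookup F) (mp_deriv a P)) = 0)"

lemma tangent_subspace: "pm.subspace {w. tangent F w}"
  unfolding pm.subspace_def tangent_def
  by (auto simp: forms_add forms_scale lookup_add ring_distribs sum.distrib mult.assoc simp flip: sum_distrib_left)

lemma directional_derivative:
  assumes "P \<in> forms idx d"
  shows "((\<lambda>t. mp_eval (lookup (v + scale_pm t w)) P) has_field_derivative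
     (\<Sum>a\<in>idx. lookup w a * mp_eval (lookup v) (mp_deriv a P))) (at 0)"
proof -
  have "((\<lambda>t. mp_eval (lookup (v + scale_pm t w)) P) has_field_derivative
     (\<Sum>a\<in>idx. lookup w a * mp_eval (lookup (v + scale_pm 0 w)) (mp_deriv a P))) (at 0)"
  proof (rule mp_eval_has_field_derivative[OF finite_idx])
    show "keys m \<subseteq> idx" if "m \<in> keys P" for m
      using monomials_keys[OF forms_keys[OF assms that]] .
    show "((\<lambda>t. lookup (v + scale_pm t w) a) has_field_derivative lookup w a) (at 0)" for a
      by (auto simp: lookup_add intro!: derivative_eq_intros)
  qed
  moreover have "v + scale_pm 0 w = v" by (rule poly_mapping_eqI) (simp add: lookup_add)
  ultimately show ?thesis by simp
qed

lemma form_of_update_linear: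
  assumes "i \<in> {1..s}"
  shows "form_of (L(i := \<lambda>j. x j + t * y j)) = form_of (L(i := x)) + scale_pm t (form_of (L(i := y)))"
proof -
  define R where "R = (\<Prod>k\<in>{1..s} - {i}. lin (L k))"
  have upd: "form_of (L(i := a)) = lin a * R" for a
    unfolding form_of_def R_def using assms by (subst prod.remove[of _ i]) auto
  have scale: "scale_pm t (p * q) = scale_pm t p * q" for p q :: "nat mpol"
    by (simp add: scale_pm_def mult_map_scale_conv_mult mult.assoc)
  have "lin (\<lambda>j. x j + t * y j) = lin x + lin (\<lambda>j. t * y j)"
    by (simp add: lin_def single_add sum.distrib)
  hence "lin (\<lambda>j. x j + t * y j) = lin x + scale_pm t (lin y)" by (simp only: lin_scale)
  thus ?thesis by (simp add: upd distrib_right scale)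
qed

text \<open>Moving one factor along a line moves the product along a line, on which every form of
  the ideal vanishes; its derivative there is 0.\<close>

lemma tangent_form_of_update:
  assumes "i \<in> {1..s}"
  shows "tangent (form_of L) (form_of (L(i := a)))"
  unfolding tangent_def
proof (intro conjI allI ballI)
  show "form_of (L(i := a)) \<in> forms {..n} s" by (rule form_of_in_forms)
  fix d P assume P: "P \<in> vanishing_forms idx (decomposables n s) d"
  hence Pf: "P \<in> forms idx d" by (simp add: vanishing_forms_iff)
  have "mp_eval (lookup (form_of L + scale_pm t (form_of (L(i := a))))) P = 0" for t
  proof -
    have "form_of L + scale_pm t (form_of (L(i := a))) = form_of (L(i := \<lambda>j. L i j + t * a j))"
      using form_of_update_linear[OF assms, of L "L i" t a] by simp
    thus ?thesis using P by (simp add: vanishing_forms_iff pull_def)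
  qed
  hence "((\<lambda>t. 0) has_field_derivative
     (\<Sum>b\<in>idx. lookup (form_of (L(i := a))) b * mp_eval (lookup (form_of L)) (mp_deriv b P))) (at (0::complex))"
    using directional_derivative[OF Pf, of "form_of L" "form_of (L(i := a))"] by simp
  thus "(\<Sum>b\<in>idx. lookup (form_of (L(i := a))) b * mp_eval (lookup (form_of L)) (mp_deriv b P)) = 0"
    using DERIV_const DERIV_unique by blast
qed

text \<open>Where the derivative of a minimal relation for the coefficient \<open>a\<close> does not vanish, that
  coefficient of a tangent vector is determined by the coordinates of the vector.\<close>

lemma tangent_coefficient_form:
  assumes "a \<in> idx"
  shows "\<exists>d. \<exists>G\<in>forms idx d. (\<exists>L. pull G L \<noteq> 0) \<and> (\<forall>L w. pull G L \<noteq> 0 \<longrightarrow> tangent (form_of L) w \<longrightarrow>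
    (\<forall>k\<in>{0..n * s}. mp_eval (mpt k) w = 0) \<longrightarrow> lookup w a = 0)"
proof -
  obtain D B Q where Q: "\<And>b. b \<le> B \<Longrightarrow> Q b \<in> forms {0..n * s} (D + (B - b))"
    "\<And>L. (\<Sum>b\<le>B. mp_eval (\<lambda>k. zc k L) (Q b) * lookup (form_of L) a ^ b) = 0"
    "\<exists>L. (\<Sum>b\<le>B. of_nat b * (mp_eval (\<lambda>k. zc k L) (Q b) * lookup (form_of L) a ^ (b - 1))) \<noteq> 0"
    using coefficient_relation[of a] by blast
  define Y :: "(nat \<Rightarrow>\<^sub>0 nat) mpol" where "Y = single (single a 1) 1"
  have Y: "Y \<in> forms idx 1" unfolding Y_def by (intro forms_single monomials_single assms)
  define P where "P = (\<Sum>b\<le>B. zform (Q b) * Y ^ b)"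
  \<comment> \<open>The partial derivative of \<open>P\<close> with respect to \<open>Y\<close>. The
    sum starts at 1, so that \<open>b - 1\<close> is not truncated and \<open>G\<close> is
    homogeneous.\<close>
  define G where "G = (\<Sum>b\<in>{1..B}. scale_pm (of_nat b) (zform (Q b) * Y ^ (b - 1)))"
  have "zform (Q b) * Y ^ b \<in> forms idx (D + B)" if "b \<le> B" for b
    using forms_mult[OF zform_in_forms[OF Q(1)[OF that]] forms_power[OF Y, of b]] that by simp
  hence Pf: "P \<in> forms idx (D + B)" unfolding P_def by (intro forms_sum) auto
  have "scale_pm (of_nat b) (zform (Q b) * Y ^ (b - 1)) \<in> forms idx (D + B - 1)" if "b \<in> {1..B}" for b
  proof -
    have "zform (Q b) * Y ^ (b - 1) \<in> forms idx (D + (B - b) + (b - 1) * 1)"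
      using that by (intro forms_mult zform_in_forms[OF Q(1)] forms_power[OF Y]) auto
    moreover have "D + (B - b) + (b - 1) * 1 = D + B - 1" using that by auto
    ultimately show ?thesis by (metis forms_scale)
  qed
  hence Gf: "G \<in> forms idx (D + B - 1)" unfolding G_def by (intro forms_sum)
  have evP: "mp_eval (lookup v) P = (\<Sum>b\<le>B. mp_eval (\<lambda>k. mp_eval (mpt k) v) (Q b) * lookup v a ^ b)"
    if "v \<in> forms {..n} s" for v
    by (simp add: P_def mp_eval_sum mp_eval_mult mp_eval_power mp_eval_zform[OF that] Y_def)
  have pullG: "pull G L = (\<Sum>b\<le>B. of_nat b * (mp_eval (\<lambda>k. zc k L) (Q b) * lookup (form_of L) a ^ (b - 1)))" for L
  proof -
    have "pull Y L = lookup (form_of L) a" by (simp add: pull_def Y_def)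
    hence "pull G L = (\<Sum>b\<in>{1..B}. of_nat b * (mp_eval (\<lambda>k. zc k L) (Q b) * lookup (form_of L) a ^ (b - 1)))"
      by (simp add: G_def pull_sum pull_scale pull_mult pull_power pull_zform)
    also have "\<dots> = (\<Sum>b\<le>B. of_nat b * (mp_eval (\<lambda>k. zc k L) (Q b) * lookup (form_of L) a ^ (b - 1)))"
      by (rule sum.mono_neutral_left) auto
    finally show ?thesis .
  qed
  have zcF: "mp_eval (mpt k) (form_of L) = zc k L" for k L by (simp add: mp_eval_form_of zc_def)
  have Pv: "P \<in> vanishing_forms idx (decomposables n s) (D + B)"
    unfolding vanishing_forms_iff using Pf Q(2) by (simp add: pull_def evP[OF form_of_in_forms] zcF)
  have "lookup w a = 0"
    if G0: "pull G L \<noteq> 0" and w: "tangent (form_of L) w" and z0: "\<forall>k\<in>{0..n * s}. mp_eval (mpt k) w = 0" for L w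
  proof -
    have wf: "w \<in> forms {..n} s" using w by (simp add: tangent_def)
    \<comment> \<open>All coordinates of \<open>w\<close> vanish, so moving along \<open>w\<close>
      changes only the value of \<open>Y\<close>, and the derivative of \<open>P\<close> becomes
      \<open>pull G L * lookup w a\<close>.\<close>
    have ev: "mp_eval (lookup (form_of L + scale_pm t w)) P
       = (\<Sum>b\<le>B. mp_eval (\<lambda>k. zc k L) (Q b) * (lookup (form_of L) a + t * lookup w a) ^ b)" for t
    proof -
      have "mp_eval (\<lambda>k. mp_eval (mpt k) (form_of L + scale_pm t w)) (Q b) = mp_eval (\<lambda>k. zc k L) (Q b)" if "b \<le> B" for b
      proof (rule mp_eval_cong)
        fix m k assume "m \<in> keys (Q b)" "k \<in> keys m"
        hence "k \<in> {0..n * s}" using forms_keys[OF Q(1)[OF that]] monomials_keys by blast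
        thus "mp_eval (mpt k) (form_of L + scale_pm t w) = zc k L" using z0 by (simp add: mp_eval_add zcF)
      qed
      thus ?thesis
        by (subst evP) (auto intro!: forms_add forms_scale form_of_in_forms wf simp: lookup_add)
    qed
    have "((\<lambda>t. mp_eval (lookup (form_of L + scale_pm t w)) P) has_field_derivative 0) (at 0)"
      using directional_derivative[OF Pf, of "form_of L" w] w Pv by (simp add: tangent_def)
    moreover have "((\<lambda>t. mp_eval (lookup (form_of L + scale_pm t w)) P) has_field_derivative
      (\<Sum>b\<le>B. mp_eval (\<lambda>k. zc k L) (Q b) * (of_nat b * (lookup w a * (lookup (form_of L) a + 0 * lookup w a) ^ (b - Suc 0))))) (at 0)"
      unfolding ev
      by (intro DERIV_sum DERIV_cmult DERIV_power) (auto intro!: derivative_eq_intros)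
    ultimately have "(\<Sum>b\<le>B. mp_eval (\<lambda>k. zc k L) (Q b) * (of_nat b * (lookup w a * (lookup (form_of L) a + 0 * lookup w a) ^ (b - Suc 0)))) = 0"
      using DERIV_unique by blast
    also have "(\<Sum>b\<le>B. mp_eval (\<lambda>k. zc k L) (Q b) * (of_nat b * (lookup w a * (lookup (form_of L) a + 0 * lookup w a) ^ (b - Suc 0))))
       = pull G L * lookup w a"
      unfolding pullG sum_distrib_right by (intro sum.cong refl) (simp add: mult_ac)
    finally show ?thesis using G0 by simp
  qed
  moreover have "\<exists>L. pull G L \<noteq> 0" using Q(3) by (simp add: pullG)
  ultimately show ?thesis using Gf by blast
qed

end

section \<open>Divisibility by linear factors on lines\<close>

lemma dvd_prod_of_distinct_roots:
  fixes q :: "complex poly"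
  assumes "finite R" "\<And>r. r \<in> R \<Longrightarrow> poly q r = 0"
  shows "(\<Prod>r\<in>R. [:- r, 1:]) dvd q"
  using assms
proof (induction R arbitrary: q rule: finite_induct)
  case (insert r R)
  have "[:- r, 1:] dvd q" using insert.prems[of r] by (simp add: poly_eq_0_iff_dvd)
  then obtain q' where q': "q = [:- r, 1:] * q'" by (elim dvdE)
  have "poly q' r' = 0" if "r' \<in> R" for r'
  proof -
    have "poly q r' = 0" "r' \<noteq> r" using insert that by auto
    thus ?thesis by (simp add: q')
  qed
  hence "(\<Prod>r\<in>R. [:- r, 1:]) dvd q'" by (rule insert.IH)
  thus ?case unfolding q' prod.insert[OF insert.hyps] by (intro mult_dvd_mono dvd_refl)
qed simp

context split_forms
begin

section \<open>Forms vanishing on the double locus\<close>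

text \<open>On the line from \<open>v\<close> towards a point \<open>u\<close> off all the
  hyperplanes of \<open>N\<close>, the restriction of \<open>P\<close> times the product of these
  functionals is identically zero, and the second factor is a nonzero polynomial.\<close>

lemma vanish_dense:
  assumes V: "\<And>x y t. x \<in> V \<Longrightarrow> y \<in> V \<Longrightarrow> (\<lambda>j. x j + t * y j) \<in> V"
    and N: "finite N" "\<And>a. a \<in> N \<Longrightarrow> \<exists>x\<in>V. dot a x \<noteq> 0"
    and P: "\<And>m. m \<in> keys P \<Longrightarrow> m \<in> monomials {..n} d"
    and gen: "\<And>x. x \<in> V \<Longrightarrow> \<forall>a\<in>N. dot a x \<noteq> 0 \<Longrightarrow> mp_eval x P = 0"
    and v: "v \<in> V"
  shows "mp_eval v P = 0"
proof -
  obtain u where u: "u \<in> V" "\<forall>a\<in>N. dot a u \<noteq> 0"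
    using common_nonzero_point[OF N(1) _ V N(2)] v by blast
  obtain p where p: "\<And>t. mp_eval (\<lambda>j. v j + t * u j) P = poly p t"
    using mp_eval_on_line[of P "{..n}" d v u] P by blast
  define q where "q = (\<Prod>a\<in>N. [:dot a v, dot a u:])"
  have "q \<noteq> 0" using u(2) N(1) by (auto simp: q_def)
  have "poly (p * q) t = 0" for t
  proof (cases "\<forall>a\<in>N. dot a (\<lambda>j. v j + t * u j) \<noteq> 0")
    case True
    thus ?thesis using gen[OF V[OF v u(1)]] by (simp flip: p)
  next
    case False
    then obtain a where "a \<in> N" "dot a v + t * dot a u = 0" by (auto simp: dot_add_right dot_scale_right)
    thus ?thesis using N(1) by (auto simp: q_def poly_prod prod_zero_iff)
  qed
  hence "p * q = 0" by (metis poly_all_0_iff_0)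
  hence "p = 0" using \<open>q \<noteq> 0\<close> by simp
  thus ?thesis using p[of 0] by simp
qed

text \<open>\<open>dist\<close> says that the roots \<open>- A j / B j\<close> are pairwise
  different, so the product of their linear factors divides \<open>q\<close> and leaves degree at
  most \<open>e\<close>.\<close>

lemma poly_divisible_by_linear_factors:
  assumes J: "finite J" and A: "\<And>j. j \<in> J \<Longrightarrow> B j \<noteq> 0"
    and dist: "\<And>j k. j \<in> J \<Longrightarrow> k \<in> J \<Longrightarrow> j \<noteq> k \<Longrightarrow> A j * B k \<noteq> A k * B j"
    and deg: "Polynomial.degree q \<le> card J + e"
    and roots: "\<And>j t. j \<in> J \<Longrightarrow> A j + t * B j = 0 \<Longrightarrow> poly q t = 0"
  shows "\<exists>r :: complex poly. Polynomial.degree r \<le> e \<and> (\<forall>t. poly q t = poly r t * (\<Prod>j\<in>J. A j + t * B j))"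
proof -
  define \<rho> where "\<rho> j = - A j / B j" for j
  have inj: "inj_on \<rho> J"
  proof (rule inj_onI)
    fix j k assume jk: "j \<in> J" "k \<in> J" "\<rho> j = \<rho> k"
    hence "A j * B k = A k * B j" using A[OF jk(1)] A[OF jk(2)] by (simp add: \<rho>_def field_simps)
    thus "j = k" using dist jk by blast
  qed
  have "(\<Prod>r\<in>\<rho> ` J. [:- r, 1:]) dvd q"
  proof (rule dvd_prod_of_distinct_roots)
    fix r assume "r \<in> \<rho> ` J"
    then obtain j where j: "j \<in> J" "r = \<rho> j" by auto
    thus "poly q r = 0" using A[of j] by (intro roots[of j]) (auto simp: \<rho>_def)
  qed (use J in simp)
  then obtain q' where q': "q = (\<Prod>r\<in>\<rho> ` J. [:- r, 1:]) * q'" by (elim dvdE)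
  have deg': "Polynomial.degree q' \<le> e"
  proof (cases "q' = 0")
    case False
    have nz: "(\<Prod>r\<in>\<rho> ` J. [:- r, 1:]) \<noteq> 0" using J by auto
    have "Polynomial.degree (\<Prod>r\<in>\<rho> ` J. [:- r, 1:]) = card J"
      by (subst degree_prod_eq_sum_degree) (auto simp: card_image[OF inj])
    hence "Polynomial.degree q = card J + Polynomial.degree q'"
      unfolding q' using degree_mult_eq[OF nz False] by simp
    thus ?thesis using deg by simp
  qed simp
  define c where "c = (\<Prod>j\<in>J. B j)"
  have c: "c \<noteq> 0" using A J by (simp add: c_def)
  have "poly q t = poly (Polynomial.smult (1 / c) q') t * (\<Prod>j\<in>J. A j + t * B j)" for t
  proof -
    have "(\<Prod>j\<in>J. A j + t * B j) = (\<Prod>j\<in>J. B j * (t - \<rho> j))"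
      using A by (intro prod.cong refl) (simp add: \<rho>_def field_simps)
    also have "\<dots> = c * (\<Prod>j\<in>J. t - \<rho> j)" by (simp add: c_def prod.distrib)
    finally show ?thesis using c by (simp add: q' poly_prod prod.reindex[OF inj])
  qed
  moreover have "Polynomial.degree (Polynomial.smult (1 / c) q') \<le> e" using deg' degree_smult_le order_trans by blast
  ultimately show ?thesis by blast
qed

text \<open>The restriction of \<open>G\<close> to a line through a base point \<open>b\<close> off the hyperplanes \<open>L j\<close> is
  divisible by the restrictions of the \<open>L j\<close>; letting the line vary, so is \<open>G\<close>.\<close>

lemma reverse_line:
  assumes G: "G \<in> forms {..n} d" and J: "finite J" "card J + e = d" "e \<le> 1"
    and r: "\<And>t. mp_eval (\<lambda>j. b j + t * v j) G = (\<alpha> + \<beta> * t) * (\<Prod>j\<in>J. dot (L j) b + t * dot (L j) v)"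
    and e: "e = 0 \<Longrightarrow> \<beta> = 0"
  shows "mp_eval v G = (if e = 0 then \<alpha> else \<beta>) * (\<Prod>j\<in>J. dot (L j) v)"
proof -
  \<comment> \<open>The value at \<open>v\<close> is the leading behaviour of the line
    \<open>b + t v\<close> at infinity. By homogeneity it is the value at 0 of the reversed line
    \<open>v + t b\<close>, where the quotient \<open>\<alpha> + \<beta> * t\<close> is reversed as
    well.\<close>
  define f where "f t = mp_eval (\<lambda>j. v j + t * b j) G - (if e = 0 then \<alpha> else \<alpha> * t + \<beta>) * (\<Prod>j\<in>J. t * dot (L j) b + dot (L j) v)" for t
  obtain p where p: "\<And>t. mp_eval (\<lambda>j. v j + t * b j) G = poly p t"
    using mp_eval_on_line[of G "{..n}" d v b] forms_keys[OF G] by blast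
  have "isCont f 0" unfolding f_def p by (cases "e = 0") (auto intro!: continuous_intros)
  moreover have "f t = 0" if t: "t \<noteq> 0" for t
  proof -
    have "mp_eval (\<lambda>j. v j + t * b j) G = mp_eval (\<lambda>j. t * (b j + (1 / t) * v j)) G"
      using t by (intro mp_eval_cong) (simp add: field_simps)
    also have "\<dots> = t ^ d * ((\<alpha> + \<beta> * (1 / t)) * (\<Prod>j\<in>J. dot (L j) b + (1 / t) * dot (L j) v))"
      unfolding mp_eval_homog[OF G] r ..
    also have "\<dots> = (t ^ e * (\<alpha> + \<beta> * (1 / t))) * (t ^ card J * (\<Prod>j\<in>J. dot (L j) b + (1 / t) * dot (L j) v))"
      by (simp flip: J(2) add: power_add)
    also have "t ^ card J * (\<Prod>j\<in>J. dot (L j) b + (1 / t) * dot (L j) v) = (\<Prod>j\<in>J. t * (dot (L j) b + (1 / t) * dot (L j) v))"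
      by (simp add: prod.distrib)
    also have "\<dots> = (\<Prod>j\<in>J. t * dot (L j) b + dot (L j) v)"
      using t by (intro prod.cong refl) (simp add: field_simps)
    also have "t ^ e * (\<alpha> + \<beta> * (1 / t)) = (if e = 0 then \<alpha> else \<alpha> * t + \<beta>)"
    proof -
      have "e = 0 \<or> e = 1" using J(3) by auto
      thus ?thesis using t e by (auto simp: field_simps)
    qed
    finally show ?thesis by (simp add: f_def)
  qed
  ultimately have "f 0 = 0" by (rule isCont_zero_off_point)
  thus ?thesis by (simp add: f_def split: if_splits)
qed

text \<open>On the line through \<open>b\<close> and \<open>v\<close>, the zeros of the \<open>L j\<close> are pairwise distinct, and none of
  them is at infinity, if these functionals do not vanish at \<open>v\<close>.\<close>

definition pencil :: "(nat \<Rightarrow> nat \<Rightarrow> complex) \<Rightarrow> nat set \<Rightarrow> (nat \<Rightarrow> complex) \<Rightarrow> (nat \<Rightarrow> complex) set" where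
  "pencil L J b = L ` J \<union> (\<lambda>(j, k). \<lambda>l. dot (L k) b * L j l + (- dot (L j) b) * L k l) ` {(j, k). j \<in> J \<and> k \<in> J \<and> j \<noteq> k}"

lemma finite_pencil: "finite J \<Longrightarrow> finite (pencil L J b)"
  unfolding pencil_def by (rule finite_UnI, simp, rule finite_imageI, rule finite_subset[of _ "J \<times> J"]) auto

lemma pencil_nonzero:
  assumes b: "\<And>k. k \<in> J \<Longrightarrow> dot (L k) b \<noteq> 0"
    and 1: "\<And>k. k \<in> J \<Longrightarrow> \<exists>x\<in>V. dot (L k) x \<noteq> 0"
    and 2: "\<And>j k. j \<in> J \<Longrightarrow> k \<in> J \<Longrightarrow> j \<noteq> k \<Longrightarrow> \<exists>x\<in>V. dot (L k) x = 0 \<and> dot (L j) x \<noteq> 0"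
    and c: "c \<in> pencil L J b"
  shows "\<exists>x\<in>V. dot c x \<noteq> 0"
  using c unfolding pencil_def
proof (elim UnE imageE)
  fix k assume "c = L k" "k \<in> J"
  thus ?thesis using 1 by blast
next
  fix p assume p: "c = (\<lambda>(j, k). \<lambda>l. dot (L k) b * L j l + (- dot (L j) b) * L k l) p"
    "p \<in> {(j, k). j \<in> J \<and> k \<in> J \<and> j \<noteq> k}"
  then obtain j k where jk: "p = (j, k)" "j \<in> J" "k \<in> J" "j \<noteq> k" by auto
  obtain x where x: "x \<in> V" "dot (L k) x = 0" "dot (L j) x \<noteq> 0" using 2[OF jk(2-4)] by blast
  have "dot c x = dot (L k) b * dot (L j) x + (- dot (L j) b) * dot (L k) x"
    unfolding p jk(1) prod.case dot_add dot_scale ..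
  hence "dot c x \<noteq> 0" using x b[OF jk(3)] by simp
  thus ?thesis using x(1) by blast
qed

lemma division_on_line:
  assumes G: "G \<in> forms {..n} d" and J: "finite J" "card J + e = d"
    and v: "\<forall>c\<in>pencil L J b. dot c v \<noteq> 0"
    and van: "\<And>j t. j \<in> J \<Longrightarrow> dot (L j) (\<lambda>l. b l + t * v l) = 0 \<Longrightarrow> mp_eval (\<lambda>l. b l + t * v l) G = 0"
  shows "\<exists>r. Polynomial.degree r \<le> e \<and>
    (\<forall>t. mp_eval (\<lambda>l. b l + t * v l) G = poly r t * (\<Prod>j\<in>J. dot (L j) b + t * dot (L j) v))"
proof -
  obtain q where q: "Polynomial.degree q \<le> d" "\<And>t. mp_eval (\<lambda>l. b l + t * v l) G = poly q t"
    using mp_eval_on_line[of G "{..n}" d b v] forms_keys[OF G] by blast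
  show ?thesis unfolding q(2)
  proof (rule poly_divisible_by_linear_factors)
    show "dot (L j) v \<noteq> 0" if "j \<in> J" for j using v that by (auto simp: pencil_def)
    show "dot (L j) b * dot (L k) v \<noteq> dot (L k) b * dot (L j) v" if "j \<in> J" "k \<in> J" "j \<noteq> k" for j k
    proof -
      have "(\<lambda>l. dot (L k) b * L j l + (- dot (L j) b) * L k l) \<in> pencil L J b" using that by (force simp: pencil_def)
      hence "dot (\<lambda>l. dot (L k) b * L j l + (- dot (L j) b) * L k l) v \<noteq> 0" using v by blast
      thus ?thesis unfolding dot_add dot_scale by simp
    qed
    show "poly q t = 0" if "j \<in> J" "dot (L j) b + t * dot (L j) v = 0" for j t
      unfolding q(2)[symmetric] by (rule van[of j]) (use that in \<open>simp_all add: dot_add_right dot_scale_right\<close>)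
  qed (use J q(1) in auto)
qed

text \<open>General position, witnessed by minors in the first two or three coordinates. Three
  linear forms in two variables are always dependent, whence the condition \<open>n \<ge> 2\<close>
  for triples.\<close>

definition general :: "(nat \<Rightarrow> nat \<Rightarrow> complex) \<Rightarrow> bool" where
  "general L \<longleftrightarrow> (\<forall>i\<in>{1..s}. L i 0 \<noteq> 0)
    \<and> (\<forall>i\<in>{1..s}. \<forall>j\<in>{1..s}. i \<noteq> j \<longrightarrow> L i 0 * L j 1 - L i 1 * L j 0 \<noteq> 0)
    \<and> (n \<ge> 2 \<longrightarrow> (\<forall>i\<in>{1..s}. \<forall>j\<in>{1..s}. \<forall>k\<in>{1..s}. i \<noteq> j \<longrightarrow> i \<noteq> k \<longrightarrow> j \<noteq> k \<longrightarrow>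
         L i 0 * (L j 1 * L k 2 - L j 2 * L k 1) - L i 1 * (L j 0 * L k 2 - L j 2 * L k 0)
         + L i 2 * (L j 0 * L k 1 - L j 1 * L k 0) \<noteq> 0))"

lemma dot_two: "dot a (\<lambda>j. if j = 0 then x else if j = 1 then y else 0) = a 0 * x + a 1 * y"
proof -
  have "dot a (\<lambda>j. if j = 0 then x else if j = 1 then y else 0) = (\<Sum>j\<in>{0, 1}. a j * (if j = 0 then x else if j = 1 then y else 0))"
    unfolding dot_def by (rule sum.mono_neutral_right) (use n in auto)
  thus ?thesis by simp
qed

lemma dot_three:
  assumes "n \<ge> 2"
  shows "dot a (\<lambda>j. if j = 0 then x else if j = 1 then y else if j = 2 then z else 0) = a 0 * x + a 1 * y + a 2 * z"
proof -
  have "dot a (\<lambda>j. if j = 0 then x else if j = 1 then y else if j = 2 then z else 0)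
      = (\<Sum>j\<in>{0, 1, 2}. a j * (if j = 0 then x else if j = 1 then y else if j = 2 then z else 0))"
    unfolding dot_def by (rule sum.mono_neutral_right) (use assms in auto)
  thus ?thesis by simp
qed

lemma general_pair_point:
  assumes "general L" "i \<in> {1..s}" "j \<in> {1..s}" "i \<noteq> j"
  shows "\<exists>x. dot (L i) x = 0 \<and> dot (L j) x \<noteq> 0"
proof -
  let ?x = "\<lambda>l::nat. if l = 0 then - L i 1 else if l = 1 then L i 0 else 0"
  have "L i 0 * L j 1 - L i 1 * L j 0 \<noteq> 0" using assms unfolding general_def by blast
  hence "dot (L i) ?x = 0 \<and> dot (L j) ?x \<noteq> 0" unfolding dot_two by (simp add: algebra_simps)
  thus ?thesis by blast
qed

lemma general_triple_point:
  assumes "general L" "n \<ge> 2" "i \<in> {1..s}" "j \<in> {1..s}" "k \<in> {1..s}" "i \<noteq> j" "i \<noteq> k" "j \<noteq> k"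
  shows "\<exists>x. dot (L i) x = 0 \<and> dot (L j) x = 0 \<and> dot (L k) x \<noteq> 0"
proof -
  \<comment> \<open>The cross product of \<open>L i\<close> and \<open>L j\<close> in the first
    three coordinates; \<open>L k\<close> takes the value of the determinant there.\<close>
  let ?x = "\<lambda>l::nat. if l = 0 then L i 1 * L j 2 - L i 2 * L j 1 else if l = 1 then L i 2 * L j 0 - L i 0 * L j 2
     else if l = 2 then L i 0 * L j 1 - L i 1 * L j 0 else 0"
  have "L i 0 * (L j 1 * L k 2 - L j 2 * L k 1) - L i 1 * (L j 0 * L k 2 - L j 2 * L k 0)
         + L i 2 * (L j 0 * L k 1 - L j 1 * L k 0) \<noteq> 0" using assms unfolding general_def by blast
  hence "dot (L i) ?x = 0 \<and> dot (L j) ?x = 0 \<and> dot (L k) ?x \<noteq> 0"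
    unfolding dot_three[OF assms(2)] by (simp add: algebra_simps)
  thus ?thesis by blast
qed

lemma general_base_point:
  assumes L: "general L" and i: "i \<in> {1..s}"
  shows "\<exists>b. dot (L i) b = 0 \<and> (\<forall>k\<in>{1..s} - {i}. dot (L k) b \<noteq> 0)"
proof -
  have "\<exists>b\<in>{x. dot (L i) x = 0}. \<forall>a\<in>L ` ({1..s} - {i}). dot a b \<noteq> 0"
  proof (rule common_nonzero_point)
    have "(\<lambda>j. 0) \<in> {x. dot (L i) x = 0}" by (simp add: dot_def)
    thus "{x. dot (L i) x = 0} \<noteq> {}" by blast
    show "\<exists>x\<in>{x. dot (L i) x = 0}. dot a x \<noteq> 0" if "a \<in> L ` ({1..s} - {i})" for a
    proof -
      obtain k where "k \<in> {1..s}" "i \<noteq> k" "a = L k" using \<open>a \<in> L ` ({1..s} - {i})\<close> by blast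
      thus ?thesis using general_pair_point[OF L i] by blast
    qed
  qed (auto simp: dot_add_right dot_scale_right)
  thus ?thesis by auto
qed

text \<open>On the hyperplane of \<open>L i\<close>, the other \<open>s - 1\<close> linear forms
  divide \<open>G\<close>, and the quotient has degree one. On each line through \<open>b\<close>
  the quotient is determined by its value and derivative at \<open>b\<close>, which makes it linear
  in the direction.\<close>

lemma restriction_to_hyperplane:
  assumes L: "general L" and i: "i \<in> {1..s}" and G: "G \<in> forms {..n} s"
    and van: "\<And>x k. k \<in> {1..s} - {i} \<Longrightarrow> dot (L i) x = 0 \<Longrightarrow> dot (L k) x = 0 \<Longrightarrow> mp_eval x G = 0"
  shows "\<exists>a. \<forall>v. dot (L i) v = 0 \<longrightarrow> mp_eval v G = dot a v * (\<Prod>k\<in>{1..s} - {i}. dot (L k) v)"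
proof -
  define J where "J = {1..s} - {i}"
  have J: "finite J" "card J + 1 = s" using i by (auto simp: J_def)
  obtain b where b: "dot (L i) b = 0" "\<And>k. k \<in> J \<Longrightarrow> dot (L k) b \<noteq> 0"
    using general_base_point[OF L i] unfolding J_def by blast
  define C where "C = (\<Prod>k\<in>J. dot (L k) b)"
  have C: "C \<noteq> 0" using b J by (simp add: C_def)
  show ?thesis
  proof (cases "n = 1")
    case True
    \<comment> \<open>For \<open>n = 1\<close> the hyperplane is one-dimensional and the factors do
      not have distinct zeros on it. Homogeneity suffices instead: \<open>a\<close> takes the value
      \<open>mp_eval b G / C\<close> at \<open>b\<close>.\<close>
    define a where "a = (\<lambda>j::nat. if j = 1 then mp_eval b G / C / b 1 else 0)"
    have Li: "L i 0 \<noteq> 0" using L i unfolding general_def by blast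
    have "{..n} = {0, 1}" using True by auto
    hence dot1: "dot c x = c 0 * x 0 + c 1 * x 1" for c x by (simp only: dot_def) simp
    show ?thesis
    proof (cases "b 1 = 0")
      \<comment> \<open>Here \<open>b\<close> is zero, and it can avoid the other hyperplanes only
        if there are none, so \<open>s = 1\<close> and \<open>G\<close> is itself linear.\<close>
      case True
      hence "b 0 = 0" using b(1) Li by (simp add: dot1)
      hence "dot (L k) b = 0" for k using True by (simp add: dot1)
      hence "J = {}" using b(2) by blast
      hence s1: "s = 1" using J(2) by simp
      have "G \<in> forms {..n} 1" using G s1 by simp
      from form_eq_lin[OF this] obtain a where "G = lin a" by blast
      thus ?thesis unfolding J_def[symmetric] using \<open>J = {}\<close> by (intro exI[of _ a]) simp
    next
      case False
      have "mp_eval v G = dot a v * (\<Prod>k\<in>J. dot (L k) v)" if v: "dot (L i) v = 0" for v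
      proof -
        define t where "t = v 1 / b 1"
        have v1: "v 1 = t * b 1" using False by (simp add: t_def)
        have "L i 0 * b 0 = - (L i 1 * b 1)" "L i 0 * v 0 = - (L i 1 * v 1)"
          using b(1) v unfolding dot1 by (simp_all add: eq_neg_iff_add_eq_0)
        hence "L i 0 * v 0 = L i 0 * (t * b 0)" unfolding v1 by (metis mult.left_commute mult_minus_right)
        hence v0: "v 0 = t * b 0" using Li by simp
        have vt: "v j = t * b j" if "j \<le> n" for j
          using v0 v1 that \<open>n = 1\<close> by (cases j) auto
        have "mp_eval v G = mp_eval (\<lambda>j. t * b j) G"
        proof (rule mp_eval_cong)
          fix m j assume "m \<in> keys G" "j \<in> keys m"
          hence "j \<le> n" using forms_keys[OF G] monomials_keys by blast
          thus "v j = t * b j" by (rule vt)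
        qed
        also have "\<dots> = t ^ s * mp_eval b G" by (rule mp_eval_homog[OF G])
        also have "\<dots> = (t * (mp_eval b G / C)) * (t ^ card J * C)"
          using C by (simp flip: J(2))
        also have "t * (mp_eval b G / C) = dot a v"
          using False by (simp add: dot1 a_def t_def mult_ac)
        also have "t ^ card J * C = (\<Prod>k\<in>J. dot (L k) v)"
        proof -
          have "dot (L k) v = t * dot (L k) b" for k unfolding dot1 v0 v1 by (simp add: algebra_simps)
          thus ?thesis by (simp add: C_def prod.distrib)
        qed
        finally show ?thesis .
      qed
      thus ?thesis unfolding J_def by blast
    qed
  next
    case False
    hence n2: "n \<ge> 2" using n by simp
    \<comment> \<open>Obtained by differentiating \<open>(\<alpha> + \<beta> * t) * (\<Prod>j\<in>J.
      dot (L j) b + t * dot (L j) v)\<close> at \<open>t = 0\<close>, equating the result with the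
      derivative of \<open>G\<close> along \<open>v\<close>, and solving for
      \<open>\<beta>\<close>.\<close>
    define a where "a l = (mp_eval b (mp_deriv l G) - mp_eval b G / C * (\<Sum>j\<in>J. L j l * (\<Prod>k\<in>J - {j}. dot (L k) b))) / C" for l
    define V where "V = {x. dot (L i) x = 0}"
    have V: "(\<lambda>j. x j + t * y j) \<in> V" if "x \<in> V" "y \<in> V" for x y t
      using that by (simp add: V_def dot_add_right dot_scale_right)
    have ne: "\<exists>x\<in>V. dot c x \<noteq> 0" if "c \<in> pencil L J b" for c
    proof (rule pencil_nonzero[OF b(2) _ _ that])
      show "\<exists>x\<in>V. dot (L k) x \<noteq> 0" if "k \<in> J" for k
        using general_pair_point[OF L i, of k] that by (auto simp: J_def V_def)
      show "\<exists>x\<in>V. dot (L k) x = 0 \<and> dot (L j) x \<noteq> 0" if "j \<in> J" "k \<in> J" "j \<noteq> k" for j k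
        using general_triple_point[OF L n2 i, of k j] that by (auto simp: J_def V_def)
    qed
    define P where "P = G - lin a * (\<Prod>k\<in>J. lin (L k))"
    have evP: "mp_eval v P = mp_eval v G - dot a v * (\<Prod>k\<in>J. dot (L k) v)" for v
    proof -
      have "mp_eval v P = mp_eval v (P + lin a * (\<Prod>k\<in>J. lin (L k))) - mp_eval v (lin a * (\<Prod>k\<in>J. lin (L k)))"
        unfolding mp_eval_add by simp
      thus ?thesis by (simp add: P_def mp_eval_mult mp_eval_prod)
    qed
    have "lin a * (\<Prod>k\<in>J. lin (L k)) \<in> forms {..n} (1 + card J)"
      by (intro forms_mult forms_prod1 lin_in_forms)
    hence Pf: "P \<in> forms {..n} s" unfolding P_def using G J(2) by (intro forms_diff) (auto simp: add.commute)
    have "mp_eval v P = 0" if v: "v \<in> V" for v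
    proof (rule vanish_dense[OF V finite_pencil[OF J(1)] ne forms_keys[OF Pf] _ v])
      fix v assume v: "v \<in> V" and gen: "\<forall>c\<in>pencil L J b. dot c v \<noteq> 0"
      have "mp_eval (\<lambda>l. b l + t * v l) G = 0" if "j \<in> J" "dot (L j) (\<lambda>l. b l + t * v l) = 0" for j t
        by (rule van[of j]) (use that b(1) v in \<open>auto simp: J_def V_def dot_add_right dot_scale_right\<close>)
      then obtain r where r: "Polynomial.degree r \<le> 1"
        "\<And>t. mp_eval (\<lambda>j. b j + t * v j) G = poly r t * (\<Prod>j\<in>J. dot (L j) b + t * dot (L j) v)"
        using division_on_line[OF G J gen] by blast
      define \<alpha> \<beta> where "\<alpha> = coeff r 0" and "\<beta> = coeff r 1"
      have rp: "poly r t = \<alpha> + \<beta> * t" for t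
      proof -
        have "poly r t = (\<Sum>i\<le>1. coeff r i * t ^ i)"
          unfolding poly_altdef using r(1) by (intro sum.mono_neutral_left) (auto intro: coeff_eq_0)
        thus ?thesis by (simp add: \<alpha>_def \<beta>_def)
      qed
      have line: "mp_eval (\<lambda>j. b j + t * v j) G = (\<alpha> + \<beta> * t) * (\<Prod>j\<in>J. dot (L j) b + t * dot (L j) v)" for t
        by (simp add: r(2) rp)
      have \<alpha>: "\<alpha> = mp_eval b G / C" using line[of 0] C by (simp add: C_def)
      have d1: "((\<lambda>t. mp_eval (\<lambda>j. b j + t * v j) G) has_field_derivative
          (\<Sum>l\<le>n. v l * mp_eval (\<lambda>j. b j + 0 * v j) (mp_deriv l G))) (at 0)"
      proof (rule mp_eval_has_field_derivative)
        show "keys m \<subseteq> {..n}" if "m \<in> keys G" for m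
          using monomials_keys[OF forms_keys[OF G that]] .
      qed (auto intro!: derivative_eq_intros)
      have dp: "((\<lambda>t. \<Prod>j\<in>J. dot (L j) b + t * dot (L j) v) has_field_derivative
          (\<Sum>j\<in>J. dot (L j) v * (\<Prod>k\<in>J - {j}. dot (L k) b + 0 * dot (L k) v))) (at 0)"
        by (rule has_field_derivative_prod) (auto intro!: derivative_eq_intros)
      have d2: "((\<lambda>t. (\<alpha> + \<beta> * t) * (\<Prod>j\<in>J. dot (L j) b + t * dot (L j) v)) has_field_derivative
          (\<beta> * C + \<alpha> * (\<Sum>j\<in>J. dot (L j) v * (\<Prod>k\<in>J - {j}. dot (L k) b)))) (at 0)"
        by (rule derivative_eq_intros dp refl)+ (simp add: C_def algebra_simps)
      have "(\<Sum>l\<le>n. v l * mp_eval b (mp_deriv l G)) = \<beta> * C + \<alpha> * (\<Sum>j\<in>J. dot (L j) v * (\<Prod>k\<in>J - {j}. dot (L k) b))"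
        using DERIV_unique[OF d1 d2[folded line]] by simp
      moreover have "(\<Sum>j\<in>J. dot (L j) v * (\<Prod>k\<in>J - {j}. dot (L k) b))
          = (\<Sum>l\<le>n. v l * (\<Sum>j\<in>J. L j l * (\<Prod>k\<in>J - {j}. dot (L k) b)))"
        unfolding dot_def[of _ v] sum_distrib_left sum_distrib_right
        by (subst sum.swap) (simp add: mult_ac)
      ultimately have "\<beta> * C = (\<Sum>l\<le>n. v l * (mp_eval b (mp_deriv l G) - \<alpha> * (\<Sum>j\<in>J. L j l * (\<Prod>k\<in>J - {j}. dot (L k) b))))"
        by (simp add: right_diff_distrib sum_subtractf sum_distrib_left mult_ac)
      also have "\<dots> = (\<Sum>l\<le>n. C * (a l * v l))"
        using C by (intro sum.cong refl) (simp add: a_def \<alpha>)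
      also have "\<dots> = C * dot a v" by (simp only: dot_def[of a v] sum_distrib_left)
      finally have \<beta>: "\<beta> = dot a v" using C by simp
      have "mp_eval v G = (if (1::nat) = 0 then \<alpha> else \<beta>) * (\<Prod>j\<in>J. dot (L j) v)"
        by (rule reverse_line[OF G J(1) J(2) _ line]) auto
      thus "mp_eval v P = 0" by (simp add: evP \<beta>)
    qed
    thus ?thesis by (auto simp: evP V_def J_def)
  qed
qed

text \<open>The same division with all \<open>s\<close> linear forms leaves degree 0, so the
  quotient is the constant ratio of the two values at \<open>b\<close>.\<close>

lemma vanish_on_all_hyperplanes:
  assumes L: "general L" and G: "G \<in> forms {..n} s"
    and van: "\<And>x k. k \<in> {1..s} \<Longrightarrow> dot (L k) x = 0 \<Longrightarrow> mp_eval x G = 0"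
  shows "\<exists>c. G = scale_pm c (form_of L)"
proof -
  define J where "J = {1..s}"
  have J: "finite J" "card J + 0 = s" by (auto simp: J_def)
  have L0: "dot (L k) (\<lambda>j. if j = 0 then 1 else if j = 1 then 0 else 0) \<noteq> 0" if "k \<in> J" for k
    unfolding dot_two using L that unfolding general_def J_def by simp
  have "\<exists>b\<in>UNIV. \<forall>a\<in>L ` J. dot a b \<noteq> 0"
    by (rule common_nonzero_point) (use J L0 in auto)
  then obtain b where b: "\<And>k. k \<in> J \<Longrightarrow> dot (L k) b \<noteq> 0" by auto
  define C where "C = (\<Prod>k\<in>J. dot (L k) b)"
  have C: "C \<noteq> 0" using b J by (simp add: C_def)
  have ne: "\<exists>x\<in>UNIV. dot c x \<noteq> 0" if "c \<in> pencil L J b" for c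
  proof (rule pencil_nonzero[OF b _ _ that])
    show "\<exists>x\<in>UNIV. dot (L k) x \<noteq> 0" if "k \<in> J" for k using L0[OF that] by blast
    show "\<exists>x\<in>UNIV. dot (L k) x = 0 \<and> dot (L j) x \<noteq> 0" if "j \<in> J" "k \<in> J" "j \<noteq> k" for j k
      using general_pair_point[OF L, of k j] that by (auto simp: J_def)
  qed
  define c where "c = mp_eval b G / C"
  define P where "P = G - scale_pm c (form_of L)"
  have evP: "mp_eval v P = mp_eval v G - c * (\<Prod>k\<in>J. dot (L k) v)" for v
  proof -
    have "mp_eval v P = mp_eval v (P + scale_pm c (form_of L)) - mp_eval v (scale_pm c (form_of L))"
      unfolding mp_eval_add by simp
    thus ?thesis by (simp add: P_def mp_eval_form_of J_def)
  qed
  have Pf: "P \<in> forms {..n} s" unfolding P_def by (intro forms_diff forms_scale form_of_in_forms G)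
  have "mp_eval v P = 0" for v
  proof (rule vanish_dense[where V = UNIV, OF _ finite_pencil[OF J(1)] ne forms_keys[OF Pf]])
    fix v assume gen: "\<forall>c\<in>pencil L J b. dot c v \<noteq> 0"
    have "mp_eval (\<lambda>l. b l + t * v l) G = 0" if "j \<in> J" "dot (L j) (\<lambda>l. b l + t * v l) = 0" for j t
      by (rule van[of j]) (use that in \<open>auto simp: J_def\<close>)
    then obtain r where "Polynomial.degree r \<le> 0"
      and r: "\<And>t. mp_eval (\<lambda>j. b j + t * v j) G = poly r t * (\<Prod>j\<in>J. dot (L j) b + t * dot (L j) v)"
      using division_on_line[OF G J gen] by blast
    hence r0: "Polynomial.degree r = 0" by simp
    obtain \<alpha> where "r = [:\<alpha>:]" using r0 degree_eq_zeroE by blast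
    hence line: "mp_eval (\<lambda>j. b j + t * v j) G = (\<alpha> + 0 * t) * (\<Prod>j\<in>J. dot (L j) b + t * dot (L j) v)" for t
      by (simp add: r)
    have "\<alpha> = c" using line[of 0] C by (simp add: C_def c_def)
    moreover have "mp_eval v G = (if (0::nat) = 0 then \<alpha> else 0) * (\<Prod>j\<in>J. dot (L j) v)"
      by (rule reverse_line[OF G J(1) J(2) _ line]) auto
    ultimately show "mp_eval v P = 0" by (simp add: evP)
  qed auto
  hence "P = 0" by (rule mp_eval_eq_zero_imp)
  thus ?thesis by (auto simp: P_def)
qed

text \<open>The image of the differential of \<open>form_of\<close> at \<open>L\<close>.\<close>

definition tangent_span :: "(nat \<Rightarrow> nat \<Rightarrow> complex) \<Rightarrow> nat mpol set" where
  "tangent_span L = pm.span {form_of (L(i := a)) | i a. i \<in> {1..s}}"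

lemma form_of_in_tangent_span: "form_of L \<in> tangent_span L"
  unfolding tangent_span_def using s by (intro pm.span_base CollectI exI[of _ 1] exI[of _ "L 1"]) auto

lemma mp_eval_form_of_update:
  "i \<in> {1..s} \<Longrightarrow> mp_eval x (form_of (L(i := a))) = dot a x * (\<Prod>k\<in>{1..s} - {i}. dot (L k) x)"
  unfolding mp_eval_form_of by (subst prod.remove[of _ i]) auto

text \<open>Restriction to each hyperplane yields a linear form \<open>a i\<close>. In the sum
  \<open>S\<close> of the products with \<open>L i\<close> replaced by \<open>a i\<close>, only the
  term \<open>k\<close> survives on the hyperplane of \<open>L k\<close>, and there it equals
  \<open>G\<close>. So \<open>G - S\<close> vanishes on all the hyperplanes and is a multiple of
  \<open>form_of L\<close>.\<close>

lemma mem_tangent_span_iff: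
  assumes L: "general L" and G: "G \<in> forms {..n} s"
  shows "G \<in> tangent_span L \<longleftrightarrow>
    (\<forall>i\<in>{1..s}. \<forall>j\<in>{1..s} - {i}. \<forall>x. dot (L i) x = 0 \<longrightarrow> dot (L j) x = 0 \<longrightarrow> mp_eval x G = 0)"
proof
  assume "G \<in> tangent_span L"
  thus "\<forall>i\<in>{1..s}. \<forall>j\<in>{1..s} - {i}. \<forall>x. dot (L i) x = 0 \<longrightarrow> dot (L j) x = 0 \<longrightarrow> mp_eval x G = 0"
    unfolding tangent_span_def
  proof (induction rule: pm.span_induct)
    case base
    show ?case by (auto simp: pm.subspace_def mp_eval_add)
  next
    case (step G)
    then obtain l a where G: "G = form_of (L(l := a))" "l \<in> {1..s}" by blast
    show ?case
    proof (intro ballI allI impI)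
      fix i j x assume ij: "i \<in> {1..s}" "j \<in> {1..s} - {i}" "dot (L i) x = 0" "dot (L j) x = 0"
      have "\<exists>k\<in>{1..s} - {l}. dot (L k) x = 0"
        using ij by (cases "i = l") auto
      hence "(\<Prod>k\<in>{1..s} - {l}. dot (L k) x) = 0" by (intro prod_zero) auto
      thus "mp_eval x G = 0" unfolding G(1) mp_eval_form_of_update[OF G(2)] by simp
    qed
  qed
next
  assume van: "\<forall>i\<in>{1..s}. \<forall>j\<in>{1..s} - {i}. \<forall>x. dot (L i) x = 0 \<longrightarrow> dot (L j) x = 0 \<longrightarrow> mp_eval x G = 0"
  have "\<forall>i\<in>{1..s}. \<exists>a. \<forall>v. dot (L i) v = 0 \<longrightarrow> mp_eval v G = dot a v * (\<Prod>k\<in>{1..s} - {i}. dot (L k) v)"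
    using restriction_to_hyperplane[OF L _ G] van by blast
  then obtain a where a: "\<And>i v. i \<in> {1..s} \<Longrightarrow> dot (L i) v = 0 \<Longrightarrow> mp_eval v G = dot (a i) v * (\<Prod>k\<in>{1..s} - {i}. dot (L k) v)"
    by metis
  define S where "S = (\<Sum>i\<in>{1..s}. form_of (L(i := a i)))"
  have "\<exists>c. G - S = scale_pm c (form_of L)"
  proof (rule vanish_on_all_hyperplanes[OF L])
    show "G - S \<in> forms {..n} s" unfolding S_def by (intro forms_diff forms_sum form_of_in_forms G)
    fix x k assume k: "k \<in> {1..s}" "dot (L k) x = 0"
    have "mp_eval x S = (\<Sum>i\<in>{1..s}. dot (a i) x * (\<Prod>k\<in>{1..s} - {i}. dot (L k) x))"
      unfolding S_def mp_eval_sum by (intro sum.cong refl mp_eval_form_of_update)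
    also have "\<dots> = (\<Sum>i\<in>{k}. dot (a i) x * (\<Prod>k\<in>{1..s} - {i}. dot (L k) x))"
      by (rule sum.mono_neutral_right) (use k in \<open>auto simp: prod_zero_iff\<close>)
    also have "\<dots> = mp_eval x G" using a[OF k] by simp
    finally have "mp_eval x S = mp_eval x G" .
    moreover have "mp_eval x (G - S + S) = mp_eval x (G - S) + mp_eval x S" by (rule mp_eval_add)
    ultimately show "mp_eval x (G - S) = 0" by simp
  qed
  then obtain c where "G - S = scale_pm c (form_of L)" by blast
  hence "G = scale_pm c (form_of L) + S" by (simp add: algebra_simps)
  moreover have "S \<in> tangent_span L" unfolding S_def tangent_span_def
    by (intro pm.span_sum pm.span_base) blast
  ultimately show "G \<in> tangent_span L"
    using form_of_in_tangent_span[of L] unfolding tangent_span_def by (simp add: pm.span_add pm.span_scale)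
qed

section \<open>Generic conditions\<close>

text \<open>Genericity in terms of the product rather than the factors: a form on the ambient space,
  not identically zero on the variety, whose nonvanishing implies \<open>C\<close> for every
  factorization.\<close>

definition detectable :: "((nat \<Rightarrow> nat \<Rightarrow> complex) \<Rightarrow> bool) \<Rightarrow> bool" where
  "detectable C \<longleftrightarrow> (\<exists>d. \<exists>P\<in>forms idx d. (\<exists>L. pull P L \<noteq> 0) \<and> (\<forall>L. pull P L \<noteq> 0 \<longrightarrow> C L))"

lemma detectable_mono: "detectable C \<Longrightarrow> (\<And>L. C L \<Longrightarrow> C' L) \<Longrightarrow> detectable C'"
  unfolding detectable_def by blast

lemma detectable_Ball:
  assumes "finite A" "\<And>a. a \<in> A \<Longrightarrow> detectable (C a)"
  shows "detectable (\<lambda>L. \<forall>a\<in>A. C a L)"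
proof -
  obtain d P where P: "\<And>a. a \<in> A \<Longrightarrow> P a \<in> forms idx (d a)" "\<And>a. a \<in> A \<Longrightarrow> \<exists>L. pull (P a) L \<noteq> 0"
    "\<And>a L. a \<in> A \<Longrightarrow> pull (P a) L \<noteq> 0 \<Longrightarrow> C a L"
    using assms(2) unfolding detectable_def by metis
  have "\<exists>L. \<forall>a\<in>A. pull (P a) L \<noteq> 0"
    by (rule common_nonzero_multihom[OF assms(1) multihom_pull[OF P(1)] P(2)])
  hence "\<exists>L. pull (\<Prod>a\<in>A. P a) L \<noteq> 0" using assms(1) by (simp add: pull_prod prod_zero_iff)
  moreover have "(\<Prod>a\<in>A. P a) \<in> forms idx (\<Sum>a\<in>A. d a)" by (intro forms_prod P(1))
  moreover have "C a L" if "pull (\<Prod>a\<in>A. P a) L \<noteq> 0" "a \<in> A" for a L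
    using that assms(1) P(3) by (simp add: pull_prod prod_zero_iff)
  ultimately show ?thesis unfolding detectable_def by blast
qed

lemma detectable_conj:
  assumes "detectable C" "detectable C'" shows "detectable (\<lambda>L. C L \<and> C' L)"
proof -
  have "detectable (\<lambda>L. \<forall>b\<in>UNIV. (if b then C else C') L)"
    by (rule detectable_Ball) (use assms in auto)
  thus ?thesis
  proof (rule detectable_mono)
    fix L assume a: "\<forall>b\<in>UNIV. (if b then C else C') L"
    show "C L \<and> C' L" using bspec[OF a UNIV_I, of True] bspec[OF a UNIV_I, of False] by simp
  qed
qed

lemma detectable_nonzero: "multihom c g \<Longrightarrow> g L0 \<noteq> 0 \<Longrightarrow> detectable (\<lambda>L. g L \<noteq> 0)"
  unfolding detectable_def by (rule detecting_form)

text \<open>\<open>multihom\<close> demands the same degree in every factor, so minors of two or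
  three rows are padded with the entries \<open>L k 0\<close> of the other rows.\<close>

definition entry_prod :: "(nat \<Rightarrow> nat) \<Rightarrow> (nat \<Rightarrow> nat \<Rightarrow> complex) \<Rightarrow> complex" where
  "entry_prod f L = (\<Prod>k\<in>{1..s}. L k (f k))"

lemma multihom_entry_prod:
  assumes "\<And>k. f k \<le> n" shows "multihom 1 (entry_prod f)"
proof -
  have "multihom 1 (multimono (\<lambda>k. single (f k) 1))"
    by (intro multihom_multimono monomials_single) (use assms in simp)
  moreover have "multimono (\<lambda>k. single (f k) 1) = entry_prod f"
    by (simp add: multimono_def entry_prod_def fun_eq_iff)
  ultimately show ?thesis by simp
qed

lemma entry_prod_pair:
  assumes "i \<in> {1..s}" "j \<in> {1..s}" "i \<noteq> j"
  shows "entry_prod ((\<lambda>_. 0)(i := a, j := b)) L = L i a * L j b * (\<Prod>k\<in>{1..s} - {i} - {j}. L k 0)"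
  unfolding entry_prod_def using assms
  by (subst prod.remove[of _ i], simp, simp, subst prod.remove[of _ j]) (auto intro!: prod.cong)

lemma entry_prod_triple:
  assumes "i \<in> {1..s}" "j \<in> {1..s}" "k \<in> {1..s}" "i \<noteq> j" "i \<noteq> k" "j \<noteq> k"
  shows "entry_prod ((\<lambda>_. 0)(i := a, j := b, k := c)) L = L i a * L j b * L k c * (\<Prod>l\<in>{1..s} - {i} - {j} - {k}. L l 0)"
  unfolding entry_prod_def using assms
  by (subst prod.remove[of _ i], simp, simp, subst prod.remove[of _ j], simp, simp, subst prod.remove[of _ k])
     (auto intro!: prod.cong)

lemma multihom_diff: "multihom d f \<Longrightarrow> multihom d g \<Longrightarrow> multihom d (\<lambda>L. f L - g L)"
  using multihom_add[of d f "\<lambda>L. (- 1) * g L"] multihom_cmult[of d g "- 1"] by simp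

lemma detectable_general: "detectable general"
proof -
  \<comment> \<open>Vandermonde rows satisfy all the conditions at once: the minors are products of
    differences of labels, and the padding entries equal 1.\<close>
  define M where "M k j = (of_nat k :: complex) ^ j" for k j :: nat
  have neq: "(of_nat j - of_nat i :: complex) \<noteq> 0" if "i \<noteq> j" for i j :: nat using that by simp
  have 1: "detectable (\<lambda>L. L i 0 \<noteq> 0)" if i: "i \<in> {1..s}" for i
  proof (rule detectable_mono)
    show "detectable (\<lambda>L. entry_prod (\<lambda>_. 0) L \<noteq> 0)"
      by (rule detectable_nonzero[OF multihom_entry_prod, of _ M]) (auto simp: entry_prod_def M_def)
    show "L i 0 \<noteq> 0" if "entry_prod (\<lambda>_. 0) L \<noteq> 0" for L
      using that i by (auto simp: entry_prod_def prod_zero_iff)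
  qed
  have 2: "detectable (\<lambda>L. L i 0 * L j 1 - L i 1 * L j 0 \<noteq> 0)" if ij: "i \<in> {1..s}" "j \<in> {1..s}" "i \<noteq> j" for i j
  proof -
    define g where "g L = entry_prod ((\<lambda>_. 0)(i := 0, j := 1)) L - entry_prod ((\<lambda>_. 0)(i := 1, j := 0)) L" for L
    have gL: "g L = (L i 0 * L j 1 - L i 1 * L j 0) * (\<Prod>k\<in>{1..s} - {i} - {j}. L k 0)" for L
      unfolding g_def entry_prod_pair[OF ij] by (simp add: algebra_simps)
    have g: "multihom 1 g" unfolding g_def[abs_def]
      by (intro multihom_diff multihom_entry_prod) (use n in auto)
    have "g M \<noteq> 0" unfolding gL using neq[OF ij(3)] by (simp add: M_def)
    from detectable_nonzero[OF g this] show ?thesis by (rule detectable_mono) (simp add: gL)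
  qed
  have 3: "detectable (\<lambda>L. L i 0 * (L j 1 * L k 2 - L j 2 * L k 1) - L i 1 * (L j 0 * L k 2 - L j 2 * L k 0)
         + L i 2 * (L j 0 * L k 1 - L j 1 * L k 0) \<noteq> 0)"
    if n2: "n \<ge> 2" and ijk: "i \<in> {1..s}" "j \<in> {1..s}" "k \<in> {1..s}" "i \<noteq> j" "i \<noteq> k" "j \<noteq> k" for i j k
  proof -
    define e where "e a b c = entry_prod ((\<lambda>_. 0)(i := a, j := b, k := c))" for a b c
    define g where "g L = (e 0 1 2 L - e 0 2 1 L) - (e 1 0 2 L - e 1 2 0 L) + (e 2 0 1 L - e 2 1 0 L)" for L
    have gL: "g L = (L i 0 * (L j 1 * L k 2 - L j 2 * L k 1) - L i 1 * (L j 0 * L k 2 - L j 2 * L k 0)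
         + L i 2 * (L j 0 * L k 1 - L j 1 * L k 0)) * (\<Prod>l\<in>{1..s} - {i} - {j} - {k}. L l 0)" for L
      unfolding g_def e_def entry_prod_triple[OF ijk] by (simp add: algebra_simps)
    have g: "multihom 1 g" unfolding g_def[abs_def] e_def
      by (intro multihom_add multihom_diff multihom_entry_prod) (use n2 in auto)
    have "M i 0 * (M j 1 * M k 2 - M j 2 * M k 1) - M i 1 * (M j 0 * M k 2 - M j 2 * M k 0)
         + M i 2 * (M j 0 * M k 1 - M j 1 * M k 0) = (of_nat j - of_nat i) * (of_nat k - of_nat i) * (of_nat k - of_nat j)"
      by (simp add: M_def algebra_simps power2_eq_square)
    hence "g M \<noteq> 0" unfolding gL using neq[OF ijk(4)] neq[OF ijk(5)] neq[OF ijk(6)] by (simp add: M_def)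
    from detectable_nonzero[OF g this] show ?thesis by (rule detectable_mono) (simp add: gL)
  qed
  have "detectable (\<lambda>L. \<forall>i\<in>{1..s}. L i 0 \<noteq> 0)" by (intro detectable_Ball 1) auto
  moreover have "detectable (\<lambda>L. \<forall>i\<in>{1..s}. \<forall>j\<in>{1..s} - {i}. L i 0 * L j 1 - L i 1 * L j 0 \<noteq> 0)"
    by (intro detectable_Ball 2) auto
  moreover have "detectable (\<lambda>L. n \<ge> 2 \<longrightarrow> (\<forall>i\<in>{1..s}. \<forall>j\<in>{1..s} - {i}. \<forall>k\<in>{1..s} - {i, j}.
      L i 0 * (L j 1 * L k 2 - L j 2 * L k 1) - L i 1 * (L j 0 * L k 2 - L j 2 * L k 0)
         + L i 2 * (L j 0 * L k 1 - L j 1 * L k 0) \<noteq> 0))"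
  proof (cases "n \<ge> 2")
    case True
    have "detectable (\<lambda>L. \<forall>i\<in>{1..s}. \<forall>j\<in>{1..s} - {i}. \<forall>k\<in>{1..s} - {i, j}.
      L i 0 * (L j 1 * L k 2 - L j 2 * L k 1) - L i 1 * (L j 0 * L k 2 - L j 2 * L k 0)
         + L i 2 * (L j 0 * L k 1 - L j 1 * L k 0) \<noteq> 0)"
      by (intro detectable_Ball 3[OF True]) auto
    thus ?thesis by (rule detectable_mono) simp
  next
    case False
    \<comment> \<open>The condition on triples is vacuous here, and any detectable condition implies
      it.\<close>
    show ?thesis by (rule detectable_mono[OF calculation(1)]) (use False in simp)
  qed
  ultimately have "detectable (\<lambda>L. (\<forall>i\<in>{1..s}. L i 0 \<noteq> 0)
    \<and> (\<forall>i\<in>{1..s}. \<forall>j\<in>{1..s} - {i}. L i 0 * L j 1 - L i 1 * L j 0 \<noteq> 0)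
    \<and> (n \<ge> 2 \<longrightarrow> (\<forall>i\<in>{1..s}. \<forall>j\<in>{1..s} - {i}. \<forall>k\<in>{1..s} - {i, j}.
      L i 0 * (L j 1 * L k 2 - L j 2 * L k 1) - L i 1 * (L j 0 * L k 2 - L j 2 * L k 0)
         + L i 2 * (L j 0 * L k 1 - L j 1 * L k 0) \<noteq> 0)))"
    by (intro detectable_conj)
  thus ?thesis by (rule detectable_mono) (unfold general_def, blast)
qed

text \<open>The \<open>n * s + 1\<close> coordinates are jointly injective on the tangent space,
  which bounds its dimension from above.\<close>

definition coordinates_determine :: "(nat \<Rightarrow> nat \<Rightarrow> complex) \<Rightarrow> bool" where
  "coordinates_determine L \<longleftrightarrow>
     (\<forall>w. tangent (form_of L) w \<longrightarrow> (\<forall>k\<in>{0..n * s}. mp_eval (mpt k) w = 0) \<longrightarrow> w = 0)"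

lemma detectable_coordinates_determine: "detectable coordinates_determine"
proof (rule detectable_mono)
  show "detectable (\<lambda>L. \<forall>a\<in>idx. \<forall>w. tangent (form_of L) w \<longrightarrow>
    (\<forall>k\<in>{0..n * s}. mp_eval (mpt k) w = 0) \<longrightarrow> lookup w a = 0)"
  proof (rule detectable_Ball[OF finite_idx])
    fix a assume "a \<in> idx"
    from tangent_coefficient_form[OF this]
    show "detectable (\<lambda>L. \<forall>w. tangent (form_of L) w \<longrightarrow>
      (\<forall>k\<in>{0..n * s}. mp_eval (mpt k) w = 0) \<longrightarrow> lookup w a = 0)"
      unfolding detectable_def by blast
  qed
  fix L assume L: "\<forall>a\<in>idx. \<forall>w. tangent (form_of L) w \<longrightarrow>
    (\<forall>k\<in>{0..n * s}. mp_eval (mpt k) w = 0) \<longrightarrow> lookup w a = 0"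
  show "coordinates_determine L" unfolding coordinates_determine_def
  proof (intro allI impI)
    fix w assume w: "tangent (form_of L) w" "\<forall>k\<in>{0..n * s}. mp_eval (mpt k) w = 0"
    have wc: "w \<in> coord_space idx" using w(1) by (simp add: tangent_def forms_def)
    show "w = 0"
    proof (rule poly_mapping_eqI)
      fix a show "lookup w a = lookup 0 a"
        using L w coord_space_lookup[OF wc, of a] by (cases "a \<in> idx") auto
    qed
  qed
qed

section \<open>The tangent space at a generic point\<close>

definition unit_vec :: "nat \<Rightarrow> nat \<Rightarrow> complex" where
  "unit_vec j l = (if l = j then 1 else 0)"

lemma dot_unit_vec: "j \<le> n \<Longrightarrow> dot (unit_vec j) x = x j"
  by (simp add: dot_def unit_vec_def if_distrib[of "\<lambda>c. c * _"] cong: if_cong)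

lemma general_form_of_nonzero:
  assumes "general L" shows "form_of L \<noteq> 0"
proof
  assume "form_of L = 0"
  hence "(\<Prod>i\<in>{1..s}. dot (L i) (\<lambda>j. if j = 0 then 1 else if j = 1 then 0 else 0)) = 0"
    by (metis mp_eval_form_of mp_eval_zero)
  hence "\<exists>i\<in>{1..s}. L i 0 = 0" unfolding dot_two by (auto simp: prod_zero_iff)
  thus False using assms unfolding general_def by blast
qed

text \<open>A linearly independent family of size \<open>n s + 1\<close> in the tangent space, indexed by the
  pairs \<open>(i, j)\<close> with \<open>j \<ge> 1\<close> and, for the form itself, by \<open>(0, 0)\<close>.\<close>

definition tangent_vec :: "(nat \<Rightarrow> nat \<Rightarrow> complex) \<Rightarrow> nat \<times> nat \<Rightarrow> nat mpol" where
  "tangent_vec L = (\<lambda>(i, j). if i = 0 then form_of L else form_of (L(i := unit_vec j)))"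

definition tangent_index :: "(nat \<times> nat) set" where
  "tangent_index = insert (0, 0) ({1..s} \<times> {1..n})"

text \<open>At points of the hyperplane of \<open>L i\<close> off the others, only the terms that
  replace factor \<open>i\<close> survive. So the linear form \<open>a\<close> with coefficients
  \<open>l (i, k)\<close> vanishes on that hyperplane; as \<open>a 0 = 0\<close> but
  \<open>L i 0\<close> is nonzero, \<open>a\<close> is zero. This is why the index 0 is left out of
  the family.\<close>

lemma tangent_vec_independent:
  assumes L: "general L" and 0: "(\<Sum>p\<in>tangent_index. scale_pm (l p) (tangent_vec L p)) = 0"
    and p: "p \<in> tangent_index"
  shows "l p = 0"
proof -
  have split: "(\<Sum>p\<in>tangent_index. f p) = f (0, 0) + (\<Sum>i\<in>{1..s}. \<Sum>j\<in>{1..n}. f (i, j))" for f :: "nat \<times> nat \<Rightarrow> nat mpol"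
    unfolding tangent_index_def by (subst sum.insert) (auto simp: sum.cartesian_product)
  have ij: "l (i, j) = 0" if i: "i \<in> {1..s}" and j: "j \<in> {1..n}" for i j
  proof -
    define a where "a k = (if k \<in> {1..n} then l (i, k) else 0)" for k
    have dota: "dot a x = (\<Sum>k\<in>{1..n}. l (i, k) * x k)" for x
      unfolding dot_def by (rule sum.mono_neutral_cong_right) (auto simp: a_def)
    have a0: "dot a x = 0" if x: "dot (L i) x = 0" "\<forall>k\<in>{1..s} - {i}. dot (L k) x \<noteq> 0" for x
    proof -
      have row: "mp_eval x (tangent_vec L (i', k)) = x k * (\<Prod>m\<in>{1..s} - {i'}. dot (L m) x)"
        if "i' \<in> {1..s}" "k \<in> {1..n}" for i' k
        using that by (simp add: tangent_vec_def mp_eval_form_of_update dot_unit_vec)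
      have off: "(\<Prod>m\<in>{1..s} - {i'}. dot (L m) x) = 0" if "i' \<noteq> i" for i'
        by (rule prod_zero) (use that i x in auto)
      have "mp_eval x (form_of L) = 0" unfolding mp_eval_form_of by (rule prod_zero) (use i x in auto)
      hence F0: "mp_eval x (tangent_vec L (0, 0)) = 0" by (simp add: tangent_vec_def)
      have "0 = mp_eval x (\<Sum>p\<in>tangent_index. scale_pm (l p) (tangent_vec L p))" by (simp only: 0 mp_eval_zero)
      also have "\<dots> = (\<Sum>i'\<in>{1..s}. \<Sum>k\<in>{1..n}. l (i', k) * mp_eval x (tangent_vec L (i', k)))"
        unfolding split mp_eval_add mp_eval_sum mp_eval_scale F0 by (simp only: mult_zero_right add_0_left)
      also have "\<dots> = (\<Sum>i'\<in>{1..s}. \<Sum>k\<in>{1..n}. l (i', k) * (x k * (\<Prod>m\<in>{1..s} - {i'}. dot (L m) x)))"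
        by (intro sum.cong refl) (simp only: row)
      also have "\<dots> = (\<Sum>i'\<in>{i}. \<Sum>k\<in>{1..n}. l (i', k) * (x k * (\<Prod>m\<in>{1..s} - {i'}. dot (L m) x)))"
      proof (rule sum.mono_neutral_right)
        show "\<forall>i'\<in>{1..s} - {i}. (\<Sum>k\<in>{1..n}. l (i', k) * (x k * (\<Prod>m\<in>{1..s} - {i'}. dot (L m) x))) = 0"
        proof
          fix i' assume "i' \<in> {1..s} - {i}"
          hence "(\<Prod>m\<in>{1..s} - {i'}. dot (L m) x) = 0" by (intro off) simp
          thus "(\<Sum>k\<in>{1..n}. l (i', k) * (x k * (\<Prod>m\<in>{1..s} - {i'}. dot (L m) x))) = 0"
            by (simp only: mult_zero_right sum.neutral_const)
        qed
      qed (use i in auto)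
      also have "\<dots> = dot a x * (\<Prod>m\<in>{1..s} - {i}. dot (L m) x)"
        by (simp add: dota sum_distrib_right mult.assoc)
      finally show ?thesis using x(2) by (auto simp: prod_zero_iff)
    qed
    have ady: "dot a y = 0" if y: "dot (L i) y = 0" for y
    proof (rule ccontr)
      assume ay: "dot a y \<noteq> 0"
      have "\<exists>x\<in>{x. dot (L i) x = 0}. \<forall>c\<in>insert a (L ` ({1..s} - {i})). dot c x \<noteq> 0"
      proof (rule common_nonzero_point)
        show "{x. dot (L i) x = 0} \<noteq> {}" using y by blast
        fix c assume "c \<in> insert a (L ` ({1..s} - {i}))"
        then consider "c = a" | k where "c = L k" "k \<in> {1..s}" "i \<noteq> k" by blast
        thus "\<exists>x\<in>{x. dot (L i) x = 0}. dot c x \<noteq> 0"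
          using ay y general_pair_point[OF L i] by cases blast+
      qed (auto simp: dot_add_right dot_scale_right)
      thus False using a0 by blast
    qed
    \<comment> \<open>A vector of the hyperplane supported on the coordinates 0 and
      \<open>j\<close>; since \<open>a 0 = 0\<close>, it isolates \<open>l (i, j)\<close>.\<close>
    define y where "y k = (if k = 0 then - L i j else if k = j then L i 0 else 0)" for k
    have ydot: "dot c y = c j * L i 0 - c 0 * L i j" for c
    proof -
      have "dot c y = (\<Sum>k\<in>{0, j}. c k * y k)"
        unfolding dot_def by (rule sum.mono_neutral_right) (use j in \<open>auto simp: y_def\<close>)
      thus ?thesis using j by (simp add: y_def)
    qed
    have "dot (L i) y = 0" unfolding ydot by (simp add: mult.commute)
    hence "dot a y = 0" by (rule ady)
    hence "l (i, j) * L i 0 = 0" using j unfolding ydot by (simp add: a_def)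
    moreover have "L i 0 \<noteq> 0" using L i unfolding general_def by blast
    ultimately show ?thesis by simp
  qed
  have "scale_pm (l (0, 0)) (form_of L) = 0"
    using 0 ij unfolding split by (simp add: tangent_vec_def)
  hence "l (0, 0) = 0" using general_form_of_nonzero[OF L] by simp
  thus ?thesis using p ij by (auto simp: tangent_index_def)
qed

lemma tangent_span_tangent: "tangent_span L \<subseteq> {w. tangent (form_of L) w}"
  unfolding tangent_span_def
  by (rule pm.span_minimal[OF _ tangent_subspace]) (use tangent_form_of_update in auto)

text \<open>Joining \<open>w\<close> to the independent family gives \<open>n * s + 2\<close>
  vectors, so some nontrivial combination has all \<open>n * s + 1\<close> coordinates zero. It is
  tangent, hence zero, and independence of the family forces a nonzero coefficient at
  \<open>w\<close>.\<close>

lemma tangent_iff: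
  assumes L: "general L" and det: "coordinates_determine L"
  shows "tangent (form_of L) w \<longleftrightarrow> w \<in> tangent_span L"
proof
  assume "w \<in> tangent_span L"
  thus "tangent (form_of L) w" using tangent_span_tangent by blast
next
  assume w: "tangent (form_of L) w"
  have tv: "tangent_vec L p \<in> tangent_span L" if "p \<in> tangent_index" for p
  proof -
    from that consider "p = (0, 0)" | i j where "p = (i, j)" "i \<in> {1..s}" unfolding tangent_index_def by blast
    thus ?thesis
    proof cases
      case 1
      thus ?thesis using form_of_in_tangent_span by (simp add: tangent_vec_def)
    next
      case 2
      hence "tangent_vec L p = form_of (L(i := unit_vec j))" by (simp add: tangent_vec_def)
      thus ?thesis using 2(2) unfolding tangent_span_def by (intro pm.span_base) blast
    qed
  qed
  have tt: "tangent (form_of L) (tangent_vec L p)" if "p \<in> tangent_index" for p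
    using tv[OF that] tangent_span_tangent by blast
  define X where "X = insert None (Some ` tangent_index)"
  define v where "v = case_option w (tangent_vec L)"
  have finI: "finite tangent_index" by (simp add: tangent_index_def)
  have "card tangent_index = n * s + 1" by (simp add: tangent_index_def mult.commute)
  hence cardX: "card X = n * s + 2" using finI by (simp add: X_def card_image)
  have "\<exists>l. (\<exists>x\<in>X. l x \<noteq> 0) \<and> (\<forall>k\<in>{0..n * s}. (\<Sum>x\<in>X. l x * mp_eval (mpt k) (v x)) = 0)"
    by (rule homogeneous_system_nontrivial_solution) (use finI cardX in \<open>simp_all add: X_def\<close>)
  then obtain l where l: "\<exists>x\<in>X. l x \<noteq> 0" "\<And>k. k \<in> {0..n * s} \<Longrightarrow> (\<Sum>x\<in>X. l x * mp_eval (mpt k) (v x)) = 0"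
    by blast
  define u where "u = (\<Sum>x\<in>X. scale_pm (l x) (v x))"
  have "u \<in> {w. tangent (form_of L) w}" unfolding u_def
    by (intro pm.subspace_sum[OF tangent_subspace] pm.subspace_scale[OF tangent_subspace])
       (use w tt in \<open>auto simp: X_def v_def\<close>)
  moreover have "mp_eval (mpt k) u = 0" if "k \<in> {0..n * s}" for k
    using l(2)[OF that] by (simp add: u_def mp_eval_sum)
  ultimately have "u = 0" using det unfolding coordinates_determine_def by blast
  moreover have "u = scale_pm (l None) w + (\<Sum>p\<in>tangent_index. scale_pm (l (Some p)) (tangent_vec L p))"
    unfolding u_def X_def by (subst sum.insert) (auto simp: finI sum.reindex v_def)
  ultimately have rel: "scale_pm (l None) w + (\<Sum>p\<in>tangent_index. scale_pm (l (Some p)) (tangent_vec L p)) = 0" by simp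
  have "l None \<noteq> 0"
  proof
    assume "l None = 0"
    hence "(\<Sum>p\<in>tangent_index. scale_pm (l (Some p)) (tangent_vec L p)) = 0" using rel by simp
    hence "\<forall>p\<in>tangent_index. l (Some p) = 0"
      using tangent_vec_independent[OF L, of "\<lambda>p. l (Some p)"] by blast
    thus False using l(1) \<open>l None = 0\<close> by (auto simp: X_def)
  qed
  have "scale_pm (l None) w = - (\<Sum>p\<in>tangent_index. scale_pm (l (Some p)) (tangent_vec L p))"
    using rel by (simp add: eq_neg_iff_add_eq_0)
  also have "\<dots> \<in> tangent_span L"
    using tv unfolding tangent_span_def by (intro pm.span_neg pm.span_sum pm.span_scale) auto
  finally have "scale_pm (1 / l None) (scale_pm (l None) w) \<in> tangent_span L"
    unfolding tangent_span_def by (rule pm.span_scale)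
  thus "w \<in> tangent_span L" using \<open>l None \<noteq> 0\<close> by simp
qed

lemma embedded_tangent_space_eq:
  "embedded_tangent_space idx (decomposables n s) (proj_pt (form_of L))
    = {proj_pt w | w. w \<noteq> 0 \<and> tangent (form_of L) w}"
proof -
  have "(\<forall>d. \<forall>p\<in>vanishing_forms idx (decomposables n s) d. \<forall>v\<in>proj_pt (form_of L).
           (\<Sum>i\<in>idx. lookup w i * mp_eval (lookup v) (mp_deriv i p)) = 0)
     \<longleftrightarrow> (\<forall>d. \<forall>p\<in>vanishing_forms idx (decomposables n s) d.
           (\<Sum>i\<in>idx. lookup w i * mp_eval (lookup (form_of L)) (mp_deriv i p)) = 0)" for w
  proof (intro all_cong1 ball_cong refl)
    fix d p assume p: "p \<in> vanishing_forms idx (decomposables n s) d"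
    hence pf: "p \<in> forms idx d" by (simp add: vanishing_forms_iff)
    let ?S = "\<lambda>v. \<Sum>i\<in>idx. lookup w i * mp_eval (lookup v) (mp_deriv i p)"
    have "?S (scale_pm c (form_of L)) = c ^ (d - 1) * ?S (form_of L)" for c
      by (simp add: lookup_scale_pm[abs_def] mp_deriv_homog[OF pf] sum_distrib_left mult.left_commute)
    thus "(\<forall>v\<in>proj_pt (form_of L). ?S v = 0) \<longleftrightarrow> ?S (form_of L) = 0"
      using mem_proj_pt[of "form_of L"] by (auto simp: proj_pt_def)
  qed
  thus ?thesis unfolding embedded_tangent_space_def tangent_def forms_def by blast
qed

lemma zero_locus_superset_iff:
  assumes G: "G \<in> forms {..n} s"
  shows "double_locus n s (\<lambda>i. lin (L i)) \<subseteq> zero_locus n G \<longleftrightarrow>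
    (\<forall>i\<in>{1..s}. \<forall>j\<in>{1..s} - {i}. \<forall>x. dot (L i) x = 0 \<longrightarrow> dot (L j) x = 0 \<longrightarrow> mp_eval x G = 0)"
proof
  assume sub: "double_locus n s (\<lambda>i. lin (L i)) \<subseteq> zero_locus n G"
  show "\<forall>i\<in>{1..s}. \<forall>j\<in>{1..s} - {i}. \<forall>x. dot (L i) x = 0 \<longrightarrow> dot (L j) x = 0 \<longrightarrow> mp_eval x G = 0"
  proof (intro ballI allI impI)
    fix i j x assume ij: "i \<in> {1..s}" "j \<in> {1..s} - {i}" "dot (L i) x = 0" "dot (L j) x = 0"
    define v where "v = (\<Sum>j\<le>n. single j (x j))"
    have lv: "lookup v l = (if l \<le> n then x l else 0)" for l
      by (simp add: v_def lookup_sum_single)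
    have vx: "mp_eval (lookup v) G = mp_eval x G"
    proof (rule mp_eval_cong)
      fix m l assume "m \<in> keys G" "l \<in> keys m"
      hence "l \<le> n" using forms_keys[OF G] monomials_keys by blast
      thus "lookup v l = x l" by (simp add: lv)
    qed
    have dv: "dot a (lookup v) = dot a x" for a by (simp add: dot_def lv)
    show "mp_eval x G = 0"
    proof (cases "v = 0")
      \<comment> \<open>The zero vector gives no projective point, but a form of positive degree
        vanishes there.\<close>
      case True
      have "mp_eval (\<lambda>l. 0 * lookup v l) G = 0 ^ s * mp_eval (lookup v) G"
        by (rule mp_eval_homog[OF G])
      moreover have "(\<lambda>l. 0 * lookup v l) = lookup v" using True by (simp add: fun_eq_iff)
      moreover have "(0::complex) ^ s = 0" using s by simp
      ultimately show ?thesis by (simp add: vx)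
    next
      case False
      have "v \<in> coord_space {..n}" by (rule coord_spaceI) (simp add: lv)
      hence z: "proj_pt v \<in> proj_space {..n}" using False by (auto simp: proj_space_def)
      have "proj_pt v \<in> zero_locus n (lin (L i)) \<inter> zero_locus n (lin (L j))"
        using ij(3,4) by (simp add: mem_proj_space_zero_locus[OF z mem_proj_pt] dv)
      hence "proj_pt v \<in> zero_locus n G" using sub ij(1,2) unfolding double_locus_def by blast
      hence "mp_eval (lookup v) G = 0"
        using mem_proj_pt[of v] unfolding zero_locus_def vanishes_at_def by blast
      thus ?thesis by (simp add: vx)
    qed
  qed
next
  assume van: "\<forall>i\<in>{1..s}. \<forall>j\<in>{1..s} - {i}. \<forall>x. dot (L i) x = 0 \<longrightarrow> dot (L j) x = 0 \<longrightarrow> mp_eval x G = 0"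
  show "double_locus n s (\<lambda>i. lin (L i)) \<subseteq> zero_locus n G"
  proof
    fix z assume "z \<in> double_locus n s (\<lambda>i. lin (L i))"
    then obtain i j where ij: "i \<in> {1..s}" "j \<in> {1..s} - {i}" "z \<in> zero_locus n (lin (L i))" "z \<in> zero_locus n (lin (L j))"
      unfolding double_locus_def by blast
    have "mp_eval (lookup v) G = 0" if "v \<in> z" for v
      using van ij that unfolding zero_locus_lin by blast
    thus "z \<in> zero_locus n G" using ij(3) by (simp add: zero_locus_def vanishes_at_def)
  qed
qed

lemma tangent_space_eq_hypersurfaces:
  assumes "general L" "coordinates_determine L"
  shows "embedded_tangent_space idx (decomposables n s) (proj_pt (form_of L))
    = hypersurfaces_through n s (double_locus n s (\<lambda>i. lin (L i)))"
proof -
  have "tangent (form_of L) w \<longleftrightarrow> w \<in> forms {..n} s \<and> double_locus n s (\<lambda>i. lin (L i)) \<subseteq> zero_locus n w" for w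
    using tangent_iff[OF assms, of w] mem_tangent_span_iff[OF assms(1), of w] zero_locus_superset_iff[of w L]
    by (auto simp: tangent_def)
  thus ?thesis unfolding embedded_tangent_space_eq hypersurfaces_through_def by auto
qed

lemma generic_tangent_space:
  "\<exists>U. proj_open_in idx (decomposables n s) U \<and> U \<noteq> {} \<and>
        (\<forall>F\<in>U. \<forall>L. (\<forall>i\<in>{1..s}. L i \<in> forms {..n} 1) \<and> F = proj_pt (\<Prod>i\<in>{1..s}. L i) \<longrightarrow>
           embedded_tangent_space idx (decomposables n s) F
             = hypersurfaces_through n s (double_locus n s L))"
proof -
  obtain d P where P: "P \<in> forms idx d" "\<exists>L. pull P L \<noteq> 0"
    "\<And>L. pull P L \<noteq> 0 \<Longrightarrow> general L \<and> coordinates_determine L"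
    using detectable_conj[OF detectable_general detectable_coordinates_determine] unfolding detectable_def by blast
  define C where "C = {z \<in> proj_space idx. \<forall>p\<in>{P}. vanishes_at p z}"
  define U where "U = decomposables n s - C"
  have "proj_closed idx C" unfolding proj_closed_def C_def using P(1) by blast
  hence "proj_open_in idx (decomposables n s) U" unfolding proj_open_in_def U_def by blast
  moreover have "U \<noteq> {}"
  proof -
    obtain L where L: "pull P L \<noteq> 0" using P(2) by blast
    hence "form_of L \<noteq> 0" using P(3) general_form_of_nonzero by blast
    hence "proj_pt (form_of L) \<in> decomposables n s" by (auto simp: decomposables_eq)
    moreover have "\<not> vanishes_at P (proj_pt (form_of L))"
      using L mem_proj_pt[of "form_of L"] unfolding vanishes_at_def pull_def by blast
    ultimately show ?thesis unfolding U_def C_def by blast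
  qed
  moreover have "embedded_tangent_space idx (decomposables n s) F = hypersurfaces_through n s (double_locus n s L)"
    if F: "F \<in> U" "\<forall>i\<in>{1..s}. L i \<in> forms {..n} 1" "F = proj_pt (\<Prod>i\<in>{1..s}. L i)" for F L
  proof -
    define A where "A i j = lookup (L i) (single j 1)" for i j
    have LA: "L i = lin (A i)" if "i \<in> {1..s}" for i
      unfolding A_def by (rule form_eq_lin) (use F(2) that in blast)
    hence FA: "F = proj_pt (form_of A)" unfolding F(3) form_of_def by simp
    have "decomposables n s \<subseteq> proj_space idx"
      unfolding decomposables_def proj_space_def forms_def by blast
    hence "\<not> vanishes_at P F" using F(1) unfolding U_def C_def by blast
    then obtain c where "mp_eval (lookup (scale_pm c (form_of A))) P \<noteq> 0"
      unfolding FA vanishes_at_def proj_pt_def by blast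
    \<comment> \<open>\<open>P\<close> only sees the product, so the conditions hold for the given
      factorization, whichever it is.\<close>
    hence "pull P A \<noteq> 0" unfolding pull_homog[OF P(1)] by simp
    hence "general A" "coordinates_determine A" using P(3) by auto
    hence "embedded_tangent_space idx (decomposables n s) F = hypersurfaces_through n s (double_locus n s (\<lambda>i. lin (A i)))"
      unfolding FA by (rule tangent_space_eq_hypersurfaces)
    moreover have "double_locus n s (\<lambda>i. lin (A i)) = double_locus n s L"
      unfolding double_locus_def using LA by (intro SUP_cong refl) auto
    ultimately show ?thesis by simp
  qed
  ultimately show ?thesis by blast
qed

end

theorem proposition3p4:
  fixes n s :: nat
  assumes "n \<ge> 1" and "s \<ge> 1"
  shows
    "(\<exists>U. proj_open_in (monomials {..n} s) (decomposables n s) U \<and> U \<noteq> {} \<and>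
        (\<forall>F\<in>U. \<forall>L. (\<forall>i\<in>{1..s}. L i \<in> forms {..n} 1) \<and> F = proj_pt (\<Prod>i\<in>{1..s}. L i) \<longrightarrow>
           embedded_tangent_space (monomials {..n} s) (decomposables n s) F
             = hypersurfaces_through n s (double_locus n s L)))
     \<and> (\<exists>W. multiproj_open {1..n * s} {..n} W \<and> W \<noteq> {} \<and>
        (\<forall>p\<in>W. finite (hyperplane_tuples_through n s (p ` {1..n * s})) \<and>
           proj_degree (monomials {..n} s) (decomposables n s)
             = of_nat (card (hyperplane_tuples_through n s (p ` {1..n * s})))))
     \<and> proj_degree (monomials {..n} s) (decomposables n s)
         = of_nat (\<Prod>j = 0..<s. (n * (s - j) - 1) choose (n - 1))
     \<and> (\<Prod>j = 0..<s. (n * (s - j) - 1) choose (n - 1))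
         = (\<Prod>k = 1..s. (n * k - 1) choose (n - 1))"
proof -
  interpret split_forms n s by unfold_locales (rule assms)+
  have prod: "(\<Prod>j = 0..<s. (n * (s - j) - 1) choose (n - 1)) = (\<Prod>k = 1..s. (n * k - 1) choose (n - 1))"
    by (rule prod.reindex_bij_witness[of _ "\<lambda>k. s - k" "\<lambda>j. s - j"]) auto
  have deg: "proj_degree (monomials {..n} s) (decomposables n s) = of_nat num_blocks"
    by (rule proj_degree_decomposables)
  obtain W where W: "multiproj_open {1..n * s} {..n} W" "W \<noteq> {}"
    "\<forall>p\<in>W. finite (hyperplane_tuples_through n s (p ` {1..n * s}))
       \<and> card (hyperplane_tuples_through n s (p ` {1..n * s})) = num_blocks"
    using generic_points by blast
  show ?thesis
  proof (intro conjI)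
    show "\<exists>W. multiproj_open {1..n * s} {..n} W \<and> W \<noteq> {} \<and>
        (\<forall>p\<in>W. finite (hyperplane_tuples_through n s (p ` {1..n * s})) \<and>
           proj_degree (monomials {..n} s) (decomposables n s)
             = of_nat (card (hyperplane_tuples_through n s (p ` {1..n * s}))))"
      by (intro exI[of _ W] conjI W(1,2)) (use W(3) deg in simp)
    show "proj_degree (monomials {..n} s) (decomposables n s)
         = of_nat (\<Prod>j = 0..<s. (n * (s - j) - 1) choose (n - 1))"
      unfolding prod deg num_blocks_def ..
  qed (rule generic_tangent_space prod)+
qed

end
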